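(* Let $N\ge1$ be an integer, let $a_1,\dots,a_N$ be arbitrary real coefficients, and for $q=1,2$ let $Q_N^{(q)}=\sum_{m,n\le N}a_m a_n\,G^{(q)}_{m,n}$. For $j=0,1,2$ put $$L_j=\sum_{n\le N}\frac{a_n}{n}\log^j n,\qquad M_j=\sum_{n\le N}a_n\log^j n,$$ and for $q=1,2$ put $$E^{(q)}=\sum_{m\le N}\frac{a_m}{m}\left(\sum_{n\le N}a_n\,S_q(n/m)-R_q(1/m)\right).$$ Then $$Q_N^{(1)}=M_0\left(K L_0+\frac12(L_1+1)\right)-\frac12M_1L_0+(\gamma-1)L_0-L_1+E^{(1)},$$ and $$Q_N^{(2)}=M_0\left(K_2L_0+K_1(L_1+1)+\frac14(2\gamma+L_2)\right)-\frac12M_1\left(2K_1L_0+L_1+1\right)+\frac14M_2L_0+(2\gamma+\gamma_1-3)L_0+\frac12\left(2\gamma L_1-L_2\right)-2L_1+E^{(2)}.$$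
   Context: For $q=1,2$ and $u,v>0$, $$G^{(q)}_{u,v}=\frac{1}{2\pi i}\int_{\Re(s)=1/2}u^{-s}\,v^{-(1-s)}\,\frac{\zeta(s)\zeta(1-s)}{s^q(1-s)^q}\,ds,$$ where $\zeta$ is the Riemann zeta function and the line is traversed upwards. $H(x)=\sum_{1\le k\le x}1/k$ for $x>0$ (empty sums are $0$), $\{x\}=x-\lfloor x\rfloor$ is the fractional part, $\log^j x=(\log x)^j$ (with $\log^0 n=1$), and $\gamma$, $\gamma_1$ are the first two Stieltjes constants: $\zeta(s)=\frac1{s-1}+\gamma-\gamma_1(s-1)+O((s-1)^2)$ as $s\to1$. For $x>0$, $$R_1(x)=\log x+\gamma-H(x)-\frac{\{x\}-1/2}{x},$$ $$R_2(x)=\frac1x\left(\frac12\log 2\pi+1+\frac12\log x\right)+(2-\gamma)\log x-\frac12\log^2x+2\gamma+\gamma_1-3+\frac1x\sum_{1\le\ell\le x}\left[\left(1+\frac x\ell\right)\log\frac x\ell+2\left(1-\frac x\ell\right)\right],$$ and $S_q(x)=\sum_{k\ge1}R_q(kx)$ for $q=1,2$ (absolutely convergent for every $x>0$). The constants are $K=(\log 2\pi-\gamma+1)/2$, $K_1=(\log 2\pi-\gamma+2)/2$, and $K_2=\left(1-\frac{\gamma}{2}\right)\log 2\pi+\frac14\log^2 2\pi+\frac{\pi^2}{48}-\frac{\gamma^2}{4}-\gamma-\gamma_1+\frac32$. *)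

theory Defs
  imports "HOL-Complex_Analysis.Complex_Analysis"
begin

text \<open>
  The Riemann zeta function, as the analytic continuation of its Dirichlet series to the plane
  punctured at 1. The identity theorem determines the chosen function at every point other
  than 1; its value at 1 is arbitrary and plays no role below.
\<close>

definition zeta :: "complex \<Rightarrow> complex" where
  "zeta = (SOME f. f holomorphic_on (- {1}) \<and>
             (\<forall>s. Re s > 1 \<longrightarrow> (\<lambda>n. of_nat (Suc n) powr (- s)) sums f s))"

text \<open>
  Normalised as usual: the coefficient of \<open>(s - 1) ^ n\<close> in the Laurent series of zeta at 1 is
  \<open>(-1) ^ n * stieltjes n / fact n\<close>. These coefficients are real.
\<close>

definition stieltjes :: "nat \<Rightarrow> real" where
  "stieltjes n = (-1) ^ n * fact n * Re (fls_nth (laurent_expansion zeta 1) (int n))"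

abbreviation \<gamma>0 :: real where "\<gamma>0 \<equiv> stieltjes 0"
abbreviation \<gamma>1 :: real where "\<gamma>1 \<equiv> stieltjes 1"

text \<open>
  The upward line integral over \<open>Re s = 1/2\<close>, parametrised by \<open>s = 1/2 + \<i> t\<close>, so that
  \<open>ds = \<i> dt\<close>; it converges absolutely for \<open>q \<ge> 1\<close>.
\<close>

definition G_integrand :: "nat \<Rightarrow> real \<Rightarrow> real \<Rightarrow> complex \<Rightarrow> complex" where
  "G_integrand q u v s =
     of_real u powr (- s) * of_real v powr (- (1 - s)) *
     (zeta s * zeta (1 - s) / (s ^ q * (1 - s) ^ q))"

definition G :: "nat \<Rightarrow> real \<Rightarrow> real \<Rightarrow> complex" where
  "G q u v = 1 / (2 * of_real pi * \<i>) *
     (\<integral>t. G_integrand q u v (Complex (1/2) t) * \<i> \<partial>lborel)"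

definition H :: "real \<Rightarrow> real" where
  "H x = harm (nat \<lfloor>x\<rfloor>)"

definition R1 :: "real \<Rightarrow> real" where
  "R1 x = ln x + \<gamma>0 - H x - (frac x - 1/2) / x"

definition R2 :: "real \<Rightarrow> real" where
  "R2 x = 1 / x * (1/2 * ln (2 * pi) + 1 + 1/2 * ln x) + (2 - \<gamma>0) * ln x
          - 1/2 * (ln x)\<^sup>2 + 2 * \<gamma>0 + \<gamma>1 - 3
          + 1 / x * (\<Sum>l = 1..nat \<lfloor>x\<rfloor>.
              (1 + x / real l) * ln (x / real l) + 2 * (1 - x / real l))"

definition S1 :: "real \<Rightarrow> real" where
  "S1 x = (\<Sum>k. R1 (real (Suc k) * x))"

definition S2 :: "real \<Rightarrow> real" where
  "S2 x = (\<Sum>k. R2 (real (Suc k) * x))"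

definition K :: real where
  "K = (ln (2 * pi) - \<gamma>0 + 1) / 2"

definition K1 :: real where
  "K1 = (ln (2 * pi) - \<gamma>0 + 2) / 2"

definition K2 :: real where
  "K2 = (1 - \<gamma>0 / 2) * ln (2 * pi) + 1/4 * (ln (2 * pi))\<^sup>2 + pi\<^sup>2 / 48
        - \<gamma>0\<^sup>2 / 4 - \<gamma>0 - \<gamma>1 + 3/2"

end

(*
  On 0 < Re s < 1 one has -zeta(s)/s = \<integral> {w} w^(-s-1) dw over w > 0, so the Fourier transform of
  \<phi>(y) = {e^y} e^(-y/2) at t is -zeta(s)/s with s = 1/2 + it. Fourier inversion of its squared modulus
  turns G_{u,v} for q = 1 into A(v/u)/v, where A(x) = \<integral> {w}{xw} w^(-2) dw is Vasyunin's autocorrelation.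
  For q = 2 the additional factor 1/(s(1-s)) = 1/(1/4+t^2) is the transform of e^(-|y|/2), and the resulting
  convolution is (1/u) (1/x \<integral>_0^x A(t)/t dt + \<integral>_x^oo A(t)/t^2 dt) with x = v/u.

  Expressing R_1 and R_2 by Euler-Maclaurin tails gives A(x) = x S_1(x) + K + (log x)/2, and integrating this
  identity yields S_2 up to one constant. The constant is found by letting x tend to infinity; it involves
  \<integral> B_2({w}) log w / w^2 dw, that is zeta''(0), which the functional equation expresses by the Stieltjes
  constants. In the quadratic form everything but the double sums then splits into products M_i L_j, and
  floor(1/m) = 0 for m > 1 makes R_q(1/m) elementary, which accounts for the terms linear in the coefficients.
*)
theory Submission
  imports Defs "HOL-Probability.Probability" "HOL-Real_Asymp.Real_Asymp"
begin

section \<open>Fourier inversion for autocorrelations\<close>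

text \<open>No bound for zeta on the critical line enters. That the squared modulus of the transform
  is integrable follows from its sign: Gaussian damping gives uniformly bounded integrals of
  nonnegative functions, and Fatou's lemma removes the damping. \<open>zeta\<close> is a choice
  among functions on the whole plane without 1, so its defining property becomes available only once
  one such function is exhibited. Second order Euler-Maclaurin reaches Re s > -1, and the functional
  equation supplies the rest. The same equation, expanded at 0, yields zeta'(0), hence Stirling's
  constant, besides zeta''(0). It is proved first for real s in (-1, 0), where all integrands are
  nonnegative and Tonelli's theorem needs no convergence check. Some remainders are integrals of a
  sawtooth against 1/w or ln w / w, which converge only conditionally; passing to the continuous
  antiderivative \<open>ppar\<close> makes everything absolutely convergent.\<close>

lemma integral_std_normal_density_iexp:
  "(\<integral>u. std_normal_density u *\<^sub>R iexp (t * u) \<partial>lborel) = complex_of_real (exp (- (t\<^sup>2) / 2))"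
proof -
  have "char std_normal_distribution t = (\<integral>u. std_normal_density u *\<^sub>R iexp (t * u) \<partial>lborel)"
    unfolding char_def by (subst integral_density) (auto simp: normal_density_nonneg)
  thus ?thesis by (simp add: char_std_normal_distribution)
qed

lemma integral_scaled_gaussian_iexp:
  assumes "\<epsilon> > 0"
  shows "(\<integral>t. std_normal_density (\<epsilon> * t) *\<^sub>R iexp (t * a) \<partial>lborel)
           = complex_of_real (exp (- ((a / \<epsilon>)\<^sup>2) / 2) / \<epsilon>)"
proof -
  have "(\<integral>u. std_normal_density u *\<^sub>R iexp ((a/\<epsilon>) * u) \<partial>lborel)
        = \<bar>\<epsilon>\<bar> *\<^sub>R (\<integral>t. std_normal_density (0 + \<epsilon> * t) *\<^sub>R iexp ((a/\<epsilon>) * (0 + \<epsilon> * t)) \<partial>lborel)"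
    by (rule lborel_integral_real_affine) (use assms in auto)
  also have "(\<lambda>t. std_normal_density (0 + \<epsilon> * t) *\<^sub>R iexp ((a/\<epsilon>) * (0 + \<epsilon> * t)))
     = (\<lambda>t. std_normal_density (\<epsilon> * t) *\<^sub>R iexp (t * a))"
    using assms by (simp add: field_simps)
  finally show ?thesis
    using assms unfolding integral_std_normal_density_iexp
    by (simp add: scaleR_conv_of_real field_simps)
qed

lemma integrable_scaled_gaussian:
  assumes "\<epsilon> > 0"
  shows "integrable lborel (\<lambda>t. std_normal_density (\<epsilon> * t))"
proof -
  have "integrable lborel (\<lambda>t. std_normal_density (0 + \<epsilon> * t))"
    by (rule lborel_integrable_real_affine) (use assms in auto)
  thus ?thesis by simp
qed

lemma integral_exp_neg_sq_half:
  "(\<integral>z. exp (- (z\<^sup>2) / 2) \<partial>lborel) = sqrt (2 * pi)" (is ?A)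
  "integrable lborel (\<lambda>z::real. exp (- (z\<^sup>2) / 2))" (is ?B)
proof -
  have eq: "(\<lambda>z. exp (- (z\<^sup>2) / 2)) = (\<lambda>z. sqrt (2 * pi) * std_normal_density z)"
    by (simp add: std_normal_density_def)
  show ?B unfolding eq by auto
  show ?A unfolding eq by (auto simp: integral_normal_density)
qed

text \<open>The Gaussian factor makes the double integral of h(y) against the damped character
  absolutely convergent, so the order of integration may be exchanged. The inner t-integral is then
  a Gaussian of width \<open>\<epsilon>\<close> centred at r, and y = r + \<epsilon> z normalises
  it. Nothing is presupposed about integrability of \<open>hh\<close>.\<close>

lemma gaussian_smoothing_identity:
  fixes h :: "real \<Rightarrow> real" and hh :: "real \<Rightarrow> complex"
  assumes int [measurable]: "integrable lborel h"
    and hat: "\<And>t. hh t = (\<integral>y. h y *\<^sub>R iexp (- (t * y)) \<partial>lborel)"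
    and e: "\<epsilon> > 0"
  shows "(\<integral>t. hh t * (std_normal_density (\<epsilon> * t) *\<^sub>R iexp (t * r)) \<partial>lborel)
           = complex_of_real (\<integral>z. h (r + \<epsilon> * z) * exp (- (z\<^sup>2) / 2) \<partial>lborel)"
proof -
  have [measurable]: "h \<in> borel_measurable borel" using int by auto
  let ?k = "\<lambda>t y. h y *\<^sub>R (std_normal_density (\<epsilon> * t) *\<^sub>R iexp (t * (r - y)))"
  have ik: "integrable (lborel \<Otimes>\<^sub>M lborel) (case_prod ?k)"
  proof (rule integrableI_bounded)
    have "(\<integral>\<^sup>+x. ennreal (norm (case_prod ?k x)) \<partial>(lborel \<Otimes>\<^sub>M lborel))
        = (\<integral>\<^sup>+t. (\<integral>\<^sup>+y. ennreal \<bar>h y\<bar> * ennreal (std_normal_density (\<epsilon> * t)) \<partial>lborel) \<partial>lborel)"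
      by (subst lborel.nn_integral_fst [symmetric])
         (auto simp: norm_mult ennreal_mult abs_mult normal_density_nonneg intro!: nn_integral_cong)
    also have "\<dots> = (\<integral>\<^sup>+y. ennreal \<bar>h y\<bar> \<partial>lborel) * (\<integral>\<^sup>+t. ennreal (std_normal_density (\<epsilon> * t)) \<partial>lborel)"
      by (simp add: nn_integral_multc nn_integral_cmult)
    also have "\<dots> < \<infinity>"
      using int integrable_scaled_gaussian[OF e]
      by (auto simp: integrable_iff_bounded ennreal_mult_less_top normal_density_nonneg)
    finally show "(\<integral>\<^sup>+x. ennreal (norm (case_prod ?k x)) \<partial>(lborel \<Otimes>\<^sub>M lborel)) < \<infinity>" .
  qed auto
  have "(\<integral>t. hh t * (std_normal_density (\<epsilon> * t) *\<^sub>R iexp (t * r)) \<partial>lborel)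
      = (\<integral>t. (\<integral>y. ?k t y \<partial>lborel) \<partial>lborel)"
    unfolding hat
  proof (rule Bochner_Integration.integral_cong[OF refl])
    fix t
    have "(\<integral>y. h y *\<^sub>R iexp (- (t * y)) \<partial>lborel) * (std_normal_density (\<epsilon> * t) *\<^sub>R iexp (t * r))
       = (\<integral>y. (h y *\<^sub>R iexp (- (t * y))) * (std_normal_density (\<epsilon> * t) *\<^sub>R iexp (t * r)) \<partial>lborel)"
      by (rule integral_mult_left_zero [symmetric])
    also have "\<dots> = (\<integral>y. ?k t y \<partial>lborel)"
      by (intro Bochner_Integration.integral_cong refl)
         (simp add: scaleR_conv_of_real algebra_simps exp_add exp_diff exp_minus field_simps)
    finally show "(\<integral>y. h y *\<^sub>R iexp (- (t * y)) \<partial>lborel) * (std_normal_density (\<epsilon> * t) *\<^sub>R iexp (t * r)) = (\<integral>y. ?k t y \<partial>lborel)" .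
  qed
  also have "\<dots> = (\<integral>y. (\<integral>t. ?k t y \<partial>lborel) \<partial>lborel)"
    using lborel_pair.Fubini_integral[OF ik] by simp
  also have "\<dots> = (\<integral>y. complex_of_real (h y * (exp (- (((r - y) / \<epsilon>)\<^sup>2) / 2) / \<epsilon>)) \<partial>lborel)"
  proof (rule Bochner_Integration.integral_cong[OF refl])
    fix y
    have "(\<integral>t. ?k t y \<partial>lborel) = h y *\<^sub>R (\<integral>t. std_normal_density (\<epsilon> * t) *\<^sub>R iexp (t * (r - y)) \<partial>lborel)"
      by (rule integral_scaleR_right)
    thus "(\<integral>t. ?k t y \<partial>lborel) = complex_of_real (h y * (exp (- (((r - y) / \<epsilon>)\<^sup>2) / 2) / \<epsilon>))"
      unfolding integral_scaled_gaussian_iexp[OF e] by (simp add: scaleR_conv_of_real)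
  qed
  also have "\<dots> = complex_of_real (\<integral>y. h y * (exp (- (((r - y) / \<epsilon>)\<^sup>2) / 2) / \<epsilon>) \<partial>lborel)"
    by (rule integral_complex_of_real)
  also have "(\<integral>y. h y * (exp (- (((r - y) / \<epsilon>)\<^sup>2) / 2) / \<epsilon>) \<partial>lborel)
     = \<bar>\<epsilon>\<bar> *\<^sub>R (\<integral>z. h (r + \<epsilon> * z) * (exp (- (((r - (r + \<epsilon> * z)) / \<epsilon>)\<^sup>2) / 2) / \<epsilon>) \<partial>lborel)"
    by (rule lborel_integral_real_affine) (use e in auto)
  also have "(\<lambda>z. h (r + \<epsilon> * z) * (exp (- (((r - (r + \<epsilon> * z)) / \<epsilon>)\<^sup>2) / 2) / \<epsilon>))
     = (\<lambda>z. h (r + \<epsilon> * z) * exp (- (z\<^sup>2) / 2) / \<epsilon>)"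
    using e by simp
  also have "\<bar>\<epsilon>\<bar> *\<^sub>R (\<integral>z. h (r + \<epsilon> * z) * exp (- (z\<^sup>2) / 2) / \<epsilon> \<partial>lborel)
     = (\<integral>z. h (r + \<epsilon> * z) * exp (- (z\<^sup>2) / 2) \<partial>lborel)"
    unfolding integral_divide_zero using e by simp
  finally show ?thesis .
qed

text \<open>Positivity takes the place of an integrability assumption on the transform: at the
  origin the smoothed integrals stay below a bound depending only on the supremum of
  \<open>h\<close>, so Fatou's lemma applies to \<open>hh\<close>. Once \<open>hh\<close> is known
  to be integrable, the width tends to 0 by dominated convergence on both sides of the smoothing
  identity, and continuity of \<open>h\<close> gives the formula at every point.\<close>

theorem fourier_inversion_nonneg:
  fixes h hh :: "real \<Rightarrow> real"
  assumes int: "integrable lborel h"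
    and bdd: "\<And>y. \<bar>h y\<bar> \<le> B" and cont: "continuous_on UNIV h"
    and hat: "\<And>t. complex_of_real (hh t) = (\<integral>y. h y *\<^sub>R iexp (- (t * y)) \<partial>lborel)"
    and nonneg: "\<And>t. hh t \<ge> 0" and meas [measurable]: "hh \<in> borel_measurable borel"
  shows "integrable lborel hh" (is ?A)
    and "(\<integral>t. hh t *\<^sub>R iexp (t * r) \<partial>lborel) = complex_of_real (2 * pi * h r)" (is ?B)
proof -
  define e where "e = (\<lambda>n. 1 / real (Suc n))"
  have e_pos: "e n > 0" for n by (simp add: e_def)
  have e_lim: "e \<longlonglongrightarrow> 0" unfolding e_def using LIMSEQ_inverse_real_of_nat by (simp add: field_simps)
  have [measurable]: "h \<in> borel_measurable borel" using int by auto
  have B0: "B \<ge> 0" using bdd[of 0] by auto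
  have d_lim: "(\<lambda>n. std_normal_density (e n * t)) \<longlonglongrightarrow> 1 / sqrt (2 * pi)" for t
  proof -
    have "(\<lambda>n. 1 / sqrt (2 * pi) * exp (- (e n * t)\<^sup>2 / 2)) \<longlonglongrightarrow> 1 / sqrt (2 * pi) * exp (- (0 * t)\<^sup>2 / 2)"
      by (intro tendsto_intros e_lim) auto
    thus ?thesis by (simp add: std_normal_density_def)
  qed
  have d_bd: "std_normal_density x \<le> 1" for x
  proof -
    have "sqrt (2 * pi) \<ge> 1" using pi_ge_two by (simp add: real_le_rsqrt)
    moreover have "exp (- x\<^sup>2 / 2) \<le> 1" by simp
    ultimately show ?thesis
      unfolding std_normal_density_def by (intro mult_le_one) (auto simp: field_simps)
  qed
  have hh_bd: "hh t \<le> (\<integral>y. \<bar>h y\<bar> \<partial>lborel)" for t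
  proof -
    have "hh t = norm (complex_of_real (hh t))" using nonneg[of t] by simp
    also have "\<dots> \<le> (\<integral>y. norm (h y *\<^sub>R iexp (- (t * y))) \<partial>lborel)"
      unfolding hat by (rule integral_norm_bound)
    also have "\<dots> = (\<integral>y. \<bar>h y\<bar> \<partial>lborel)" by simp
    finally show ?thesis .
  qed
  have int_d: "integrable lborel (\<lambda>t. hh t * std_normal_density (e n * t))" for n
    by (rule Bochner_Integration.integrable_bound
          [OF integrable_mult_right[OF integrable_scaled_gaussian[OF e_pos[of n]], of "\<integral>y. \<bar>h y\<bar> \<partial>lborel"]])
       (use nonneg hh_bd in \<open>auto simp: abs_mult normal_density_nonneg intro!: mult_right_mono\<close>)
  have id: "(\<integral>t. complex_of_real (hh t) * (std_normal_density (e n * t) *\<^sub>R iexp (t * r)) \<partial>lborel)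
     = complex_of_real (\<integral>z. h (r + e n * z) * exp (- (z\<^sup>2) / 2) \<partial>lborel)" for n r
    by (rule gaussian_smoothing_identity[OF int hat e_pos])
  \<comment> \<open>At the origin the character is 1, and the right-hand side of the smoothing
    identity is an average of \<open>h\<close> against a Gaussian of mass sqrt (2 pi), whatever the
    width.\<close>
  have bd: "(\<integral>t. hh t * std_normal_density (e n * t) \<partial>lborel) \<le> B * sqrt (2 * pi)" for n
  proof -
    have "complex_of_real (\<integral>t. hh t * std_normal_density (e n * t) \<partial>lborel)
       = complex_of_real (\<integral>z. h (0 + e n * z) * exp (- (z\<^sup>2) / 2) \<partial>lborel)"
      using id[of n 0] by (simp add: scaleR_conv_of_real flip: integral_complex_of_real)
    hence "(\<integral>t. hh t * std_normal_density (e n * t) \<partial>lborel)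
       = (\<integral>z. h (0 + e n * z) * exp (- (z\<^sup>2) / 2) \<partial>lborel)" by (simp only: of_real_eq_iff)
    also have "\<dots> \<le> (\<integral>z. B * exp (- (z\<^sup>2) / 2) \<partial>lborel)"
    proof (rule integral_mono)
      show "integrable lborel (\<lambda>z. B * exp (- (z\<^sup>2) / 2))" using integral_exp_neg_sq_half by auto
      show "integrable lborel (\<lambda>z. h (0 + e n * z) * exp (- (z\<^sup>2) / 2))"
        by (rule Bochner_Integration.integrable_bound[OF \<open>integrable lborel (\<lambda>z. B * exp (- (z\<^sup>2) / 2))\<close>])
           (use bdd B0 in \<open>auto simp: abs_mult intro!: mult_right_mono\<close>)
    qed (use bdd in \<open>auto intro!: mult_right_mono intro: order_trans[OF abs_ge_self]\<close>)
    also have "\<dots> = B * sqrt (2 * pi)" using integral_exp_neg_sq_half by simp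
    finally show ?thesis .
  qed
  show A: ?A
  proof (rule integrableI_bounded)
    have "(\<integral>\<^sup>+t. ennreal (hh t * (1 / sqrt (2 * pi))) \<partial>lborel)
        = (\<integral>\<^sup>+t. liminf (\<lambda>n. ennreal (hh t * std_normal_density (e n * t))) \<partial>lborel)"
    proof (rule nn_integral_cong)
      fix t
      have "(\<lambda>n. ennreal (hh t * std_normal_density (e n * t))) \<longlonglongrightarrow> ennreal (hh t * (1 / sqrt (2 * pi)))"
        by (intro tendsto_ennrealI tendsto_mult d_lim tendsto_const)
      thus "ennreal (hh t * (1 / sqrt (2 * pi))) = liminf (\<lambda>n. ennreal (hh t * std_normal_density (e n * t)))"
        by (simp add: lim_imp_Liminf)
    qed
    also have "\<dots> \<le> liminf (\<lambda>n. \<integral>\<^sup>+t. ennreal (hh t * std_normal_density (e n * t)) \<partial>lborel)"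
      by (rule nn_integral_liminf) auto
    also have "\<dots> \<le> limsup (\<lambda>n. \<integral>\<^sup>+t. ennreal (hh t * std_normal_density (e n * t)) \<partial>lborel)"
      by (rule Liminf_le_Limsup) auto
    also have "\<dots> \<le> ennreal (B * sqrt (2 * pi))"
    proof (rule Limsup_bounded, rule always_eventually, rule allI)
      fix n
      have "(\<integral>\<^sup>+t. ennreal (hh t * std_normal_density (e n * t)) \<partial>lborel)
          = ennreal (\<integral>t. hh t * std_normal_density (e n * t) \<partial>lborel)"
        by (rule nn_integral_eq_integral[OF int_d]) (use nonneg in \<open>auto simp: normal_density_nonneg\<close>)
      also have "\<dots> \<le> ennreal (B * sqrt (2 * pi))" by (rule ennreal_leI[OF bd])
      finally show "(\<integral>\<^sup>+t. ennreal (hh t * std_normal_density (e n * t)) \<partial>lborel) \<le> ennreal (B * sqrt (2 * pi))" .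
    qed
    finally have fin: "(\<integral>\<^sup>+t. ennreal (hh t * (1 / sqrt (2 * pi))) \<partial>lborel) < \<infinity>"
      by (auto simp: less_top[symmetric] top_unique)
    have "(\<integral>\<^sup>+t. ennreal (norm (hh t)) \<partial>lborel)
       = (\<integral>\<^sup>+t. ennreal (sqrt (2 * pi)) * ennreal (hh t * (1 / sqrt (2 * pi))) \<partial>lborel)"
      using nonneg by (intro nn_integral_cong) (simp flip: ennreal_mult')
    also have "\<dots> = ennreal (sqrt (2 * pi)) * (\<integral>\<^sup>+t. ennreal (hh t * (1 / sqrt (2 * pi))) \<partial>lborel)"
      by (rule nn_integral_cmult) auto
    also have "\<dots> < \<infinity>" using fin by (simp add: ennreal_mult_less_top)
    finally show "(\<integral>\<^sup>+t. ennreal (norm (hh t)) \<partial>lborel) < \<infinity>" .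
  qed auto
  \<comment> \<open>On the spectral side the density tends to 1 / sqrt (2 pi), while the averages of
    \<open>h\<close> tend to sqrt (2 pi) h(r); the quotient of the two constants is the factor 2
    pi.\<close>
  have lim1: "(\<lambda>n. \<integral>t. complex_of_real (hh t) * (std_normal_density (e n * t) *\<^sub>R iexp (t * r)) \<partial>lborel)
     \<longlonglongrightarrow> (\<integral>t. complex_of_real (hh t) * ((1 / sqrt (2 * pi)) *\<^sub>R iexp (t * r)) \<partial>lborel)"
  proof (rule integral_dominated_convergence[where w = hh])
    show "AE t in lborel. (\<lambda>n. complex_of_real (hh t) * (std_normal_density (e n * t) *\<^sub>R iexp (t * r)))
           \<longlonglongrightarrow> complex_of_real (hh t) * ((1 / sqrt (2 * pi)) *\<^sub>R iexp (t * r))"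
      by (intro AE_I2 tendsto_intros d_lim)
    show "AE t in lborel. norm (complex_of_real (hh t) * (std_normal_density (e n * t) *\<^sub>R iexp (t * r))) \<le> hh t" for n
      using nonneg d_bd by (intro AE_I2) (auto simp: norm_mult normal_density_nonneg intro!: mult_left_le_one_le)
  qed (use A in auto)
  have lim2: "(\<lambda>n. complex_of_real (\<integral>z. h (r + e n * z) * exp (- (z\<^sup>2) / 2) \<partial>lborel))
     \<longlonglongrightarrow> complex_of_real (\<integral>z. h r * exp (- (z\<^sup>2) / 2) \<partial>lborel)"
  proof (intro tendsto_of_real integral_dominated_convergence[where w = "\<lambda>z. B * exp (- (z\<^sup>2) / 2)"])
    show "AE z in lborel. (\<lambda>n. h (r + e n * z) * exp (- (z\<^sup>2) / 2)) \<longlonglongrightarrow> h r * exp (- (z\<^sup>2) / 2)"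
    proof (intro AE_I2 tendsto_mult tendsto_const)
      fix z
      have "(\<lambda>n. r + e n * z) \<longlonglongrightarrow> r + 0 * z" by (intro tendsto_intros e_lim)
      hence "(\<lambda>n. r + e n * z) \<longlonglongrightarrow> r" by simp
      moreover have "isCont h r" using cont by (simp add: continuous_on_eq_continuous_at)
      ultimately show "(\<lambda>n. h (r + e n * z)) \<longlonglongrightarrow> h r" by (metis isCont_tendsto_compose)
    qed
    show "integrable lborel (\<lambda>z. B * exp (- (z\<^sup>2) / 2))" using integral_exp_neg_sq_half by auto
    show "AE z in lborel. norm (h (r + e n * z) * exp (- (z\<^sup>2) / 2)) \<le> B * exp (- (z\<^sup>2) / 2)" for n
      using bdd by (auto simp: abs_mult intro!: mult_right_mono)
  qed auto
  have "(\<integral>t. complex_of_real (hh t) * ((1 / sqrt (2 * pi)) *\<^sub>R iexp (t * r)) \<partial>lborel)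
      = complex_of_real (\<integral>z. h r * exp (- (z\<^sup>2) / 2) \<partial>lborel)"
    using LIMSEQ_unique[OF lim1] lim2 id by simp
  also have "\<dots> = complex_of_real (h r * sqrt (2 * pi))" using integral_exp_neg_sq_half by simp
  also have "(\<lambda>t. complex_of_real (hh t) * ((1 / sqrt (2 * pi)) *\<^sub>R iexp (t * r)))
      = (\<lambda>t. complex_of_real (1 / sqrt (2 * pi)) * (hh t *\<^sub>R iexp (t * r)))"
    by (simp add: scaleR_conv_of_real mult_ac)
  finally have "complex_of_real (1 / sqrt (2 * pi)) * (\<integral>t. hh t *\<^sub>R iexp (t * r) \<partial>lborel) = complex_of_real (h r * sqrt (2 * pi))"
    by (simp only: integral_mult_right_zero)
  hence "(\<integral>t. hh t *\<^sub>R iexp (t * r) \<partial>lborel) = complex_of_real (sqrt (2 * pi)) * complex_of_real (h r * sqrt (2 * pi))"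
    by (simp add: field_simps)
  also have "\<dots> = complex_of_real ((sqrt (2 * pi) * sqrt (2 * pi)) * h r)" by (simp only: of_real_mult mult_ac)
  also have "sqrt (2 * pi) * sqrt (2 * pi) = 2 * pi" by simp
  finally show ?B by simp
qed

text \<open>Jumps of \<open>\<phi>\<close> do no harm: the autocorrelation of a bounded integrable
  function that is continuous off a countable set is bounded, integrable and continuous everywhere,
  and its transform is the squared modulus of \<open>F\<close>. Inversion is applied to this
  autocorrelation, never to \<open>\<phi>\<close> itself.\<close>

theorem autocorrelation_inversion:
  fixes \<phi> :: "real \<Rightarrow> real"
  assumes int: "integrable lborel \<phi>" and bdd: "\<And>y. \<bar>\<phi> y\<bar> \<le> C"
    and A: "countable A" "\<And>y. y \<notin> A \<Longrightarrow> isCont \<phi> y"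
  defines "F \<equiv> \<lambda>t. \<integral>y. \<phi> y *\<^sub>R iexp (- (t * y)) \<partial>lborel"
  shows "integrable lborel (\<lambda>t. (cmod (F t))\<^sup>2)" (is ?A)
    and "(\<integral>t. (cmod (F t))\<^sup>2 *\<^sub>R iexp (t * r) \<partial>lborel)
           = complex_of_real (2 * pi * (\<integral>y. \<phi> y * \<phi> (y + r) \<partial>lborel))" (is ?B)
proof -
  have [measurable]: "\<phi> \<in> borel_measurable borel" using int by auto
  have C0: "C \<ge> 0" using bdd[of 0] by auto
  define h where "h = (\<lambda>r. \<integral>y. \<phi> y * \<phi> (y + r) \<partial>lborel)"
  have dom: "norm (\<phi> y * \<phi> (y + r)) \<le> C * \<bar>\<phi> y\<bar>" for y r
    unfolding real_norm_def abs_mult by (subst mult.commute, rule mult_right_mono[OF bdd]) simp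
  have intC: "integrable lborel (\<lambda>y. C * \<bar>\<phi> y\<bar>)" using int by auto
  have h_bdd: "\<bar>h r\<bar> \<le> C * (\<integral>y. \<bar>\<phi> y\<bar> \<partial>lborel)" for r
  proof -
    have "\<bar>h r\<bar> \<le> (\<integral>y. norm (\<phi> y * \<phi> (y + r)) \<partial>lborel)"
      unfolding h_def real_norm_def [symmetric] by (rule integral_norm_bound)
    also have "\<dots> \<le> (\<integral>y. C * \<bar>\<phi> y\<bar> \<partial>lborel)"
      by (rule integral_mono')
         (use dom intC C0 in auto)
    finally show ?thesis by simp
  qed
  have h_cont: "continuous_on UNIV h"
    unfolding continuous_on_sequentially
  proof (intro allI ballI impI, elim conjE)
    fix x :: "nat \<Rightarrow> real" and a :: real assume lim: "x \<longlonglongrightarrow> a"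
    have "(\<lambda>n. h (x n)) \<longlonglongrightarrow> h a"
      unfolding h_def
    proof (rule integral_dominated_convergence[where w = "\<lambda>y. C * \<bar>\<phi> y\<bar>"])
      \<comment> \<open>Convergence of the integrand can fail only where y + a meets a
        discontinuity; these y form a translate of \<open>A\<close>, hence a null set.\<close>
      have "countable ((\<lambda>z. z - a) ` A)" using A by auto
      hence "AE y in lborel. y \<notin> (\<lambda>z. z - a) ` A"
        by (intro AE_not_in countable_imp_null_set_lborel)
      thus "AE y in lborel. (\<lambda>n. \<phi> y * \<phi> (y + x n)) \<longlonglongrightarrow> \<phi> y * \<phi> (y + a)"
      proof eventually_elim
        case (elim y)
        have "y + a \<notin> A" using elim by (auto simp: image_iff)
        hence "isCont \<phi> (y + a)" by (rule A)
        moreover have "(\<lambda>n. y + x n) \<longlonglongrightarrow> y + a" by (intro tendsto_intros lim)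
        ultimately show ?case by (intro tendsto_mult tendsto_const) (rule isCont_tendsto_compose)
      qed
    qed (use intC dom in auto)
    thus "(h \<circ> x) \<longlonglongrightarrow> h a" by (simp add: o_def)
  qed
  have ik: "integrable (lborel \<Otimes>\<^sub>M lborel) (\<lambda>(y, r). (\<phi> y * \<phi> (y + r)) *\<^sub>R iexp (- (t * r)))" for t
  proof (rule integrableI_bounded)
    have "(\<integral>\<^sup>+x. ennreal (norm (case_prod (\<lambda>y r. (\<phi> y * \<phi> (y + r)) *\<^sub>R iexp (- (t * r))) x)) \<partial>(lborel \<Otimes>\<^sub>M lborel))
        = (\<integral>\<^sup>+y. (\<integral>\<^sup>+r. ennreal \<bar>\<phi> y\<bar> * ennreal \<bar>\<phi> (y + r)\<bar> \<partial>lborel) \<partial>lborel)"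
      by (subst lborel.nn_integral_fst [symmetric])
         (auto simp: norm_mult ennreal_mult abs_mult intro!: nn_integral_cong)
    also have "\<dots> = (\<integral>\<^sup>+y. ennreal \<bar>\<phi> y\<bar> * (\<integral>\<^sup>+z. ennreal \<bar>\<phi> z\<bar> \<partial>lborel) \<partial>lborel)"
    proof (rule nn_integral_cong)
      fix y
      show "(\<integral>\<^sup>+r. ennreal \<bar>\<phi> y\<bar> * ennreal \<bar>\<phi> (y + r)\<bar> \<partial>lborel) = ennreal \<bar>\<phi> y\<bar> * (\<integral>\<^sup>+z. ennreal \<bar>\<phi> z\<bar> \<partial>lborel)"
        using nn_integral_real_affine[of "\<lambda>z. ennreal \<bar>\<phi> z\<bar>" 1 y]
        by (simp add: nn_integral_cmult)
    qed
    also have "\<dots> = (\<integral>\<^sup>+z. ennreal \<bar>\<phi> z\<bar> \<partial>lborel) * (\<integral>\<^sup>+z. ennreal \<bar>\<phi> z\<bar> \<partial>lborel)"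
      by (simp add: nn_integral_multc)
    also have "\<dots> < \<infinity>" using int by (auto simp: integrable_iff_bounded ennreal_mult_less_top)
    finally show "(\<integral>\<^sup>+x. ennreal (norm (case_prod (\<lambda>y r. (\<phi> y * \<phi> (y + r)) *\<^sub>R iexp (- (t * r))) x)) \<partial>(lborel \<Otimes>\<^sub>M lborel)) < \<infinity>" .
  qed auto
  have h_int: "integrable lborel h"
  proof -
    from ik[of 0] have "integrable (lborel \<Otimes>\<^sub>M lborel) (\<lambda>x. Re (case x of (y, r) \<Rightarrow> (\<phi> y * \<phi> (y + r)) *\<^sub>R iexp (- (0 * r))))"
      by (rule integrable_Re)
    hence "integrable (lborel \<Otimes>\<^sub>M lborel) (\<lambda>(y, r). \<phi> y * \<phi> (y + r))"
      by (simp add: case_prod_unfold)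
    from lborel_pair.integrable_snd[OF this] show ?thesis by (simp add: h_def)
  qed
  have hat: "complex_of_real ((cmod (F t))\<^sup>2) = (\<integral>r. h r *\<^sub>R iexp (- (t * r)) \<partial>lborel)" for t
  proof -
    have "(\<integral>r. h r *\<^sub>R iexp (- (t * r)) \<partial>lborel)
       = (\<integral>r. (\<integral>y. (\<phi> y * \<phi> (y + r)) *\<^sub>R iexp (- (t * r)) \<partial>lborel) \<partial>lborel)"
    proof (rule Bochner_Integration.integral_cong[OF refl])
      fix r
      have i: "integrable lborel (\<lambda>y. \<phi> y * \<phi> (y + r))"
        by (rule Bochner_Integration.integrable_bound[OF intC]) (use dom C0 in \<open>auto simp: abs_mult\<close>)
      show "h r *\<^sub>R iexp (- (t * r)) = (\<integral>y. (\<phi> y * \<phi> (y + r)) *\<^sub>R iexp (- (t * r)) \<partial>lborel)"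
        unfolding h_def by (rule integral_scaleR_left[OF i, symmetric])
    qed
    also have "\<dots> = (\<integral>y. (\<integral>r. (\<phi> y * \<phi> (y + r)) *\<^sub>R iexp (- (t * r)) \<partial>lborel) \<partial>lborel)"
      using lborel_pair.Fubini_integral[OF ik[of t]] by simp
    also have "\<dots> = (\<integral>y. cnj (\<phi> y *\<^sub>R iexp (- (t * y))) * F t \<partial>lborel)"
    proof (rule Bochner_Integration.integral_cong[OF refl])
      fix y
      have "F t = (\<integral>r. \<phi> (y + r) *\<^sub>R iexp (- (t * (y + r))) \<partial>lborel)"
        unfolding F_def using lborel_integral_real_affine[of 1 "\<lambda>z. \<phi> z *\<^sub>R iexp (- (t * z))" y] by simp
      hence "cnj (\<phi> y *\<^sub>R iexp (- (t * y))) * F t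
         = (\<integral>r. cnj (\<phi> y *\<^sub>R iexp (- (t * y))) * (\<phi> (y + r) *\<^sub>R iexp (- (t * (y + r)))) \<partial>lborel)"
        by (simp only: integral_mult_right_zero)
      also have "\<dots> = (\<integral>r. (\<phi> y * \<phi> (y + r)) *\<^sub>R iexp (- (t * r)) \<partial>lborel)"
        by (rule Bochner_Integration.integral_cong[OF refl])
           (simp add: scaleR_conv_of_real exp_cnj algebra_simps exp_add exp_diff exp_minus field_simps)
      finally show "(\<integral>r. (\<phi> y * \<phi> (y + r)) *\<^sub>R iexp (- (t * r)) \<partial>lborel) = cnj (\<phi> y *\<^sub>R iexp (- (t * y))) * F t" by simp
    qed
    also have "\<dots> = (\<integral>y. cnj (\<phi> y *\<^sub>R iexp (- (t * y))) \<partial>lborel) * F t"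
      by (rule integral_mult_left_zero)
    also have "(\<integral>y. cnj (\<phi> y *\<^sub>R iexp (- (t * y))) \<partial>lborel) = cnj (F t)"
      unfolding F_def by (rule Bochner_Integration.integral_cnj)
    finally have "(\<integral>r. h r *\<^sub>R iexp (- (t * r)) \<partial>lborel) = cnj (F t) * F t" .
    thus ?thesis by (simp only: complex_norm_square mult.commute)
  qed
  have "F \<in> borel_measurable borel" unfolding F_def by measurable
  hence meas: "(\<lambda>t. (cmod (F t))\<^sup>2) \<in> borel_measurable borel" by measurable
  show ?A by (rule fourier_inversion_nonneg(1)[OF h_int h_bdd h_cont hat _ meas]) simp
  show ?B using fourier_inversion_nonneg(2)[OF h_int h_bdd h_cont hat _ meas, of r] by (simp add: h_def)
qed

section \<open>Integration on half-lines\<close>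

text \<open>Both sides are monotone limits, over the intervals from e^(-n) to e^n and from -n to n,
  and on each of these the substitution rule for compact intervals applies.\<close>

lemma nn_integral_exp_substitution:
  fixes f :: "real \<Rightarrow> ennreal"
  assumes [measurable]: "f \<in> borel_measurable borel"
  shows "(\<integral>\<^sup>+x. f x * indicator {0<..} x \<partial>lborel) = (\<integral>\<^sup>+y. f (exp y) * ennreal (exp y) \<partial>lborel)"
proof (rule LIMSEQ_unique)
  let ?I = "\<lambda>n::nat. {exp (- real n)..exp (real n)}"
  have mono: "incseq (\<lambda>n x. f x * indicator (?I n) x)"
    by (auto simp: incseq_def le_fun_def split: split_indicator)
       (meson dual_order.trans exp_le_cancel_iff neg_le_iff_le of_nat_mono)+
  show "(\<lambda>n. \<integral>\<^sup>+x. f x * indicator (?I n) x \<partial>lborel) \<longlonglongrightarrow> (\<integral>\<^sup>+x. f x * indicator {0<..} x \<partial>lborel)"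
  proof (rule nn_integral_LIMSEQ[OF mono])
    fix x :: real
    show "(\<lambda>n. f x * indicator (?I n) x) \<longlonglongrightarrow> f x * indicator {0<..} x"
    proof (cases "x > 0")
      case True
      have "eventually (\<lambda>n. real n \<ge> \<bar>ln x\<bar>) sequentially"
        by (rule eventually_sequentiallyI[of "nat \<lceil>\<bar>ln x\<bar>\<rceil>"]) linarith
      hence "eventually (\<lambda>n. f x * indicator (?I n) x = f x * indicator {0<..} x) sequentially"
      proof eventually_elim
        case (elim n)
        hence "exp (- real n) \<le> exp (ln x)" "exp (ln x) \<le> exp (real n)" by (simp_all add: abs_le_iff)
        thus ?case using True by simp
      qed
      thus ?thesis by (rule tendsto_eventually)
    next
      case False
      hence "indicator (?I n) x = (0 :: ennreal)" for n
        using exp_gt_zero[of "- real n"] by (auto simp: indicator_def simp del: exp_gt_zero)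
      thus ?thesis using False by simp
    qed
  qed auto
  have eq: "(\<integral>\<^sup>+x. f x * indicator (?I n) x \<partial>lborel)
     = (\<integral>\<^sup>+y. f (exp y) * ennreal (exp y) * indicator {- real n..real n} y \<partial>lborel)" for n
  \<comment> \<open>The compact rule asks for a nondegenerate interval; for n = 0 both domains are
    single points.\<close>
  proof (cases "n = 0")
    case True
    have "(\<integral>\<^sup>+x. f x * indicator {1..1} x \<partial>lborel) = 0"
      using AE_lborel_singleton[of "1::real"] by (subst nn_integral_0_iff_AE) (auto elim!: eventually_mono)
    moreover have "(\<integral>\<^sup>+y. f (exp y) * ennreal (exp y) * indicator {0..0} y \<partial>lborel) = 0"
      using AE_lborel_singleton[of "0::real"] by (subst nn_integral_0_iff_AE) (auto elim!: eventually_mono)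
    ultimately show ?thesis using True by simp
  next
    case False
    show ?thesis
      by (rule nn_integral_substitution_aux)
         (use False in \<open>auto intro!: derivative_eq_intros continuous_intros\<close>)
  qed
  have mono': "incseq (\<lambda>n y. f (exp y) * ennreal (exp y) * indicator {- real n..real n} y)"
    by (auto simp: incseq_def le_fun_def split: split_indicator)
  have "(\<lambda>n. \<integral>\<^sup>+y. f (exp y) * ennreal (exp y) * indicator {- real n..real n} y \<partial>lborel)
     \<longlonglongrightarrow> (\<integral>\<^sup>+y. f (exp y) * ennreal (exp y) \<partial>lborel)"
  proof (rule nn_integral_LIMSEQ[OF mono'])
    fix y :: real
    have "eventually (\<lambda>n. real n \<ge> \<bar>y\<bar>) sequentially"
      by (rule eventually_sequentiallyI[of "nat \<lceil>\<bar>y\<bar>\<rceil>"]) linarith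
    hence "eventually (\<lambda>n. f (exp y) * ennreal (exp y) * indicator {- real n..real n} y = f (exp y) * ennreal (exp y)) sequentially"
      by eventually_elim (simp add: abs_le_iff)
    thus "(\<lambda>n. f (exp y) * ennreal (exp y) * indicator {- real n..real n} y) \<longlonglongrightarrow> f (exp y) * ennreal (exp y)"
      by (rule tendsto_eventually)
  qed auto
  thus "(\<lambda>n. \<integral>\<^sup>+x. f x * indicator (?I n) x \<partial>lborel) \<longlonglongrightarrow> (\<integral>\<^sup>+y. f (exp y) * ennreal (exp y) \<partial>lborel)"
    by (simp add: eq)
qed

text \<open>Stated as an equality of measures, the substitution carries over from nonnegative
  functions to integrability and integrals of Banach-valued ones in a single step.\<close>

lemma distr_exp_lborel:
  "distr (density lborel (\<lambda>y. ennreal (exp y))) borel exp = density lborel (indicator {0<..} :: real \<Rightarrow> ennreal)"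
proof (rule measure_eqI)
  fix A :: "real set"
  assume "A \<in> sets (distr (density lborel (\<lambda>y. ennreal (exp y))) borel exp)"
  hence A [measurable]: "A \<in> sets borel" by simp
  have "(exp :: real \<Rightarrow> real) \<in> borel_measurable borel" by measurable
  from measurable_sets[OF this A] have [measurable]: "exp -` A \<in> sets borel" by simp
  have "emeasure (distr (density lborel (\<lambda>y. ennreal (exp y))) borel exp) A
     = (\<integral>\<^sup>+y. indicator A (exp y) * ennreal (exp y) \<partial>lborel)"
    by (subst emeasure_distr; simp?) (subst emeasure_density; auto intro!: nn_integral_cong split: split_indicator)
  also have "\<dots> = (\<integral>\<^sup>+x. indicator A x * indicator {0<..} x \<partial>lborel)"
    by (rule nn_integral_exp_substitution [symmetric]) auto
  also have "\<dots> = emeasure (density lborel (indicator {0<..} :: real \<Rightarrow> ennreal)) A"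
    by (subst emeasure_density) (auto simp: mult.commute)
  finally show "emeasure (distr (density lborel (\<lambda>y. ennreal (exp y))) borel exp) A
     = emeasure (density lborel (indicator {0<..} :: real \<Rightarrow> ennreal)) A" .
qed simp

lemma
  fixes f :: "real \<Rightarrow> 'a :: {banach, second_countable_topology}"
  assumes [measurable]: "f \<in> borel_measurable borel"
  shows integrable_exp_substitution:
      "integrable lborel (\<lambda>y. exp y *\<^sub>R f (exp y)) \<longleftrightarrow> set_integrable lborel {0<..} f"
    and integral_exp_substitution:
      "(\<integral>y. exp y *\<^sub>R f (exp y) \<partial>lborel) = (LINT x:{0<..}|lborel. f x)"
proof -
  have ind: "density lborel (\<lambda>x. ennreal (indicator {0<..} x :: real)) = density lborel (indicator {0<..} :: real \<Rightarrow> ennreal)"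
    by (rule density_cong) (auto split: split_indicator)
  have "integrable lborel (\<lambda>y. exp y *\<^sub>R f (exp y)) \<longleftrightarrow> integrable (density lborel (\<lambda>y. ennreal (exp y))) (\<lambda>y. f (exp y))"
    by (subst integrable_density) auto
  also have "\<dots> \<longleftrightarrow> integrable (distr (density lborel (\<lambda>y. ennreal (exp y))) borel exp) f"
    by (subst integrable_distr_eq) auto
  also have "\<dots> \<longleftrightarrow> set_integrable lborel {0<..} f"
    unfolding distr_exp_lborel set_integrable_def ind[symmetric] by (subst integrable_density) auto
  finally show "integrable lborel (\<lambda>y. exp y *\<^sub>R f (exp y)) \<longleftrightarrow> set_integrable lborel {0<..} f" .
  have "(\<integral>y. exp y *\<^sub>R f (exp y) \<partial>lborel) = (\<integral>y. f (exp y) \<partial>density lborel (\<lambda>y. ennreal (exp y)))"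
    by (subst integral_density) auto
  also have "\<dots> = (\<integral>y. f y \<partial>distr (density lborel (\<lambda>y. ennreal (exp y))) borel exp)"
    by (subst integral_distr) auto
  also have "\<dots> = (LINT x:{0<..}|lborel. f x)"
    unfolding distr_exp_lborel set_lebesgue_integral_def ind[symmetric] by (subst integral_density) auto
  finally show "(\<integral>y. exp y *\<^sub>R f (exp y) \<partial>lborel) = (LINT x:{0<..}|lborel. f x)" .
qed

text \<open>The exceptional set \<open>X\<close> is meant for the jumps of \<open>frac\<close>: the
  antiderivatives used below are continuous there but not differentiable.\<close>

lemma set_integral_FTC:
  fixes F f :: "real \<Rightarrow> 'a :: euclidean_space"
  assumes ab: "a \<le> b" and X: "finite (X \<inter> {a..b})"
    and int: "set_integrable lborel {a..b} f"
    and cont: "continuous_on {a..b} F"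
    and der: "\<And>x. a < x \<Longrightarrow> x < b \<Longrightarrow> x \<notin> X \<Longrightarrow> (F has_vector_derivative f x) (at x)"
  shows "(LINT x:{a..b}|lborel. f x) = F b - F a"
proof -
  have "(f has_integral F b - F a) {a..b}"
    by (rule fundamental_theorem_of_calculus_interior_strong[OF X ab _ cont]) (use der in auto)
  thus ?thesis using set_borel_integral_eq_integral(2)[OF int] by (simp add: integral_unique)
qed

lemma set_integral_FTC_at_top:
  fixes F f :: "real \<Rightarrow> 'a :: euclidean_space"
  assumes X: "\<And>b. finite (X \<inter> {a..b})"
    and int: "set_integrable lborel {a..} f"
    and cont: "continuous_on {a..} F"
    and der: "\<And>x. a < x \<Longrightarrow> x \<notin> X \<Longrightarrow> (F has_vector_derivative f x) (at x)"
    and lim: "(F \<longlongrightarrow> L) at_top"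
  shows "(LINT x:{a..}|lborel. f x) = L - F a"
proof (rule tendsto_unique)
  show "((\<lambda>b. LINT x:{a..b}|lborel. f x) \<longlongrightarrow> (LINT x:{a..}|lborel. f x)) at_top"
    by (rule tendsto_set_lebesgue_integral_at_top[OF _ int]) auto
  have "eventually (\<lambda>b. F b - F a = (LINT x:{a..b}|lborel. f x)) at_top"
    using eventually_ge_at_top[of a]
  proof eventually_elim
    case (elim b)
    show ?case
      by (rule set_integral_FTC [symmetric, OF elim X])
         (use cont der in \<open>auto intro: set_integrable_subset[OF int] continuous_on_subset\<close>)
  qed
  moreover have "((\<lambda>b. F b - F a) \<longlongrightarrow> L - F a) at_top" by (intro tendsto_intros lim)
  ultimately show "((\<lambda>b. LINT x:{a..b}|lborel. f x) \<longlongrightarrow> L - F a) at_top"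
    using tendsto_cong by force
qed auto

lemma set_integral_Ici_split:
  fixes f :: "real \<Rightarrow> 'a :: {banach, second_countable_topology}"
  assumes int: "set_integrable lborel {a..} f" and z: "a \<le> z"
  shows "(LINT w:{a..}|lborel. f w) = (LINT w:{a..z}|lborel. f w) + (LINT w:{z..}|lborel. f w)"
proof -
  have "(LINT w:{a..z} \<union> {z..}|lborel. f w) = (LINT w:{a..z}|lborel. f w) + (LINT w:{z..}|lborel. f w)"
    by (rule set_integral_Un_AE)
       (use z AE_lborel_singleton[of z] in \<open>auto intro: set_integrable_subset[OF int] elim!: eventually_mono\<close>)
  moreover have "{a..z} \<union> {z..} = {a..}" using z by auto
  ultimately show ?thesis by simp
qed

lemma tail_integral_has_derivative:
  fixes f :: "real \<Rightarrow> real"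
  assumes cont: "continuous_on {0<..} f" and int: "\<And>c. c > 0 \<Longrightarrow> set_integrable lborel {c..} f" and y: "y > 0"
  shows "((\<lambda>y. LINT w:{y..}|lborel. f w) has_real_derivative - f y) (at y)"
proof -
  \<comment> \<open>A base point strictly between 0 and y, since the integrand need not be
    integrable down to 0.\<close>
  define c where "c = y / 2"
  have c: "c > 0" "c < y" using y by (auto simp: c_def)
  have eq: "(LINT w:{z..}|lborel. f w) = (LINT w:{c..}|lborel. f w) - integral {c..z} f" if "z > c" for z
  proof -
    have "(LINT w:{c..}|lborel. f w) = (LINT w:{c..z}|lborel. f w) + (LINT w:{z..}|lborel. f w)"
      by (rule set_integral_Ici_split) (use that c int in auto)
    moreover have "(LINT w:{c..z}|lborel. f w) = integral {c..z} f"
      by (rule set_borel_integral_eq_integral) (use that c in \<open>auto intro: set_integrable_subset[OF int[of c]]\<close>)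
    ultimately show ?thesis by simp
  qed
  have "((\<lambda>z. integral {c..z} f) has_real_derivative f y) (at y within {c..y+1})"
    by (rule integral_has_real_derivative) (use c in \<open>auto intro: continuous_on_subset[OF cont]\<close>)
  hence "((\<lambda>z. integral {c..z} f) has_real_derivative f y) (at y)"
    using at_within_Icc_at[of c y "y + 1"] c by simp
  hence "((\<lambda>z. (LINT w:{c..}|lborel. f w) - integral {c..z} f) has_real_derivative 0 - f y) (at y)"
    by (intro derivative_intros)
  hence "((\<lambda>z. (LINT w:{c..}|lborel. f w) - integral {c..z} f) has_real_derivative - f y) (at y)" by simp
  thus ?thesis
    by (rule DERIV_cong_ev[THEN iffD1, rotated -1, OF _ refl _ refl])
       (use c eq in \<open>auto intro!: eventually_nhds_in_open[of "{c<..}", THEN eventually_mono]\<close>)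
qed

lemma tail_integral_tendsto_0:
  fixes f :: "real \<Rightarrow> real"
  assumes int: "set_integrable lborel {a..} f"
  shows "((\<lambda>y. LINT w:{y..}|lborel. f w) \<longlongrightarrow> 0) at_top"
proof -
  have lim: "((\<lambda>b. LINT x:{a..b}|lborel. f x) \<longlongrightarrow> (LINT x:{a..}|lborel. f x)) at_top"
    by (rule tendsto_set_lebesgue_integral_at_top[OF _ int]) auto
  have "((\<lambda>b. (LINT x:{a..}|lborel. f x) - (LINT x:{a..b}|lborel. f x)) \<longlongrightarrow> (LINT x:{a..}|lborel. f x) - (LINT x:{a..}|lborel. f x)) at_top"
    by (intro tendsto_intros lim)
  moreover have "eventually (\<lambda>b. (LINT x:{a..}|lborel. f x) - (LINT x:{a..b}|lborel. f x) = (LINT w:{b..}|lborel. f w)) at_top"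
    using eventually_ge_at_top[of a]
  proof eventually_elim
    case (elim z)
    show ?case using set_integral_Ici_split[OF int elim] by simp
  qed
  ultimately show ?thesis using tendsto_cong by fastforce
qed

section \<open>Euler-Maclaurin tails\<close>

text \<open>\<open>saw\<close> is the periodic Bernoulli function B_1, and \<open>ppar\<close> is
  1/12 - B_2({t})/2. This additive constant makes \<open>ppar\<close> vanish at the integers, which
  removes the boundary terms there, and keeps it nonnegative, which permits Tonelli
  arguments.\<close>

definition saw :: "real \<Rightarrow> real" where "saw t = frac t - 1/2"
definition ppar :: "real \<Rightarrow> real" where "ppar t = frac t * (1 - frac t) / 2"

lemma frac_measurable [measurable]: "(frac :: real \<Rightarrow> real) \<in> borel_measurable borel"
  unfolding frac_def by measurable

lemma saw_measurable [measurable]: "saw \<in> borel_measurable borel"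
  unfolding saw_def by measurable

lemma ppar_measurable [measurable]: "ppar \<in> borel_measurable borel"
  unfolding ppar_def by measurable

lemma frac_eq_on_piece: "of_int n \<le> t \<Longrightarrow> t < of_int n + 1 \<Longrightarrow> frac t = t - of_int n"
  for t :: real by (simp add: frac_unique_iff)

lemma ppar_eq_on_piece: "of_int n \<le> t \<Longrightarrow> t \<le> of_int n + 1 \<Longrightarrow> ppar t = (t - of_int n) * (of_int n + 1 - t) / 2"
proof (cases "t = of_int n + 1")
  case True
  hence "frac t = 0" by (simp add: frac_eq_0_iff)
  thus ?thesis using True by (simp add: ppar_def)
qed (simp add: ppar_def frac_eq_on_piece)

lemma frac_has_derivative:
  assumes "x \<notin> \<int>"
  shows "(frac has_real_derivative 1) (at x)"
proof -
  have "of_int \<lfloor>x\<rfloor> \<noteq> x" using assms by (metis Ints_of_int)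
  hence x: "of_int \<lfloor>x\<rfloor> < x" "x < of_int \<lfloor>x\<rfloor> + 1" using of_int_floor_le[of x] by linarith+
  have "((\<lambda>t. t - of_int \<lfloor>x\<rfloor>) has_real_derivative 1) (at x)" by (auto intro!: derivative_eq_intros)
  thus ?thesis
    by (rule has_field_derivative_transform_within_open[where S = "{of_int \<lfloor>x\<rfloor><..<of_int \<lfloor>x\<rfloor> + 1}"])
       (use x in \<open>auto simp: frac_eq_on_piece[of "\<lfloor>x\<rfloor>"]\<close>)
qed

lemma ppar_has_derivative: "x \<notin> \<int> \<Longrightarrow> (ppar has_real_derivative - saw x) (at x)"
  unfolding ppar_def [abs_def] saw_def
  by (auto intro!: derivative_eq_intros frac_has_derivative simp: field_simps)

lemma ppar_nonneg: "0 \<le> ppar t"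
  by (simp add: ppar_def frac_ge_0 frac_lt_1 less_imp_le)

lemma ppar_le: "ppar t \<le> 1/8"
  using zero_le_power2[of "frac t - 1/2"] by (simp add: ppar_def power2_eq_square field_simps)

lemma abs_ppar_le: "\<bar>ppar t\<bar> \<le> 1/8"
  using ppar_nonneg[of t] ppar_le[of t] by simp

lemma ppar_Ints: "t \<in> \<int> \<Longrightarrow> ppar t = 0"
  by (auto simp: ppar_def)

lemma ppar_1 [simp]: "ppar 1 = 0"
  by (simp add: ppar_Ints)

text \<open>At an integer x the two neighbouring parabolas both vanish, and within distance 1 on
  either side \<open>ppar\<close> t is at most |t - x|.\<close>

lemma isCont_ppar: "isCont ppar x"
proof (cases "x \<in> \<int>")
  case False
  thus ?thesis using ppar_has_derivative DERIV_isCont by blast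
next
  case True
  then obtain k where k: "x = of_int k" by (auto elim: Ints_cases)
  have "eventually (\<lambda>t. t \<in> {x - 1<..<x + 1}) (at x)"
    by (rule eventually_at_in_open') auto
  hence "eventually (\<lambda>t. norm (ppar t) \<le> \<bar>t - x\<bar>) (at x)"
  proof eventually_elim
    case (elim t)
    show ?case
    proof (cases "t \<ge> x")
      case True
      hence "ppar t = (t - x) * (x + 1 - t) / 2" using elim ppar_eq_on_piece[of k t] by (simp add: k)
      moreover have "(t - x) * (x + 1 - t) \<le> (t - x) * 1" using True elim by (intro mult_left_mono) auto
      ultimately show ?thesis using True ppar_nonneg[of t] by simp
    next
      case False
      hence "ppar t = (t - (x - 1)) * (x - t) / 2" using elim ppar_eq_on_piece[of "k - 1" t] by (simp add: k)
      moreover have "(t - (x - 1)) * (x - t) \<le> 1 * (x - t)" using False elim by (intro mult_right_mono) auto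
      ultimately have "ppar t \<le> 1 * (x - t) / 2" by (simp only: divide_right_mono)
      hence "ppar t * 2 \<le> x - t" by simp
      hence "ppar t \<le> x - t" using False ppar_nonneg[of t] by linarith
      thus ?thesis using False ppar_nonneg[of t] by simp
    qed
  qed
  moreover have "((\<lambda>t. \<bar>t - x\<bar>) \<longlongrightarrow> \<bar>x - x\<bar>) (at x)" by (intro tendsto_intros)
  hence "((\<lambda>t. \<bar>t - x\<bar>) \<longlongrightarrow> 0) (at x)" by simp
  ultimately have "(ppar \<longlongrightarrow> 0) (at x)" by (rule Lim_null_comparison)
  thus ?thesis using True by (simp add: isCont_def ppar_Ints)
qed

lemma continuous_on_ppar [continuous_intros]: "continuous_on A ppar"
  using isCont_ppar continuous_at_imp_continuous_on by blast

lemma finite_Ints_inter_Icc: "finite (\<int> \<inter> {a..b :: real})"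
proof (rule finite_subset)
  show "\<int> \<inter> {a..b} \<subseteq> of_int ` {\<lceil>a\<rceil>..\<lfloor>b\<rfloor>}"
    by (auto elim!: Ints_cases simp: ceiling_le_iff le_floor_iff)
qed auto

lemma integrable_Ici_from_1:
  fixes f :: "real \<Rightarrow> 'a :: euclidean_space"
  assumes "continuous_on {0<..} f" "set_integrable lborel {1..} f" "c > 0"
  shows "set_integrable lborel {c..} f"
proof -
  have "set_integrable lborel ({c..max 1 c} \<union> {1..}) f"
    by (rule set_integrable_Un)
       (use assms in \<open>auto intro!: borel_integrable_atLeastAtMost' intro: continuous_on_subset\<close>)
  thus ?thesis by (rule set_integrable_subset) auto
qed

text \<open>A monotone antiderivative with a finite limit already bounds the integral, so
  integrability comes together with the value; naming an antiderivative is then the whole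
  integrability proof.\<close>

lemma set_integrable_FTC_nonneg:
  fixes f F :: "real \<Rightarrow> real"
  assumes meas: "set_borel_measurable borel {a..} f"
    and "\<And>x. a \<le> x \<Longrightarrow> (F has_real_derivative f x) (at x)" "\<And>x. a \<le> x \<Longrightarrow> 0 \<le> f x" "(F \<longlongrightarrow> L) at_top"
  shows "set_integrable lborel {a..} f" "(LINT x:{a..}|lborel. f x) = L - F a"
proof -
  let ?g = "\<lambda>x. indicator {a..} x * f x"
  have m: "?g \<in> borel_measurable borel"
    using meas by (simp add: set_borel_measurable_def)
  have *: "(\<integral>\<^sup>+x. ennreal (?g x) * indicator {a..} x \<partial>lborel) = ennreal (L - F a)"
    by (rule nn_integral_FTC_atLeast[OF m]) (use assms in auto)
  also have "(\<integral>\<^sup>+x. ennreal (?g x) * indicator {a..} x \<partial>lborel) = (\<integral>\<^sup>+x. ennreal (?g x) \<partial>lborel)"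
    by (intro nn_integral_cong) (auto split: split_indicator)
  finally have eq: "(\<integral>\<^sup>+x. ennreal (?g x) \<partial>lborel) = ennreal (L - F a)" .
  have nn: "?g x \<ge> 0" for x using assms(3) by (auto split: split_indicator)
  have i: "integrable lborel ?g"
    by (rule integrableI_nonneg) (use m nn eq in auto)
  thus int: "set_integrable lborel {a..} f" by (simp add: set_integrable_def)
  show "(LINT x:{a..}|lborel. f x) = L - F a"
    by (rule set_integral_FTC_at_top[where X = "{}"])
       (use assms(2,4) int continuous_at_imp_continuous_on[of "{a..}" F] DERIV_isCont[OF assms(2)]
         in \<open>auto simp: has_real_derivative_iff_has_vector_derivative[symmetric]\<close>)
qed

lemma integral_inverse_square:
  assumes "c > (0::real)"
  shows "set_integrable lborel {c..} (\<lambda>w. 1 / w\<^sup>2)" "(LINT w:{c..}|lborel. 1 / w\<^sup>2) = 1 / c"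
proof -
  have l: "((\<lambda>w::real. - 1 / w) \<longlongrightarrow> 0) at_top" by real_asymp
  have m: "set_borel_measurable borel {c..} (\<lambda>w. 1 / w\<^sup>2)" unfolding set_borel_measurable_def by measurable
  have d: "((\<lambda>w::real. - 1 / w) has_real_derivative 1 / x\<^sup>2) (at x)" if "c \<le> x" for x
    using that assms by (auto intro!: derivative_eq_intros simp: power2_eq_square)
  show "set_integrable lborel {c..} (\<lambda>w. 1 / w\<^sup>2)"
    by (rule set_integrable_FTC_nonneg(1)[OF m d _ l]) auto
  show "(LINT w:{c..}|lborel. 1 / w\<^sup>2) = 1 / c"
    by (subst set_integrable_FTC_nonneg(2)[OF m d _ l]) auto
qed

text \<open>The logarithm changes sign at 1, so the nonnegative rule is applied from 1 on and
  continuity covers the remaining compact piece; the value then follows from the antiderivative -(1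
  + ln w) / w on the whole half-line.\<close>

lemma integrable_ln_over_square:
  assumes "c > (0::real)"
  shows "set_integrable lborel {c..} (\<lambda>w. ln w / w\<^sup>2)" "(LINT w:{c..}|lborel. ln w / w\<^sup>2) = (1 + ln c) / c"
proof -
  have l: "((\<lambda>w::real. - (1 + ln w) / w) \<longlongrightarrow> 0) at_top" by real_asymp
  have m: "set_borel_measurable borel {1..} (\<lambda>w::real. ln w / w\<^sup>2)" unfolding set_borel_measurable_def by measurable
  have d: "((\<lambda>w::real. - (1 + ln w) / w) has_real_derivative ln x / x\<^sup>2) (at x)" if "x > 0" for x
    using that by (auto intro!: derivative_eq_intros simp: power2_eq_square field_simps)
  have "set_integrable lborel {1..} (\<lambda>w::real. ln w / w\<^sup>2)"
    by (rule set_integrable_FTC_nonneg(1)[OF m d _ l]) auto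
  thus i: "set_integrable lborel {c..} (\<lambda>w. ln w / w\<^sup>2)"
    by (rule integrable_Ici_from_1[rotated]) (use assms in \<open>auto intro!: continuous_intros\<close>)
  have "(LINT w:{c..}|lborel. ln w / w\<^sup>2) = 0 - (- (1 + ln c) / c)"
    by (rule set_integral_FTC_at_top[where X = "{}", OF _ i _ _ l])
       (use assms d continuous_at_imp_continuous_on[of "{c..}", OF ballI[OF DERIV_isCont[OF d]]]
         in \<open>auto simp: has_real_derivative_iff_has_vector_derivative[symmetric] simp del: minus_add_distrib\<close>)
  thus "(LINT w:{c..}|lborel. ln w / w\<^sup>2) = (1 + ln c) / c" using assms by (simp add: field_simps)
qed

text \<open>
  Stands for the conditionally convergent integral of \<open>saw w * g w\<close> over \<open>w \<ge> y\<close>, integrated by parts once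
  (\<open>- saw\<close> is the derivative of \<open>ppar\<close>).
\<close>

definition saw_tail :: "(real \<Rightarrow> real) \<Rightarrow> (real \<Rightarrow> real) \<Rightarrow> real \<Rightarrow> real" where
  "saw_tail g g' y = ppar y * g y + (LINT w:{y..}|lborel. ppar w * g' w)"

text \<open>Only \<open>g'\<close> has to be integrable at infinity, not \<open>g\<close>: this
  covers the weights 1/w and ln w / w, for which the integral of saw w * g w converges only
  conditionally.\<close>

locale tail_weight =
  fixes g g' :: "real \<Rightarrow> real"
  assumes der: "\<And>y. y > 0 \<Longrightarrow> (g has_real_derivative g' y) (at y)"
    and cont: "continuous_on {0<..} g'"
    and int: "\<And>c. c > 0 \<Longrightarrow> set_integrable lborel {c..} g'"
    and lim: "(g \<longlongrightarrow> 0) at_top"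
begin

lemma int_ppar: "c > 0 \<Longrightarrow> set_integrable lborel {c..} (\<lambda>w. ppar w * g' w)"
proof -
  assume c: "c > 0"
  have "integrable lborel (\<lambda>w. indicator {c..} w *\<^sub>R (ppar w * g' w))"
  proof (rule Bochner_Integration.integrable_bound[OF int[OF c, unfolded set_integrable_def]])
    have "(\<lambda>w. ppar w * (indicator {c..} w *\<^sub>R g' w)) \<in> borel_measurable lborel"
      using borel_measurable_integrable[OF int[OF c, unfolded set_integrable_def]] by measurable
    thus "(\<lambda>w. indicator {c..} w *\<^sub>R (ppar w * g' w)) \<in> borel_measurable lborel"
      by (simp add: mult_ac)
    show "AE w in lborel. norm (indicator {c..} w *\<^sub>R (ppar w * g' w)) \<le> norm (indicator {c..} w *\<^sub>R g' w)"
      using abs_ppar_le by (intro AE_I2) (auto simp: abs_mult split: split_indicator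
            intro!: mult_left_le_one_le intro: order_trans[OF abs_ppar_le])
  qed
  thus ?thesis by (simp add: set_integrable_def)
qed

lemma cont_ppar: "continuous_on {0<..} (\<lambda>w. ppar w * g' w)"
  by (intro continuous_intros cont)

text \<open>The product rule and the moving lower limit both produce ppar y * g' y, with opposite
  signs; what remains comes from the derivative of \<open>ppar\<close>.\<close>

lemma tail_has_derivative:
  assumes "y > 0" "y \<notin> \<int>"
  shows "(saw_tail g g' has_real_derivative - (saw y * g y)) (at y)"
proof -
  have "((\<lambda>y. ppar y * g y + (LINT w:{y..}|lborel. ppar w * g' w)) has_real_derivative
     (- saw y * g y + ppar y * g' y) + - (ppar y * g' y)) (at y)"
    by (rule derivative_eq_intros ppar_has_derivative der tail_integral_has_derivative cont_ppar int_ppar assms refl)+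
       (use assms in auto)
  thus ?thesis unfolding saw_tail_def [abs_def] by simp
qed

lemma isCont_tail: "y > 0 \<Longrightarrow> isCont (saw_tail g g') y"
  unfolding saw_tail_def [abs_def]
  by (intro continuous_intros isCont_ppar DERIV_isCont[OF der]
        DERIV_isCont[OF tail_integral_has_derivative[OF cont_ppar int_ppar]])

lemma tail_tendsto_0: "(saw_tail g g' \<longlongrightarrow> 0) at_top"
proof -
  have "((\<lambda>y. norm (g y)) \<longlongrightarrow> 0) at_top" using lim by (rule tendsto_norm_zero)
  moreover have "eventually (\<lambda>y. norm (ppar y * g y) \<le> norm (g y)) at_top"
    by (intro always_eventually allI)
       (auto simp: abs_mult intro!: mult_left_le_one_le intro: order_trans[OF abs_ppar_le])
  ultimately have "((\<lambda>y. ppar y * g y) \<longlongrightarrow> 0) at_top" by (rule Lim_null_comparison[rotated])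
  from tendsto_add[OF this tail_integral_tendsto_0[OF int_ppar[of 1]]]
  show ?thesis unfolding saw_tail_def [abs_def] by simp
qed

text \<open>For decreasing \<open>g\<close> the integral of |g'| from y on equals g y; with ppar <=
  1/8 the boundary term and the integral are each at most g y / 8.\<close>

lemma tail_bound:
  assumes y: "y > 0" and neg: "\<And>w. w > 0 \<Longrightarrow> g' w \<le> 0"
  shows "\<bar>saw_tail g g' y\<bar> \<le> g y / 4"
proof -
  have g_int: "(LINT w:{y..}|lborel. g' w) = 0 - g y"
    by (rule set_integral_FTC_at_top[where X = "{}"])
       (use y der int lim in \<open>auto simp: has_real_derivative_iff_has_vector_derivative[symmetric]
          intro!: continuous_at_imp_continuous_on DERIV_isCont[OF der]\<close>)
  have gy: "g y \<ge> 0"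
  proof -
    have "(LINT w:{y..}|lborel. - g' w) \<ge> 0"
      unfolding set_lebesgue_integral_def using neg y
      by (intro integral_nonneg_AE AE_I2) (auto split: split_indicator)
    thus ?thesis using g_int by (simp add: set_lebesgue_integral_def)
  qed
  have "\<bar>LINT w:{y..}|lborel. ppar w * g' w\<bar> \<le> (LINT w:{y..}|lborel. (1/8) * - g' w)"
    unfolding set_lebesgue_integral_def real_norm_def[symmetric]
  proof (rule Bochner_Integration.integral_norm_bound_integral)
    show "integrable lborel (\<lambda>x. indicat_real {y..} x *\<^sub>R (ppar x * g' x))"
      using int_ppar[OF y] by (simp add: set_integrable_def)
    show "integrable lborel (\<lambda>x. indicat_real {y..} x *\<^sub>R (1 / 8 * - g' x))"
      using int[OF y] by (simp add: set_integrable_def)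
    fix x :: real
    show "norm (indicat_real {y..} x *\<^sub>R (ppar x * g' x)) \<le> indicat_real {y..} x *\<^sub>R (1 / 8 * - g' x)"
    proof (cases "x \<ge> y")
      case True
      have "\<bar>ppar x\<bar> * \<bar>g' x\<bar> \<le> 1/8 * \<bar>g' x\<bar>" by (intro mult_right_mono abs_ppar_le) auto
      thus ?thesis using True neg[of x] y by (simp add: abs_mult)
    qed auto
  qed
  also have "\<dots> = g y / 8" using g_int by (simp add: set_lebesgue_integral_def)
  finally have 1: "\<bar>LINT w:{y..}|lborel. ppar w * g' w\<bar> \<le> g y / 8" .
  have 2: "\<bar>ppar y * g y\<bar> \<le> 1/8 * g y"
    using gy by (simp add: abs_mult) (use mult_right_mono[OF abs_ppar_le gy, of y] in simp)
  show ?thesis unfolding saw_tail_def using 1 2 by linarith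
qed

end

text \<open>Consecutive pieces share an end point, so the value propagates through the integers; the
  piece with n = 0 omits the point 0, where the functions of interest have a logarithm.\<close>

lemma const_on_unit_pieces:
  fixes D :: "real \<Rightarrow> real"
  assumes "\<And>n y. 0 < y \<Longrightarrow> real n \<le> y \<Longrightarrow> y \<le> real n + 1 \<Longrightarrow> D y = D (real n + 1)" and "y > 0"
  shows "D y = D 1"
proof -
  have nat: "D (real n + 1) = D 1" for n
  proof (induction n)
    case (Suc n)
    have "D (real n + 1) = D (real (Suc n) + 1)" by (rule assms(1)) auto
    thus ?case using Suc by simp
  qed simp
  have "D y = D (real (nat \<lfloor>y\<rfloor>) + 1)" by (rule assms(1)) (use \<open>y > 0\<close> in linarith)+
  thus ?thesis by (simp only: nat)
qed

text \<open>At the right end of the piece \<open>saw\<close> drops from its left limit 1/2 to -1/2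
  while the sum gains the term f (n + 1). The two jumps cancel, so one formula is valid on the
  closed piece.\<close>

lemma floor_sum_on_piece:
  fixes f :: "real \<Rightarrow> real"
  assumes "real n \<le> z" "z \<le> real n + 1"
  shows "saw z * f z + (\<Sum>l=1..nat \<lfloor>z\<rfloor>. f (real l)) = (z - real n - 1/2) * f z + (\<Sum>l=1..n. f (real l))"
proof (cases "z = real n + 1")
  case True
  hence "frac z = 0" by (simp add: frac_eq_0_iff)
  hence "saw z = - 1/2" by (simp add: saw_def)
  moreover have "nat \<lfloor>z\<rfloor> = Suc n" using True by (simp add: nat_add_distrib)
  moreover have "f z = f (real (Suc n))" using True by (simp add: add.commute)
  ultimately show ?thesis using True by simp
next
  case False
  hence "frac z = z - real n" using assms frac_eq_on_piece[of "int n" z] by auto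
  moreover have "nat \<lfloor>z\<rfloor> = n" using assms False by linarith
  ultimately show ?thesis by (simp add: saw_def)
qed

text \<open>Euler-Maclaurin summation with exact remainder. Inside a unit piece the left-hand side
  has derivative f + (z - n - 1/2) g - f - saw z * g = 0, and it is continuous across the integers,
  hence constant on the positive axis. The constant is read off at y = 1, where saw 1 = -1/2, the
  sum has one term and ppar 1 = 0.\<close>

theorem (in tail_weight) euler_maclaurin_tail:
  assumes f: "\<And>y. y > 0 \<Longrightarrow> (f has_real_derivative g y) (at y)"
    and F: "\<And>y. y > 0 \<Longrightarrow> (F has_real_derivative f y) (at y)" and y: "y > 0"
  shows "saw y * f y + (\<Sum>l=1..nat \<lfloor>y\<rfloor>. f (real l)) - F y + saw_tail g g' y
           = f 1 / 2 - F 1 + (LINT w:{1..}|lborel. ppar w * g' w)"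
proof -
  define D where "D = (\<lambda>y. saw y * f y + (\<Sum>l=1..nat \<lfloor>y\<rfloor>. f (real l)) - F y + saw_tail g g' y)"
  have "D y = D 1"
  proof (rule const_on_unit_pieces[where D = D, OF _ y])
    fix n :: nat and y :: real assume y: "0 < y" "real n \<le> y" "y \<le> real n + 1"
    define E where "E = (\<lambda>z. (z - real n - 1/2) * f z + (\<Sum>l=1..n. f (real l)) - F z + saw_tail g g' z)"
    have DE: "D z = E z" if "real n \<le> z" "z \<le> real n + 1" for z
      unfolding D_def E_def using floor_sum_on_piece[OF that, of f] by simp
    have "E (real n + 1) = E y"
    proof (cases "y = real n + 1")
      case False
      show ?thesis
      proof (rule DERIV_isconst_end[where f = E])
        show "y < real n + 1" using y False by simp
        show "continuous_on {y..real n + 1} E"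
          unfolding E_def
          by (intro continuous_intros continuous_at_imp_continuous_on ballI isCont_tail DERIV_isCont[OF f] DERIV_isCont[OF F])
             (use y in auto)
        fix z assume z: "y < z" "z < real n + 1"
        hence ni: "z \<notin> \<int>"
        proof -
          have "False" if "z = of_int k" for k
          proof -
            have "int n < k" "k < int n + 1" using y z that by linarith+
            thus False by simp
          qed
          thus ?thesis by (auto elim!: Ints_cases)
        qed
        have fr: "saw z = z - real n - 1/2"
          using z y frac_eq_on_piece[of "int n" z] by (simp add: saw_def)
        show "(E has_real_derivative 0) (at z)"
          unfolding E_def
          by (rule derivative_eq_intros f F tail_has_derivative ni refl | use y z fr in \<open>simp; fail\<close>)+
      qed
    qed simp
    thus "D y = D (real n + 1)" using DE[of y] DE[of "real n + 1"] y by simp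
  qed
  also have "D 1 = f 1 / 2 - F 1 + (LINT w:{1..}|lborel. ppar w * g' w)"
    by (simp add: D_def saw_def saw_tail_def)
  finally show ?thesis by (simp add: D_def)
qed

section \<open>Continuation of zeta to Re s > -1\<close>

lemma has_vector_derivative_of_real_powr:
  assumes "t > 0"
  shows "((\<lambda>t. complex_of_real t powr z) has_vector_derivative z * of_real t powr (z - 1)) (at t within A)"
  by (rule has_vector_derivative_real_field, rule has_field_derivative_powr) (use assms in \<open>auto simp: complex_nonpos_Reals_iff\<close>)

lemma norm_of_real_powr: "t > 0 \<Longrightarrow> norm (complex_of_real t powr z) = t powr Re z"
  by (simp add: norm_powr_real_powr)

lemma of_real_powr_measurable [measurable]:
  "(\<lambda>t. complex_of_real t powr z) \<in> borel_measurable borel"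
  unfolding powr_def by measurable

lemma set_integrable_powr_Ici:
  assumes "e < - 1" "a > (0::real)"
  shows "set_integrable lborel {a..} (\<lambda>t. t powr e)"
  by (rule set_integrable_FTC_nonneg(1)[where F = "\<lambda>t. t powr (e + 1) / (e + 1)" and L = 0])
     (use assms in \<open>auto simp: set_borel_measurable_def intro!: derivative_eq_intros tendsto_divide_zero tendsto_neg_powr filterlim_ident\<close>)

lemma set_integrable_ln_powr:
  assumes "e < - 1"
  shows "set_integrable lborel {1..} (\<lambda>t::real. ln t * t powr e)"
proof (rule set_integrable_FTC_nonneg(1)[where F = "\<lambda>t. ln t * t powr (e + 1) / (e + 1) - t powr (e + 1) / (e + 1)\<^sup>2" and L = 0])
  show "((\<lambda>t. ln t * t powr (e + 1) / (e + 1) - t powr (e + 1) / (e + 1)\<^sup>2) \<longlongrightarrow> 0) at_top"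
  proof -
    have "((\<lambda>t::real. ln t * t powr (e + 1)) \<longlongrightarrow> 0) at_top" using assms by real_asymp
    moreover have "((\<lambda>t::real. t powr (e + 1)) \<longlongrightarrow> 0) at_top" using assms by real_asymp
    ultimately have "((\<lambda>t. ln t * t powr (e + 1) / (e + 1) - t powr (e + 1) / (e + 1)\<^sup>2) \<longlongrightarrow> 0 / (e + 1) - 0 / (e + 1)\<^sup>2) at_top"
      using assms by (intro tendsto_intros) auto
    thus ?thesis by simp
  qed
  fix x :: real assume x: "1 \<le> x"
  show "((\<lambda>t. ln t * t powr (e + 1) / (e + 1) - t powr (e + 1) / (e + 1)\<^sup>2) has_real_derivative ln x * x powr e) (at x)"
  proof -
    have p: "((\<lambda>t. t powr (e + 1)) has_real_derivative (e + 1) * x powr e) (at x)"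
      using has_real_derivative_powr[of x "e + 1"] x by simp
    have l: "(ln has_real_derivative 1 / x) (at x)" using x by (auto intro!: derivative_eq_intros)
    have px: "x powr (e + 1) = x * x powr e" using x by (simp add: powr_add)
    have "((\<lambda>t. ln t * t powr (e + 1) / (e + 1) - t powr (e + 1) / (e + 1)\<^sup>2) has_real_derivative
       (1 / x * x powr (e + 1) + (e + 1) * x powr e * ln x) / (e + 1) - (e + 1) * x powr e / (e + 1)\<^sup>2) (at x)"
      by (intro DERIV_diff DERIV_cdivide DERIV_mult p l)
    also have "(1 / x * x powr (e + 1) + (e + 1) * x powr e * ln x) / (e + 1) - (e + 1) * x powr e / (e + 1)\<^sup>2 = ln x * x powr e"
      unfolding px using assms x by (simp add: add_divide_distrib power2_eq_square)
    finally show ?thesis .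
  qed
qed (auto simp: set_borel_measurable_def)

text \<open>The variable enters as t^(-s), so that a bounded function gives an absolutely convergent
  integral exactly in the range Re s > 1 used below; the shifts by 1 and 2 at its occurrences
  reflect this convention.\<close>

definition mellin1 :: "(real \<Rightarrow> real) \<Rightarrow> complex \<Rightarrow> complex" where
  "mellin1 \<phi> s = (LINT t:{1..}|lborel. \<phi> t *\<^sub>R (of_real t powr - s))"

context
  fixes \<phi> :: "real \<Rightarrow> real" and C :: real
  assumes meas [measurable]: "\<phi> \<in> borel_measurable borel" and bdd: "\<And>t. \<bar>\<phi> t\<bar> \<le> C"
begin

lemma mellin1_integrable:
  assumes "Re s > 1"
  shows "set_integrable lborel {1..} (\<lambda>t. \<phi> t *\<^sub>R (of_real t powr - s))"
proof -
  have "set_integrable lborel {1..} (\<lambda>t. C * t powr (- Re s))"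
    using set_integrable_powr_Ici[of "- Re s" 1] assms by simp
  thus ?thesis unfolding set_integrable_def
    by (rule Bochner_Integration.integrable_bound)
       (auto simp: abs_mult norm_of_real_powr split: split_indicator
         intro!: mult_right_mono AE_I2 order_trans[OF bdd])
qed

text \<open>The difference quotients are dominated, uniformly in the increment, by a multiple of ln
  t times a slightly larger power of t. This stays integrable as long as the increment is below half
  the distance to the line Re s = 1, which is the choice of \<open>d\<close>.\<close>

lemma mellin1_has_field_derivative:
  assumes s: "Re s > 1"
  shows "(mellin1 \<phi> has_field_derivative - (LINT t:{1..}|lborel. (\<phi> t * ln t) *\<^sub>R (of_real t powr - s))) (at s)"
proof -
  define d where "d = (Re s - 1) / 2"
  have d: "d > 0" "Re s - d > 1" using s by (auto simp: d_def field_simps)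
  have C0: "C \<ge> 0" using bdd[of 0] by simp
  let ?k = "\<lambda>(h::complex) (t::real). indicator {1..} t *\<^sub>R ((\<phi> t *\<^sub>R of_real t powr - (s + h) - \<phi> t *\<^sub>R of_real t powr - s) / h)"
  let ?lim = "\<lambda>t. indicator {1..} t *\<^sub>R (- ((\<phi> t * ln t) *\<^sub>R (of_real t powr - s)))"
  let ?w = "\<lambda>t. indicator {1..} t *\<^sub>R (C * (ln t * t powr (- (Re s - d))))"
  have "((\<lambda>h. (mellin1 \<phi> (s + h) - mellin1 \<phi> s) / h) \<longlongrightarrow> (\<integral>t. ?lim t \<partial>lborel)) (at 0)"
    unfolding tendsto_at_iff_sequentially
  proof (intro allI impI)
    fix X :: "nat \<Rightarrow> complex"
    assume X: "\<forall>i. X i \<in> UNIV - {0}" "X \<longlonglongrightarrow> 0"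
    have "eventually (\<lambda>n. dist (X n) 0 < d) sequentially"
      using X(2) d(1) by (simp add: tendsto_iff)
    then obtain n0 where n0: "\<And>n. n \<ge> n0 \<Longrightarrow> norm (X n) < d"
      by (auto simp: eventually_sequentially)
    define Y where "Y = (\<lambda>n. X (n + n0))"
    have Y: "Y n \<noteq> 0" "norm (Y n) < d" for n using X(1) n0[of "n + n0"] by (auto simp: Y_def)
    have Y0: "Y \<longlonglongrightarrow> 0" unfolding Y_def using X(2) by (rule LIMSEQ_ignore_initial_segment)
    have "(\<lambda>n. \<integral>t. ?k (Y n) t \<partial>lborel) \<longlonglongrightarrow> (\<integral>t. ?lim t \<partial>lborel)"
    proof (rule integral_dominated_convergence[where w = ?w])
      show "integrable lborel ?w"
        using set_integrable_mult_right[OF set_integrable_ln_powr[of "- (Re s - d)"], of C] d by (simp add: set_integrable_def)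
      show "AE t in lborel. (\<lambda>n. ?k (Y n) t) \<longlonglongrightarrow> ?lim t"
      proof (intro AE_I2)
        fix t :: real
        show "(\<lambda>n. ?k (Y n) t) \<longlonglongrightarrow> ?lim t"
        proof (cases "t \<ge> 1")
          case True
          have "((\<lambda>z. complex_of_real t powr - z) has_field_derivative - (of_real (ln t) * of_real t powr - s)) (at s)"
          proof -
            have "((\<lambda>z. complex_of_real t powr - z) has_field_derivative (Ln (of_real t) * of_real t powr - s) * (- 1)) (at s)"
              by (rule DERIV_chain2[OF has_field_derivative_powr_right]) (use True in \<open>auto intro!: derivative_eq_intros\<close>)
            thus ?thesis using True by (simp add: Ln_of_real)
          qed
          hence "((\<lambda>h. (of_real t powr - (s + h) - of_real t powr - s) / h) \<longlongrightarrow> - (of_real (ln t) * of_real t powr - s)) (at 0)"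
            by (simp add: DERIV_def)
          hence "(\<lambda>n. (of_real t powr - (s + Y n) - of_real t powr - s) / Y n) \<longlonglongrightarrow> - (of_real (ln t) * of_real t powr - s)"
            unfolding tendsto_at_iff_sequentially using Y Y0 by (auto simp: o_def)
          hence "(\<lambda>n. of_real (\<phi> t) * ((of_real t powr - (s + Y n) - of_real t powr - s) / Y n)) \<longlonglongrightarrow> of_real (\<phi> t) * - (of_real (ln t) * of_real t powr - s)"
            by (intro tendsto_intros)
          thus ?thesis using True by (simp add: scaleR_conv_of_real algebra_simps diff_divide_distrib)
        qed auto
      qed
      show "AE t in lborel. norm (?k (Y n) t) \<le> ?w t" for n
      proof (intro AE_I2)
        fix t :: real
        show "norm (?k (Y n) t) \<le> ?w t"
        proof (cases "t \<ge> 1")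
          case True
          have ln0: "ln t \<ge> 0" using True by simp
          have eq: "of_real t powr - (s + Y n) - of_real t powr - s = of_real t powr - s * (exp (- Y n * of_real (ln t)) - 1)"
            using True by (simp add: powr_def Ln_of_real algebra_simps exp_add [symmetric] exp_diff exp_minus field_simps)
          \<comment> \<open>Taylor remainder of order zero: |e^z - 1| <= e^|Re z| |z|. The factor |Y
            n| that it produces cancels the denominator of the difference quotient.\<close>
          have "norm (exp (- Y n * of_real (ln t)) - 1) \<le> exp \<bar>Re (- Y n * of_real (ln t))\<bar> * norm (- Y n * of_real (ln t))"
            using Taylor_exp[of "- Y n * of_real (ln t)" 0] by simp
          also have "\<dots> \<le> exp (d * ln t) * (norm (Y n) * ln t)"
          proof (intro mult_mono)
            have "\<bar>Re (- Y n * of_real (ln t))\<bar> \<le> d * ln t"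
              using abs_Re_le_cmod[of "Y n"] Y(2)[of n] ln0 by (auto simp: abs_mult intro!: mult_right_mono)
            thus "exp \<bar>Re (- Y n * of_real (ln t))\<bar> \<le> exp (d * ln t)" by simp
          qed (use ln0 in \<open>auto simp: norm_mult\<close>)
          also have "exp (d * ln t) = t powr d" using True by (simp add: powr_def)
          finally have b: "norm (exp (- Y n * of_real (ln t)) - 1) \<le> t powr d * (norm (Y n) * ln t)" .
          have "norm (?k (Y n) t) = \<bar>\<phi> t\<bar> * (t powr (- Re s) * norm (exp (- Y n * of_real (ln t)) - 1)) / norm (Y n)"
            using True by (simp only: scaleR_diff_right [symmetric] eq) (simp add: norm_mult norm_divide norm_of_real_powr)
          also have "\<dots> \<le> C * (t powr (- Re s) * (t powr d * (norm (Y n) * ln t))) / norm (Y n)"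
            by (intro divide_right_mono mult_mono bdd b mult_left_mono) (use C0 in auto)
          also have "\<dots> = C * (ln t * t powr (- (Re s - d)))"
            using Y(1)[of n] True by (simp add: powr_diff powr_minus field_simps)
          finally show ?thesis using True by simp
        qed auto
      qed
    qed auto
    also have "(\<lambda>n. \<integral>t. ?k (Y n) t \<partial>lborel) = (\<lambda>n. (mellin1 \<phi> (s + Y n) - mellin1 \<phi> s) / Y n)"
    proof
      fix n
      have R: "Re (s + Y n) > 1" using Y(2)[of n] d abs_Re_le_cmod[of "Y n"] by auto
      have "(\<integral>t. ?k (Y n) t \<partial>lborel) = (LINT t:{1..}|lborel. \<phi> t *\<^sub>R of_real t powr - (s + Y n) - \<phi> t *\<^sub>R of_real t powr - s) / Y n"
        unfolding set_lebesgue_integral_def by (subst integral_divide_zero [symmetric]) (simp add: scaleR_conv_of_real)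
      also have "\<dots> = (mellin1 \<phi> (s + Y n) - mellin1 \<phi> s) / Y n"
        unfolding mellin1_def by (subst set_integral_diff) (use mellin1_integrable[OF R] mellin1_integrable[OF s] in auto)
      finally show "(\<integral>t. ?k (Y n) t \<partial>lborel) = (mellin1 \<phi> (s + Y n) - mellin1 \<phi> s) / Y n" .
    qed
    finally have "(\<lambda>n. ((\<lambda>h. (mellin1 \<phi> (s + h) - mellin1 \<phi> s) / h) \<circ> X) (n + n0)) \<longlonglongrightarrow> (\<integral>t. ?lim t \<partial>lborel)"
      by (simp add: Y_def)
    thus "((\<lambda>h. (mellin1 \<phi> (s + h) - mellin1 \<phi> s) / h) \<circ> X) \<longlonglongrightarrow> (\<integral>t. ?lim t \<partial>lborel)"
      by (rule LIMSEQ_offset)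
  qed
  also have "(\<integral>t. ?lim t \<partial>lborel) = - (LINT t:{1..}|lborel. (\<phi> t * ln t) *\<^sub>R (of_real t powr - s))"
    unfolding set_lebesgue_integral_def by simp
  finally show ?thesis unfolding DERIV_def .
qed

end

definition zeta_tail :: "complex \<Rightarrow> complex" where
  "zeta_tail s = mellin1 ppar (s + 2)"

text \<open>Second order Euler-Maclaurin expression of zeta. With B_2 in place of
  \<open>ppar\<close> a further term s/12 would appear; here it is contained in the integral.
  Convergence for Re s > -1 covers both points, 0 and 1, at which Taylor coefficients are taken
  later.\<close>

definition zeta1 :: "complex \<Rightarrow> complex" where
  "zeta1 s = 1 / (s - 1) + 1/2 + s * (s + 1) * zeta_tail s"

lemma zeta_tail_has_field_derivative:
  assumes "Re s > - 1"
  shows "(zeta_tail has_field_derivative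
           - (LINT t:{1..}|lborel. (ppar t * ln t) *\<^sub>R (of_real t powr - (s + 2)))) (at s)"
proof -
  have "((\<lambda>s. mellin1 ppar (s + 2)) has_field_derivative
           - (LINT t:{1..}|lborel. (ppar t * ln t) *\<^sub>R (of_real t powr - (s + 2))) * 1) (at s)"
    by (rule DERIV_chain2[OF mellin1_has_field_derivative[OF _ abs_ppar_le]])
       (use assms in \<open>auto intro!: derivative_eq_intros\<close>)
  thus ?thesis by (simp add: zeta_tail_def [abs_def])
qed

lemma holomorphic_zeta_tail: "zeta_tail holomorphic_on {s. Re s > - 1}"
  using zeta_tail_has_field_derivative
  by (auto simp: holomorphic_on_open open_halfspace_Re_gt)

lemma holomorphic_zeta1: "zeta1 holomorphic_on {s. Re s > - 1} - {1}"
  unfolding zeta1_def [abs_def]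
  by (intro holomorphic_intros holomorphic_on_subset[OF holomorphic_zeta_tail]) auto

text \<open>Each unit interval contributes the error of the trapezoidal rule for t^(-s). Halves of
  neighbouring end values add up to full terms, which leaves the corrections -1/2 and -N^(-s)/2 at
  the two ends of the range.\<close>

lemma zeta1_partial_sums:
  fixes s :: complex
  assumes s: "s \<noteq> 1" and N: "N \<ge> 1"
  shows "((\<lambda>t. ppar t *\<^sub>R (s * (s + 1) * of_real t powr - (s + 2))) has_integral
            (\<Sum>n=1..N. of_nat n powr - s) - 1/2 - of_nat N powr - s / 2 - (of_nat N powr (1 - s) - 1) / (1 - s)) {1..real N}"
  using N
proof (induction N rule: dec_induct)
  case base
  show ?case using has_integral_refl(1)[of _ "1::real"] by simp
next
  case (step N)
  let ?f = "\<lambda>t. ppar t *\<^sub>R (s * (s + 1) * of_real t powr - (s + 2))"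
  \<comment> \<open>Found by integrating by parts twice. The first term vanishes at both end points,
    and N + 1/2 - t takes the values 1/2 and -1/2 there.\<close>
  define \<Theta> where "\<Theta> = (\<lambda>t. ((t - real N) * (real N + 1 - t) / 2) *\<^sub>R (- s * of_real t powr (- s - 1))
      - (real N + 1/2 - t) *\<^sub>R (of_real t powr - s) - of_real t powr (1 - s) / (1 - s))"
  have "(?f has_integral (\<Theta> (real N + 1) - \<Theta> (real N))) {real N..real N + 1}"
  proof (rule fundamental_theorem_of_calculus)
    fix t assume t: "t \<in> {real N..real N + 1}"
    hence t0: "t > 0" using step by auto
    have p: "ppar t = (t - real N) * (real N + 1 - t) / 2" using ppar_eq_on_piece[of "int N" t] t by simp
    have e: "- s - 1 - 1 = - (s + 2)" "1 - s - 1 = - s" by auto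
    have "(\<Theta> has_vector_derivative
        ((t - real N) * (real N + 1 - t) / 2) *\<^sub>R
     (- s * ((- s - 1) * complex_of_real t powr (- s - 1 - 1)) +
      0 * complex_of_real t powr (- s - 1)) +
     ((((1 - 0) * (real N + 1 - t) + (0 - 1) * (t - real N)) * 2 -
       (t - real N) * (real N + 1 - t) * 0) /
      (2 * 2)) *\<^sub>R
     (- s * complex_of_real t powr (- s - 1)) -
     ((real N + 1 / 2 - t) *\<^sub>R (- s * complex_of_real t powr (- s - 1)) +
      (0 - 1) *\<^sub>R complex_of_real t powr - s) -
     (1 - s) * complex_of_real t powr (1 - s - 1) / (1 - s)) (at t within {real N..real N + 1})"
      unfolding \<Theta>_def
      by (rule derivative_eq_intros has_vector_derivative_of_real_powr t0 refl
            has_vector_derivative_scaleR has_vector_derivative_mult_right has_vector_derivative_diff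
            has_vector_derivative_divide has_vector_derivative_minus | simp; fail)+
    moreover have "((t - real N) * (real N + 1 - t) / 2) *\<^sub>R
     (- s * ((- s - 1) * complex_of_real t powr (- s - 1 - 1)) +
      0 * complex_of_real t powr (- s - 1)) +
     ((((1 - 0) * (real N + 1 - t) + (0 - 1) * (t - real N)) * 2 -
       (t - real N) * (real N + 1 - t) * 0) /
      (2 * 2)) *\<^sub>R
     (- s * complex_of_real t powr (- s - 1)) -
     ((real N + 1 / 2 - t) *\<^sub>R (- s * complex_of_real t powr (- s - 1)) +
      (0 - 1) *\<^sub>R complex_of_real t powr - s) -
     (1 - s) * complex_of_real t powr (1 - s - 1) / (1 - s) = ?f t"
      unfolding p e using s by (simp add: scaleR_conv_of_real field_simps)
    ultimately show "(\<Theta> has_vector_derivative ?f t) (at t within {real N..real N + 1})" by simp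
  qed auto
  from has_integral_combine[OF _ _ step.IH this]
  have "(?f has_integral (\<Sum>n=1..N. of_nat n powr - s) - 1/2 - of_nat N powr - s / 2 - (of_nat N powr (1 - s) - 1) / (1 - s)
      + (\<Theta> (real N + 1) - \<Theta> (real N))) {1..real N + 1}"
    using step by auto
  also have "(\<Sum>n=1..N. of_nat n powr - s) - 1/2 - of_nat N powr - s / 2 - (of_nat N powr (1 - s) - 1) / (1 - s)
      + (\<Theta> (real N + 1) - \<Theta> (real N))
    = (\<Sum>n=1..Suc N. of_nat n powr - s) - 1/2 - of_nat (Suc N) powr - s / 2 - (of_nat (Suc N) powr (1 - s) - 1) / (1 - s)"
    by (simp add: \<Theta>_def scaleR_conv_of_real diff_divide_distrib algebra_simps)
  finally show ?case by (simp add: add.commute)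
qed

lemma zeta1_sums:
  assumes s: "Re s > 1"
  shows "(\<lambda>n. of_nat (Suc n) powr - s) sums zeta1 s"
proof -
  have s1: "s \<noteq> 1" using s by auto
  have int: "set_integrable lborel {1..} (\<lambda>t. ppar t *\<^sub>R (of_real t powr - (s + 2)))"
    by (rule mellin1_integrable[OF _ abs_ppar_le]) (use s in auto)
  hence int': "set_integrable lborel {1..} (\<lambda>t. ppar t *\<^sub>R (s * (s + 1) * of_real t powr - (s + 2)))"
    by (simp add: mult.commute[of "s * (s + 1)"] flip: mult_scaleR_left)
  have v: "(LINT t:{1..}|lborel. ppar t *\<^sub>R (s * (s + 1) * of_real t powr - (s + 2))) = s * (s + 1) * zeta_tail s"
    unfolding zeta_tail_def mellin1_def by (simp add: mult_scaleR_right [symmetric] del: mult_scaleR_right)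
  have "(\<lambda>N. LINT t:{1..real N}|lborel. ppar t *\<^sub>R (s * (s + 1) * of_real t powr - (s + 2))) \<longlonglongrightarrow> s * (s + 1) * zeta_tail s"
    unfolding v [symmetric]
    by (rule filterlim_compose[OF tendsto_set_lebesgue_integral_at_top[OF _ int'] filterlim_real_sequentially]) auto
  moreover have "eventually (\<lambda>N. (LINT t:{1..real N}|lborel. ppar t *\<^sub>R (s * (s + 1) * of_real t powr - (s + 2)))
     = (\<Sum>n=1..N. of_nat n powr - s) - 1/2 - of_nat N powr - s / 2 - (of_nat N powr (1 - s) - 1) / (1 - s)) sequentially"
    using eventually_ge_at_top[of 1]
  proof eventually_elim
    case (elim N)
    have "set_integrable lborel {1..real N} (\<lambda>t. ppar t *\<^sub>R (s * (s + 1) * of_real t powr - (s + 2)))"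
      by (rule set_integrable_subset[OF int']) auto
    from set_borel_integral_eq_integral(2)[OF this] show ?case
      using zeta1_partial_sums[OF s1 elim] by (simp add: integral_unique)
  qed
  ultimately have A: "(\<lambda>N. (\<Sum>n=1..N. of_nat n powr - s) - 1/2 - of_nat N powr - s / 2 - (of_nat N powr (1 - s) - 1) / (1 - s)) \<longlonglongrightarrow> s * (s + 1) * zeta_tail s"
    by (rule Lim_transform_eventually)
  have l: "(\<lambda>N. of_nat N powr z :: complex) \<longlonglongrightarrow> 0" if "Re z < 0" for z
    using tendsto_neg_powr_complex_of_real[OF filterlim_real_sequentially that] by simp
  have "(\<lambda>N. ((\<Sum>n=1..N. of_nat n powr - s) - 1/2 - of_nat N powr - s / 2 - (of_nat N powr (1 - s) - 1) / (1 - s))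
      + 1/2 + of_nat N powr - s / 2 + (of_nat N powr (1 - s) - 1) / (1 - s)) \<longlonglongrightarrow> s * (s + 1) * zeta_tail s + 1/2 + 0 / 2 + (0 - 1) / (1 - s)"
    by (intro tendsto_intros A l) (use s s1 in auto)
  moreover have "s * (s + 1) * zeta_tail s + 1/2 + 0 / 2 + (0 - 1) / (1 - s) = zeta1 s"
    using s1 by (simp add: zeta1_def field_simps)
  ultimately have "(\<lambda>N. \<Sum>n=1..N. of_nat n powr - s) \<longlonglongrightarrow> zeta1 s" by simp
  hence "(\<lambda>N. \<Sum>n<N. of_nat (Suc n) powr - s) \<longlonglongrightarrow> zeta1 s"
    by (simp only: One_nat_def sum.atLeast1_atMost_eq)
  thus ?thesis by (simp add: sums_def)
qed

text \<open>Antiderivatives pieced together from unit intervals give integrals up to integers only;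
  for a nonnegative integrand monotone convergence makes these sufficient.\<close>

lemma nn_integral_Ici_limit:
  fixes f :: "real \<Rightarrow> real"
  assumes [measurable]: "f \<in> borel_measurable borel" and nn: "\<And>t. a \<le> t \<Longrightarrow> 0 \<le> f t"
    and I: "\<And>M. M \<ge> Mmin \<Longrightarrow> (f has_integral V M) {a..real M}" and lim: "V \<longlonglongrightarrow> L"
  shows "(\<integral>\<^sup>+t. ennreal (indicator {a..} t * f t) \<partial>lborel) = ennreal L"
proof (rule LIMSEQ_unique)
  have "incseq (\<lambda>M t. ennreal (indicator {a..real M} t * f t))"
    using nn by (auto simp: incseq_def le_fun_def split: split_indicator)
  thus "(\<lambda>M. \<integral>\<^sup>+t. ennreal (indicator {a..real M} t * f t) \<partial>lborel) \<longlonglongrightarrow> (\<integral>\<^sup>+t. ennreal (indicator {a..} t * f t) \<partial>lborel)"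
  proof (rule nn_integral_LIMSEQ)
    fix t :: real
    have "eventually (\<lambda>M. ennreal (indicator {a..real M} t * f t) = ennreal (indicator {a..} t * f t)) sequentially"
      by (rule eventually_sequentiallyI[of "nat \<lceil>t\<rceil>"]) (auto split: split_indicator, linarith?)
    thus "(\<lambda>M. ennreal (indicator {a..real M} t * f t)) \<longlonglongrightarrow> ennreal (indicator {a..} t * f t)"
      by (rule tendsto_eventually)
  qed auto
  have "eventually (\<lambda>M. ennreal (V M) = (\<integral>\<^sup>+t. ennreal (indicator {a..real M} t * f t) \<partial>lborel)) sequentially"
    using eventually_ge_at_top[of Mmin]
    by eventually_elim (rule nn_integral_has_integral_lebesgue[symmetric, OF _ I], use nn in auto)
  moreover have "(\<lambda>M. ennreal (V M)) \<longlonglongrightarrow> ennreal L" using lim by (rule tendsto_ennrealI)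
  ultimately show "(\<lambda>M. \<integral>\<^sup>+t. ennreal (indicator {a..real M} t * f t) \<partial>lborel) \<longlonglongrightarrow> ennreal L"
    by (rule Lim_transform_eventually[rotated])
qed

lemma set_integrable_has_integral_nonneg:
  fixes f :: "real \<Rightarrow> real"
  assumes [measurable]: "f \<in> borel_measurable borel" "S \<in> sets borel" and nn: "\<And>t. t \<in> S \<Longrightarrow> 0 \<le> f t"
    and I: "(f has_integral L) S"
  shows "set_integrable lborel S f" "(LINT t:S|lborel. f t) = L"
proof -
  have eq: "(\<integral>\<^sup>+t. ennreal (indicator S t * f t) \<partial>lborel) = ennreal L"
    by (rule nn_integral_has_integral_lebesgue[OF nn I])
  show i: "set_integrable lborel S f"
    unfolding set_integrable_def
    by (rule integrableI_nonneg) (use nn eq in \<open>auto split: split_indicator\<close>)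
  show "(LINT t:S|lborel. f t) = L"
    using set_borel_integral_eq_integral(2)[OF i] I by (simp add: integral_unique)
qed

lemma set_integral_powr_from_0:
  assumes "e > - 1" "c \<ge> (0::real)"
  shows "set_integrable lborel {0..c} (\<lambda>t. t powr e)" "(LINT t:{0..c}|lborel. t powr e) = c powr (e + 1) / (e + 1)"
  by (rule set_integrable_has_integral_nonneg[OF _ _ _ has_integral_powr_from_0[OF assms]]; simp)+

lemma abs_frac_le: "\<bar>frac t\<bar> \<le> (1::real)"
  by (simp add: frac_ge_0 frac_lt_1 less_imp_le)

lemma abs_saw_le: "\<bar>saw t\<bar> \<le> 1"
  unfolding saw_def using frac_ge_0[of t] frac_lt_1[of t] by linarith

lemma continuous_on_of_real_powr:
  "A \<subseteq> {0<..} \<Longrightarrow> continuous_on A (\<lambda>t. complex_of_real t powr z)"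
  unfolding continuous_on_eq_continuous_within
  using has_vector_derivative_continuous[OF has_vector_derivative_of_real_powr] by (auto simp: subset_iff)

lemma mellin1_one:
  assumes "Re s > 1"
  shows "mellin1 (\<lambda>_. 1) s = 1 / (s - 1)"
proof -
  have s1: "s \<noteq> 1" using assms by auto
  have "mellin1 (\<lambda>_. 1) s = 0 - (of_real 1 powr (1 - s) / (1 - s))"
    unfolding mellin1_def
  proof (rule set_integral_FTC_at_top[where X = "{}" and F = "\<lambda>t. of_real t powr (1 - s) / (1 - s)"])
    show "set_integrable lborel {1..} (\<lambda>t. 1 *\<^sub>R complex_of_real t powr - s)"
      by (rule mellin1_integrable[where C = 1]) (use assms in auto)
    have d: "((\<lambda>t. complex_of_real t powr (1 - s) / (1 - s)) has_vector_derivative 1 *\<^sub>R complex_of_real x powr - s) (at x within A)"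
      if "x \<ge> 1" for x A
    proof -
      have "((\<lambda>t. complex_of_real t powr (1 - s) / (1 - s)) has_vector_derivative (1 - s) * complex_of_real x powr (1 - s - 1) / (1 - s)) (at x within A)"
        by (rule has_vector_derivative_divide[OF has_vector_derivative_of_real_powr]) (use that in auto)
      thus ?thesis using s1 by simp
    qed
    show "continuous_on {1..} (\<lambda>t. complex_of_real t powr (1 - s) / (1 - s))"
      by (intro continuous_intros continuous_on_of_real_powr) (use s1 in auto)
    show "((\<lambda>t. complex_of_real t powr (1 - s) / (1 - s)) has_vector_derivative 1 *\<^sub>R complex_of_real x powr - s) (at x)"
      if "1 < x" for x using d that by auto
    show "((\<lambda>t. complex_of_real t powr (1 - s) / (1 - s)) \<longlongrightarrow> 0) at_top"
      by (rule tendsto_divide_zero[OF tendsto_neg_powr_complex_of_real[OF filterlim_ident]]) (use assms in auto)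
  qed auto
  thus ?thesis using s1 by (simp add: field_simps)
qed

text \<open>One integration by parts back from \<open>ppar\<close> to its derivative -
  \<open>saw\<close>. It lowers the decay by one power, whence Re s > 0, and the constant 1/2 inside
  \<open>saw\<close> integrates to 1 / (2 s).\<close>

lemma zeta_tail_conv_mellin1_frac:
  assumes s: "Re s > 0"
  shows "(s + 1) * zeta_tail s = 1 / (2 * s) - mellin1 frac (s + 1)"
proof -
  let ?F = "\<lambda>t. - (ppar t *\<^sub>R (complex_of_real t powr (- s - 1)))"
  let ?f = "\<lambda>t. (s + 1) * (ppar t *\<^sub>R (complex_of_real t powr - (s + 2))) + saw t *\<^sub>R (complex_of_real t powr - (s + 1))"
  have i1: "set_integrable lborel {1..} (\<lambda>t. ppar t *\<^sub>R (complex_of_real t powr - (s + 2)))"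
    by (rule mellin1_integrable[OF _ abs_ppar_le]) (use s in auto)
  have i2: "set_integrable lborel {1..} (\<lambda>t. saw t *\<^sub>R (complex_of_real t powr - (s + 1)))"
    by (rule mellin1_integrable[OF _ abs_saw_le]) (use s in auto)
  have i3: "set_integrable lborel {1..} (\<lambda>t. frac t *\<^sub>R (complex_of_real t powr - (s + 1)))"
    by (rule mellin1_integrable[OF _ abs_frac_le]) (use s in auto)
  have i4: "set_integrable lborel {1..} (\<lambda>t. 1 *\<^sub>R (complex_of_real t powr - (s + 1)))"
    by (rule mellin1_integrable[where C = 1]) (use s in auto)
  have "(LINT t:{1..}|lborel. ?f t) = 0 - ?F 1"
  proof (rule set_integral_FTC_at_top[where X = \<int>])
    show "set_integrable lborel {1..} ?f"
      by (intro set_integral_add set_integrable_mult_right i1 i2)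
    show "continuous_on {1..} ?F"
      by (intro continuous_intros continuous_on_of_real_powr) auto
    show "(?F has_vector_derivative ?f x) (at x)" if "1 < x" "x \<notin> \<int>" for x
    proof -
      have "(?F has_vector_derivative - (ppar x *\<^sub>R ((- s - 1) * of_real x powr (- s - 1 - 1)) + (- saw x) *\<^sub>R (of_real x powr (- s - 1)))) (at x)"
        by (intro has_vector_derivative_minus has_vector_derivative_scaleR has_vector_derivative_of_real_powr ppar_has_derivative)
           (use that in auto)
      also have "- (ppar x *\<^sub>R ((- s - 1) * of_real x powr (- s - 1 - 1)) + (- saw x) *\<^sub>R (of_real x powr (- s - 1))) = ?f x"
      proof -
        have e: "- s - 1 - 1 = - (s + 2)" "- s - 1 = - (s + 1)" by simp_all
        have E: "of_real x powr (- s - 1 - 1) = complex_of_real x powr - (s + 2)"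
          "of_real x powr (- s - 1) = complex_of_real x powr - (s + 1)" by (simp only: e(1), simp only: e(2))
        have "- (p *\<^sub>R ((- s - 1) * P) + (- q) *\<^sub>R Q) = (s + 1) * (p *\<^sub>R P) + q *\<^sub>R Q" for p q and P Q :: complex
          by (simp add: scaleR_conv_of_real algebra_simps)
        thus ?thesis unfolding E .
      qed
      finally show ?thesis .
    qed
    show "(?F \<longlongrightarrow> 0) at_top"
    proof (rule Lim_null_comparison)
      have "((\<lambda>t. complex_of_real t powr (- s - 1)) \<longlongrightarrow> 0) at_top"
        by (rule tendsto_neg_powr_complex_of_real[OF filterlim_ident]) (use s in auto)
      thus "((\<lambda>t. norm (complex_of_real t powr (- s - 1))) \<longlongrightarrow> 0) at_top" by (rule tendsto_norm_zero)
      show "eventually (\<lambda>t. norm (?F t) \<le> norm (complex_of_real t powr (- s - 1))) at_top"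
        by (intro always_eventually allI)
           (auto simp: norm_mult intro!: mult_left_le_one_le intro: order_trans[OF abs_ppar_le])
    qed
  qed (rule finite_Ints_inter_Icc)
  also have "(LINT t:{1..}|lborel. ?f t) = (LINT t:{1..}|lborel. (s + 1) * (ppar t *\<^sub>R (complex_of_real t powr - (s + 2))))
      + (LINT t:{1..}|lborel. saw t *\<^sub>R (complex_of_real t powr - (s + 1)))"
    by (rule set_integral_add(2)[OF set_integrable_mult_right[OF i1] i2])
  also have "(LINT t:{1..}|lborel. (s + 1) * (ppar t *\<^sub>R (complex_of_real t powr - (s + 2)))) = (s + 1) * zeta_tail s"
    unfolding zeta_tail_def mellin1_def by (rule set_integral_mult_right)
  also have "(\<lambda>t. saw t *\<^sub>R (complex_of_real t powr - (s + 1)))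
     = (\<lambda>t. frac t *\<^sub>R (complex_of_real t powr - (s + 1)) - 1/2 * (1 *\<^sub>R (complex_of_real t powr - (s + 1))))"
    by (simp add: saw_def scaleR_conv_of_real algebra_simps)
  also have "(LINT t:{1..}|lborel. \<dots> t) = mellin1 frac (s + 1) - 1/2 * mellin1 (\<lambda>_. 1) (s + 1)"
    unfolding mellin1_def by (subst set_integral_diff) (use i3 i4 in \<open>auto intro!: set_integrable_mult_right\<close>)
  also have "mellin1 (\<lambda>_. 1) (s + 1) = 1 / s" using mellin1_one[of "s + 1"] s by simp
  finally show ?thesis by (simp add: field_simps)
qed

text \<open>Below 1 the fractional part of t is t itself, and t^(-s) integrates over (0, 1) to 1 /
  (1 - s), convergent because Re s < 1. Multiplied by -s this is 1 / (s - 1) + 1; together with the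
  contribution -1/2 of the constant in \<open>saw\<close> it is the elementary part of
  \<open>zeta1\<close>.\<close>

lemma zeta1_strip:
  assumes s: "0 < Re s" "Re s < 1"
  shows "set_integrable lborel {0<..} (\<lambda>t. frac t *\<^sub>R (complex_of_real t powr (- s - 1)))" (is ?A)
    and "zeta1 s = - s * (LINT t:{0<..}|lborel. frac t *\<^sub>R (complex_of_real t powr (- s - 1)))" (is ?B)
proof -
  let ?f = "\<lambda>t. frac t *\<^sub>R (complex_of_real t powr (- s - 1))"
  have s1: "s \<noteq> 1" "s \<noteq> 0" using s by auto
  have le: "norm (complex_of_real x powr - s) \<le> x powr - Re s" if "0 \<le> x" for x
    using that by (cases "x = 0") (simp_all add: norm_of_real_powr)
  have i0: "set_integrable lborel {0..1} (\<lambda>t. complex_of_real t powr - s)"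
    unfolding set_integrable_def
    by (rule Bochner_Integration.integrable_bound[OF set_integral_powr_from_0(1)[of "- Re s" 1, unfolded set_integrable_def]])
       (use s le in \<open>auto intro!: AE_I2 split: split_indicator\<close>)
  have v0: "(LINT t:{0..1}|lborel. complex_of_real t powr - s) = of_real 1 powr (1 - s) / (1 - s) - of_real 0 powr (1 - s) / (1 - s)"
  proof (rule set_integral_FTC[where X = "{}" and F = "\<lambda>t. of_real t powr (1 - s) / (1 - s)"])
    show "continuous_on {0..1} (\<lambda>t. complex_of_real t powr (1 - s) / (1 - s))"
    proof (intro continuous_at_imp_continuous_on ballI)
      fix x :: real assume "x \<in> {0..1}"
      show "isCont (\<lambda>t. complex_of_real t powr (1 - s) / (1 - s)) x"
      proof (cases "x = 0")
        case True
        have "((\<lambda>t. complex_of_real t powr (1 - s)) \<longlongrightarrow> 0) (at 0)"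
          by (rule tendsto_powr_complex_0[of _ _ _ "1 - s"]) (use s in \<open>auto intro!: tendsto_eq_intros\<close>)
        thus ?thesis using True by (auto simp: isCont_def intro: tendsto_divide_zero)
      next
        case False
        hence "x > 0" using \<open>x \<in> {0..1}\<close> by auto
        from has_vector_derivative_divide[OF has_vector_derivative_of_real_powr[OF this]]
        show ?thesis by (rule has_vector_derivative_continuous)
      qed
    qed
    show "((\<lambda>t. complex_of_real t powr (1 - s) / (1 - s)) has_vector_derivative of_real x powr - s) (at x)" if "0 < x" for x
      using has_vector_derivative_divide[OF has_vector_derivative_of_real_powr[OF that, of "1 - s"], of "1 - s"] s1 by simp
  qed (use i0 in auto)
  have ae: "AE t in lborel. indicator {0<..1} t *\<^sub>R ?f t = indicator {0..1} t *\<^sub>R (complex_of_real t powr - s)"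
    using AE_lborel_singleton[of "1::real"] AE_lborel_singleton[of "0::real"]
  proof eventually_elim
    case (elim t)
    show ?case
    proof (cases "0 < t \<and> t < 1")
      case True
      have "of_real t powr (- s) = of_real t * complex_of_real t powr (- s - 1)"
        using True by (simp add: powr_diff)
      moreover have "frac t = t" using True by (simp add: frac_eq)
      ultimately show ?thesis using True by (simp add: scaleR_conv_of_real)
    qed (use elim in auto)
  qed
  have j0: "set_integrable lborel {0<..1} ?f"
    unfolding set_integrable_def
    by (subst integrable_cong_AE[OF _ _ ae]) (use i0 in \<open>auto simp: set_integrable_def\<close>)
  have w0: "(LINT t:{0<..1}|lborel. ?f t) = 1 / (1 - s)"
  proof -
    have "(LINT t:{0<..1}|lborel. ?f t) = (LINT t:{0..1}|lborel. complex_of_real t powr - s)"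
      unfolding set_lebesgue_integral_def by (rule integral_cong_AE[OF _ _ ae]) auto
    thus ?thesis using v0 by simp
  qed
  have j1: "set_integrable lborel {1..} ?f"
  proof -
    have "set_integrable lborel {1..} (\<lambda>t. frac t *\<^sub>R (complex_of_real t powr - (s + 1)))"
      by (rule mellin1_integrable[OF _ abs_frac_le]) (use s in auto)
    thus ?thesis by (simp only: minus_add_distrib diff_conv_add_uminus)
  qed
  have un: "{0<..} = {0<..1} \<union> {1::real..}" by auto
  show ?A unfolding un by (rule set_integrable_Un[OF j0 j1]) auto
  have "(LINT t:{0<..}|lborel. ?f t) = (LINT t:{0<..1}|lborel. ?f t) + (LINT t:{1..}|lborel. ?f t)"
    unfolding un by (rule set_integral_Un_AE)
      (use j0 j1 AE_lborel_singleton[of "1::real"] in \<open>auto elim!: eventually_mono\<close>)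
  also have "(LINT t:{1..}|lborel. ?f t) = mellin1 frac (s + 1)" by (simp add: mellin1_def)
  also have "mellin1 frac (s + 1) = 1 / (2 * s) - (s + 1) * zeta_tail s"
    using zeta_tail_conv_mellin1_frac[OF s(1)] by simp
  finally have v: "(LINT t:{0<..}|lborel. ?f t) = 1 / (1 - s) + (1 / (2 * s) - (s + 1) * zeta_tail s)"
    using w0 by simp
  have a: "s * (1 / (1 - s)) = - 1 - 1 / (s - 1)" and b: "s * (1 / (2 * s)) = 1/2"
    using s1 by (simp_all add: divide_simps) (simp_all add: algebra_simps)
  have "zeta1 s = - (s * (1 / (1 - s))) - s * (1 / (2 * s)) + s * (s + 1) * zeta_tail s"
    unfolding a b zeta1_def by simp
  also have "\<dots> = - s * (1 / (1 - s) + (1 / (2 * s) - (s + 1) * zeta_tail s))"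
  proof -
    have "- (s * A) - s * B + s * (s + 1) * Z = - s * (A + (B - (s + 1) * Z))" for A B Z :: complex
      by (simp add: algebra_simps)
    thus ?thesis .
  qed
  finally show ?B unfolding v .
qed

section \<open>Gamma and beta integrals of nonnegative functions\<close>

lemma nn_integral_gamma:
  assumes a: "a > 0" and w: "w > (0::real)"
  shows "(\<integral>\<^sup>+x. ennreal (indicator {0..} x * (x powr (a - 1) * exp (- (w * x)))) \<partial>lborel) = ennreal (Gamma a * w powr (- a))"
proof -
  let ?g = "\<lambda>t::real. ennreal (indicator {0..} t * t powr (a - 1) / exp t)"
  have "ennreal (Gamma a) = (\<integral>\<^sup>+t. ?g t \<partial>lborel)" by (rule Gamma_conv_nn_integral_real[OF a])
  also have "\<dots> = ennreal \<bar>w\<bar> * (\<integral>\<^sup>+x. ?g (0 + w * x) \<partial>lborel)"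
    by (rule nn_integral_real_affine) (use w in auto)
  also have "(\<lambda>x. ?g (0 + w * x)) = (\<lambda>x. ennreal (w powr (a - 1)) * ennreal (indicator {0..} x * (x powr (a - 1) * exp (- (w * x)))))"
    using w by (auto simp: fun_eq_iff powr_mult exp_minus field_simps ennreal_mult'[symmetric] zero_le_mult_iff split: split_indicator)
  also have "ennreal \<bar>w\<bar> * (\<integral>\<^sup>+x. \<dots> x \<partial>lborel) = ennreal (w powr a) * (\<integral>\<^sup>+x. ennreal (indicator {0..} x * (x powr (a - 1) * exp (- (w * x)))) \<partial>lborel)"
    using w by (subst nn_integral_cmult) (auto simp: mult.assoc[symmetric] ennreal_mult'[symmetric] powr_mult_base)
  finally have "ennreal (w powr (- a)) * ennreal (Gamma a) = (ennreal (w powr (- a)) * ennreal (w powr a)) * (\<integral>\<^sup>+x. ennreal (indicator {0..} x * (x powr (a - 1) * exp (- (w * x)))) \<partial>lborel)"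
    by (simp add: mult.assoc)
  also have "ennreal (w powr (- a)) * ennreal (w powr a) = 1"
    using w by (simp add: ennreal_mult'[symmetric] powr_add[symmetric])
  finally show ?thesis using Gamma_real_pos[OF a] by (simp add: ennreal_mult'[symmetric] mult.commute)
qed

text \<open>1 / (1 + v) is the integral of e^(-w (1 + v)) over w > 0; exchanging the order leaves
  two Gamma integrals, with parameters a and 1 - a.\<close>

lemma nn_integral_powr_over_one_plus:
  assumes "0 < a" "a < (1::real)"
  shows "(\<integral>\<^sup>+v. ennreal (indicator {0..} v * (v powr (a - 1) / (1 + v))) \<partial>lborel) = ennreal (Gamma a * Gamma (1 - a))"
proof -
  have e: "ennreal (indicator {0..} v * (v powr (a - 1) / (1 + v)))
     = (\<integral>\<^sup>+w. ennreal (indicator {0..} v * (v powr (a - 1))) * ennreal (indicator {0..} w * exp (- (w * (1 + v)))) \<partial>lborel)" for v :: real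
  proof (cases "v \<ge> 0")
    case True
    have "(\<integral>\<^sup>+w. ennreal (indicator {0..} w * exp (- (w * (1 + v)))) \<partial>lborel)
       = (\<integral>\<^sup>+w. ennreal (indicator {0..} w * (w powr (1 - 1) * exp (- ((1 + v) * w)))) \<partial>lborel)"
      using AE_lborel_singleton[of "0::real"]
      by (intro nn_integral_cong_AE) (auto elim!: eventually_mono simp: mult.commute split: split_indicator)
    also have "\<dots> = ennreal (1 / (1 + v))"
      using True by (subst nn_integral_gamma) (auto simp: powr_minus divide_simps)
    finally have E: "(\<integral>\<^sup>+w. ennreal (indicator {0..} w * exp (- (w * (1 + v)))) \<partial>lborel) = ennreal (1 / (1 + v))" .
    have "(\<integral>\<^sup>+w. ennreal (indicator {0..} v * (v powr (a - 1))) * ennreal (indicator {0..} w * exp (- (w * (1 + v)))) \<partial>lborel)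
       = ennreal (indicator {0..} v * (v powr (a - 1))) * (\<integral>\<^sup>+w. ennreal (indicator {0..} w * exp (- (w * (1 + v)))) \<partial>lborel)"
      by (rule nn_integral_cmult) auto
    also have "\<dots> = ennreal (indicator {0..} v * (v powr (a - 1)) * (1 / (1 + v)))"
      unfolding E by (rule ennreal_mult'[symmetric]) (use True in auto)
    finally show ?thesis by simp
  qed simp
  have "(\<integral>\<^sup>+v. ennreal (indicator {0..} v * (v powr (a - 1) / (1 + v))) \<partial>lborel)
     = (\<integral>\<^sup>+w. (\<integral>\<^sup>+v. ennreal (indicator {0..} v * (v powr (a - 1))) * ennreal (indicator {0..} w * exp (- (w * (1 + v)))) \<partial>lborel) \<partial>lborel)"
    unfolding e by (rule lborel_pair.Fubini') auto
  also have "\<dots> = (\<integral>\<^sup>+w. ennreal (Gamma a) * ennreal (indicator {0..} w * (w powr ((1 - a) - 1) * exp (- (1 * w)))) \<partial>lborel)"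
  proof (rule nn_integral_cong_AE, use AE_lborel_singleton[of "0::real"] in eventually_elim)
    case (elim w)
    show ?case
    proof (cases "w > 0")
      case True
      have "(\<integral>\<^sup>+v. ennreal (indicator {0..} v * (v powr (a - 1))) * ennreal (indicator {0..} w * exp (- (w * (1 + v)))) \<partial>lborel)
         = (\<integral>\<^sup>+v. ennreal (exp (- w)) * ennreal (indicator {0..} v * (v powr (a - 1) * exp (- (w * v)))) \<partial>lborel)"
        using True by (intro nn_integral_cong)
          (auto simp: ennreal_mult'[symmetric] exp_add[symmetric] algebra_simps split: split_indicator)
      also have "\<dots> = ennreal (exp (- w)) * ennreal (Gamma a * w powr (- a))"
        using True assms by (subst nn_integral_cmult) (auto simp: nn_integral_gamma)
      finally show ?thesis using True assms by (simp add: ennreal_mult'[symmetric] Gamma_real_pos less_imp_le algebra_simps)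
    qed (use elim in auto)
  qed
  also have "\<dots> = ennreal (Gamma a) * (\<integral>\<^sup>+w. ennreal (indicator {0..} w * (w powr ((1 - a) - 1) * exp (- (1 * w)))) \<partial>lborel)"
    by (rule nn_integral_cmult) auto
  also have "(\<integral>\<^sup>+w. ennreal (indicator {0..} w * (w powr ((1 - a) - 1) * exp (- (1 * w)))) \<partial>lborel) = ennreal (Gamma (1 - a) * 1 powr (- (1 - a)))"
    by (rule nn_integral_gamma) (use assms in auto)
  finally show ?thesis using assms by (simp add: ennreal_mult'[symmetric] Gamma_real_pos less_imp_le)
qed

text \<open>The substitution v = y^2, which on the exponential scale is the doubling w = 2 u, leads
  to the previous integral with a = (1 + s) / 2. The reflection formula turns the Gamma product into
  pi / sin (pi a), and sin (pi a) = cos (pi s / 2).\<close>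

lemma nn_integral_powr_over_one_plus_square:
  assumes s: "- 1 < s" "s < (1::real)"
  shows "(\<integral>\<^sup>+y. ennreal (indicator {0..} y * (y powr s / (1 + y\<^sup>2))) \<partial>lborel) = ennreal (pi / (2 * cos (pi * s / 2)))"
proof -
  define a where "a = (1 + s) / 2"
  have a: "0 < a" "a < 1" using s by (auto simp: a_def)
  let ?h = "\<lambda>w. ennreal (exp (a * w) / (1 + exp w))"
  have 1: "(\<integral>\<^sup>+v. ennreal (indicator {0..} v * (v powr (a - 1) / (1 + v))) \<partial>lborel) = (\<integral>\<^sup>+w. ?h w \<partial>lborel)"
  proof -
    have "(\<integral>\<^sup>+v. ennreal (indicator {0..} v * (v powr (a - 1) / (1 + v))) \<partial>lborel)
       = (\<integral>\<^sup>+v. ennreal (v powr (a - 1) / (1 + v)) * indicator {0<..} v \<partial>lborel)"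
      by (intro nn_integral_cong) (auto split: split_indicator)
    also have "\<dots> = (\<integral>\<^sup>+w. ennreal (exp w powr (a - 1) / (1 + exp w)) * ennreal (exp w) \<partial>lborel)"
      by (rule nn_integral_exp_substitution) auto
    also have "\<dots> = (\<integral>\<^sup>+w. ?h w \<partial>lborel)"
      by (intro nn_integral_cong) (auto simp: ennreal_mult'[symmetric] exp_powr_real exp_add[symmetric] algebra_simps add_pos_pos)
    finally show ?thesis .
  qed
  have "(\<integral>\<^sup>+y. ennreal (indicator {0..} y * (y powr s / (1 + y\<^sup>2))) \<partial>lborel)
     = (\<integral>\<^sup>+y. ennreal (y powr s / (1 + y\<^sup>2)) * indicator {0<..} y \<partial>lborel)"
    by (intro nn_integral_cong) (auto split: split_indicator)
  also have "\<dots> = (\<integral>\<^sup>+u. ennreal (exp u powr s / (1 + (exp u)\<^sup>2)) * ennreal (exp u) \<partial>lborel)"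
    by (rule nn_integral_exp_substitution) auto
  also have "\<dots> = (\<integral>\<^sup>+u. ?h (0 + 2 * u) \<partial>lborel)"
  proof (rule nn_integral_cong)
    fix u :: real
    have "exp u powr s * exp u = exp (a * (0 + 2 * u))"
    proof -
      have "exp u powr s * exp u = exp (u * s + u)" by (simp only: exp_powr_real exp_add)
      also have "u * s + u = a * (0 + 2 * u)" by (simp add: a_def field_simps)
      finally show ?thesis .
    qed
    moreover have "(exp u)\<^sup>2 = exp (0 + 2 * u)" by (simp add: exp_double)
    ultimately show "ennreal (exp u powr s / (1 + (exp u)\<^sup>2)) * ennreal (exp u) = ?h (0 + 2 * u)"
      by (simp add: ennreal_mult'[symmetric] add_pos_pos)
  qed
  finally have 2: "(\<integral>\<^sup>+y. ennreal (indicator {0..} y * (y powr s / (1 + y\<^sup>2))) \<partial>lborel) = (\<integral>\<^sup>+u. ?h (0 + 2 * u) \<partial>lborel)" .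
  have "(\<integral>\<^sup>+w. ?h w \<partial>lborel) = ennreal \<bar>2\<bar> * (\<integral>\<^sup>+u. ?h (0 + 2 * u) \<partial>lborel)"
    by (rule nn_integral_real_affine) auto
  hence "ennreal (1/2) * ennreal (Gamma a * Gamma (1 - a)) = (ennreal (1/2) * ennreal 2) * (\<integral>\<^sup>+u. ?h (0 + 2 * u) \<partial>lborel)"
    using 1 nn_integral_powr_over_one_plus[OF a] by (simp add: mult.assoc)
  also have "ennreal (1/2) * ennreal 2 = 1" by (subst ennreal_mult'[symmetric]) auto
  finally have h1: "ennreal (1/2) * ennreal (Gamma a * Gamma (1 - a)) = (\<integral>\<^sup>+u. ?h (0 + 2 * u) \<partial>lborel)"
    by (simp only: mult_1_left)
  have h2: "ennreal (1/2) * ennreal (Gamma a * Gamma (1 - a)) = ennreal (1/2 * (Gamma a * Gamma (1 - a)))"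
    by (rule ennreal_mult'[symmetric]) simp
  have "(\<integral>\<^sup>+u. ?h (0 + 2 * u) \<partial>lborel) = ennreal (1/2 * (Gamma a * Gamma (1 - a)))"
    by (rule trans[OF sym[OF h1] h2])
  hence I: "(\<integral>\<^sup>+y. ennreal (indicator {0..} y * (y powr s / (1 + y\<^sup>2))) \<partial>lborel) = ennreal (1/2 * (Gamma a * Gamma (1 - a)))"
    using 2 by (rule trans[rotated])
  have "complex_of_real (Gamma a) * complex_of_real (Gamma (1 - a)) = of_real pi / sin (of_real pi * of_real a)"
    using Gamma_reflection_complex[of "of_real a"]
    unfolding Gamma_complex_of_real[symmetric] of_real_diff of_real_1 .
  hence "complex_of_real (Gamma a * Gamma (1 - a)) = complex_of_real (pi / sin (pi * a))"
    by (simp only: of_real_mult of_real_divide sin_of_real [symmetric])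
  hence G: "Gamma a * Gamma (1 - a) = pi / sin (pi * a)" by (simp only: of_real_eq_iff)
  have "sin (pi * a) = cos (pi / 2 - pi * a)" by (simp add: cos_diff)
  also have "pi / 2 - pi * a = - (pi * s / 2)" by (simp add: a_def field_simps)
  also have "cos (- (pi * s / 2)) = cos (pi * s / 2)" by (rule cos_minus)
  finally have C: "sin (pi * a) = cos (pi * s / 2)" .
  have "1 / 2 * (Gamma a * Gamma (1 - a)) = pi / (2 * cos (pi * s / 2))"
    unfolding G C by simp
  thus ?thesis using I by (simp only:)
qed

section \<open>The functional equation\<close>

text \<open>For s < 0 the integral converges at 0 as well, because \<open>ppar\<close> t is about t
  / 2 there, and its part over (0, 1), multiplied by s (s + 1), equals the elementary terms 1 / (s -
  1) + 1/2. So \<open>zeta1\<close> becomes a single Mellin integral with nonnegative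
  integrand.\<close>

lemma zeta1_real_conv_integral:
  assumes s: "- 1 < s" "s < (0::real)"
  shows "set_integrable lborel {0..} (\<lambda>t. ppar t * t powr (- s - 2))"
    and "zeta1 (of_real s) = of_real (s * (s + 1) * (LINT t:{0..}|lborel. ppar t * t powr (- s - 2)))"
proof -
  let ?f = "\<lambda>t. ppar t * t powr (- s - 2)"
  have eq: "?f t = (t powr (- s - 1) - t powr (- s)) / 2" if "t \<in> {0..1}" for t
  proof (cases "t = 0")
    case False
    hence t: "t > 0" using that by simp
    have "t powr (- s - 1) = t * t powr (- s - 2)" "t powr (- s) = t * t * t powr (- s - 2)"
    proof -
      have e: "- s - 1 = 1 + (- s - 2)" "- s = 1 + (1 + (- s - 2))" by simp_all
      show "t powr (- s - 1) = t * t powr (- s - 2)"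
        by (subst e(1), subst powr_add) (use t in simp)
      show "t powr (- s) = t * t * t powr (- s - 2)"
        by (subst e(2), subst powr_add, subst powr_add) (use t in simp)
    qed
    moreover have "ppar t = t * (1 - t) / 2" using ppar_eq_on_piece[of 0 t] that by simp
    ultimately show ?thesis by (simp only:) (simp add: algebra_simps)
  qed (simp add: ppar_def)
  have i0': "set_integrable lborel {0..1} (\<lambda>t. (t powr (- s - 1) - t powr (- s)) / 2)"
    by (intro set_integrable_divide set_integral_diff set_integral_powr_from_0) (use s in auto)
  have i0: "set_integrable lborel {0..1} ?f"
    using i0' by (rule set_integrable_cong[THEN iffD1, rotated -1]) (use eq in auto)
  have i1: "set_integrable lborel {1..} ?f"
  proof -
    have "set_integrable lborel {1..} (\<lambda>t::real. t powr (- s - 2))"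
      by (rule set_integrable_powr_Ici) (use s in auto)
    thus ?thesis unfolding set_integrable_def
      by (rule Bochner_Integration.integrable_bound)
         (auto simp: abs_mult split: split_indicator intro!: AE_I2 mult_left_le_one_le intro: order_trans[OF abs_ppar_le])
  qed
  have un: "{0..} = {0..1} \<union> {1::real..}" by auto
  show i: "set_integrable lborel {0..} ?f" unfolding un by (rule set_integrable_Un[OF i0 i1]) auto
  have "(LINT t:{0..1}|lborel. ?f t) = (LINT t:{0..1}|lborel. (t powr (- s - 1) - t powr (- s)) / 2)"
    by (rule set_lebesgue_integral_cong) (use eq in auto)
  also have "\<dots> = (1 / (- s) - 1 / (1 - s)) / 2"
    using s by (subst set_integral_divide_zero, subst set_integral_diff) (auto simp: set_integral_powr_from_0)
  finally have v0: "(LINT t:{0..1}|lborel. ?f t) = (1 / (- s) - 1 / (1 - s)) / 2" .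
  define Z where "Z = (LINT t:{1..}|lborel. ?f t)"
  have v: "(LINT t:{0..}|lborel. ?f t) = (1 / (- s) - 1 / (1 - s)) / 2 + Z"
    using set_integral_Ici_split[OF i, of 1] v0 by (simp add: Z_def)
  have "zeta_tail (of_real s) = (LINT t:{1..}|lborel. complex_of_real (?f t))"
    unfolding zeta_tail_def mellin1_def
  proof (rule set_lebesgue_integral_cong, simp, intro allI impI)
    fix t :: real assume t: "t \<in> {1..}"
    have "complex_of_real t powr - (of_real s + 2) = of_real (t powr (- s - 2))"
      using t powr_of_real[of t "- s - 2"] by simp
    thus "ppar t *\<^sub>R complex_of_real t powr - (of_real s + 2) = of_real (?f t)"
      by (simp add: scaleR_conv_of_real)
  qed
  also have "\<dots> = of_real Z" unfolding Z_def by (rule set_integral_complex_of_real)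
  finally have z: "zeta_tail (of_real s) = of_real Z" .
  have "1 / (- s) - 1 / (1 - s) = - (1 / (s * (1 - s)))"
    using s by (simp add: divide_simps)
  hence "s * (s + 1) * ((1 / (- s) - 1 / (1 - s)) / 2) = - ((s + 1) / (2 * (1 - s)))"
    using s by simp
  also have "\<dots> = 1 / (s - 1) + 1/2" using s by (simp add: divide_simps) (simp add: algebra_simps)
  finally have e: "s * (s + 1) * ((1 / (- s) - 1 / (1 - s)) / 2 + Z) = 1 / (s - 1) + 1/2 + s * (s + 1) * Z"
    by (simp only: distrib_left)
  have "zeta1 (of_real s) = of_real (1 / (s - 1) + 1/2 + s * (s + 1) * Z)"
    unfolding zeta1_def z by simp
  thus "zeta1 (of_real s) = of_real (s * (s + 1) * (LINT t:{0..}|lborel. ?f t))"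
    unfolding v e .
qed

text \<open>The quotient (1 + e^(-x)) / (1 - e^(-x)) is coth (x / 2). The contributions of
  successive unit intervals differ by the factor e^(-x), so the integral up to M contains a
  geometric sum, collected in \<open>g\<close>.\<close>

lemma laplace_ppar:
  assumes x: "x > (0::real)"
  shows "(\<integral>\<^sup>+t. ennreal (indicator {0..} t * (ppar t * exp (- (x * t)))) \<partial>lborel)
     = ennreal (((1 + exp (- x)) / (1 - exp (- x)) / 2 - 1 / x) / x\<^sup>2)"
proof (rule nn_integral_Ici_limit[where Mmin = 0])
  define q where "q = exp (- x)"
  have q: "0 < q" "q < 1" using x by (auto simp: q_def)
  define X2 X3 where "X2 = 1 / x\<^sup>2" and "X3 = 1 / x ^ 3"
  have X: "x * X2 = 1 / x" "x * X3 = X2"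
    using x by (simp_all add: X2_def X3_def power2_eq_square power3_eq_cube)
  define g where "g = (\<lambda>M. (1 + q) * (1 - q ^ M) / (1 - q))"
  have g_Suc: "g (Suc M) = g M + (1 + q) * q ^ M" for M
  proof -
    have "(1 + q) * (1 - q ^ Suc M) = (1 + q) * (1 - q ^ M) + (1 + q) * q ^ M * (1 - q)"
      by (simp add: algebra_simps)
    thus ?thesis unfolding g_def using q by (simp add: add_divide_distrib)
  qed
  define V where "V = (\<lambda>M. g M / 2 * X2 + (q ^ M - 1) * X3)"
  show "((\<lambda>t. ppar t * exp (- (x * t))) has_integral V M) {0..real M}" for M
  proof (induction M)
    case 0
    show ?case using has_integral_refl(1)[of _ "0::real"] by (simp add: V_def g_def)
  next
    case (Suc M)
    \<comment> \<open>Again two integrations by parts: the quadratic factor vanishes at both ends,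
      which leaves X2 / 2 + X3 at the right and - X2 / 2 + X3 at the left end.\<close>
    define \<Theta> where "\<Theta> = (\<lambda>t. exp (- (x * t)) * (- ((t - real M) * (real M + 1 - t) / 2) * (1 / x) - (real M + 1/2 - t) * X2 + X3))"
    have "((\<lambda>t. ppar t * exp (- (x * t))) has_integral (\<Theta> (real M + 1) - \<Theta> (real M))) {real M..real M + 1}"
    proof (rule fundamental_theorem_of_calculus)
      fix t assume t: "t \<in> {real M..real M + 1}"
      have p: "ppar t = (t - real M) * (real M + 1 - t) / 2" using ppar_eq_on_piece[of "int M" t] t by simp
      have "(\<Theta> has_real_derivative
          (exp (- (x * t)) * (- x)) * (- ((t - real M) * (real M + 1 - t) / 2) * (1 / x) - (real M + 1/2 - t) * X2 + X3)
          + exp (- (x * t)) * (- (real M + 1/2 - t) * (1 / x) + X2)) (at t within {real M..real M + 1})"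
        unfolding \<Theta>_def
        by (rule derivative_eq_intros refl | simp; fail)+ (simp add: algebra_simps add_divide_distrib diff_divide_distrib)
      also have "(exp (- (x * t)) * (- x)) * (- ((t - real M) * (real M + 1 - t) / 2) * (1 / x) - (real M + 1/2 - t) * X2 + X3)
          + exp (- (x * t)) * (- (real M + 1/2 - t) * (1 / x) + X2)
          = ppar t * exp (- (x * t)) * (x * (1 / x)) + exp (- (x * t)) * (real M + 1/2 - t) * (x * X2)
             - exp (- (x * t)) * (x * X3) + exp (- (x * t)) * (- (real M + 1/2 - t) * (1 / x) + X2)"
        unfolding p by (simp only: algebra_simps minus_mult_left minus_mult_right)
      also have "\<dots> = ppar t * exp (- (x * t))"
      proof -
        have "p * A * 1 + A * w * r - A * y + A * (- w * r + y) = p * A" for p A w r y :: real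
          by (simp add: algebra_simps)
        moreover have "x * (1 / x) = 1" using x by simp
        ultimately show ?thesis unfolding X by (simp only:)
      qed
      finally show "(\<Theta> has_vector_derivative ppar t * exp (- (x * t))) (at t within {real M..real M + 1})"
        by (simp add: has_real_derivative_iff_has_vector_derivative)
    qed auto
    from has_integral_combine[OF _ _ Suc.IH this]
    have "((\<lambda>t. ppar t * exp (- (x * t))) has_integral V M + (\<Theta> (real M + 1) - \<Theta> (real M))) {0..real M + 1}"
      by auto
    also have "V M + (\<Theta> (real M + 1) - \<Theta> (real M)) = V (Suc M)"
    proof -
      have e: "exp (- (x * real M)) = q ^ M" "exp (- (x * (real M + 1))) = q * q ^ M"
        unfolding q_def by (simp_all add: exp_of_nat_mult[symmetric] exp_add[symmetric] algebra_simps)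
      have T1: "\<Theta> (real M + 1) = q * q ^ M * (1/2 * X2 + X3)"
        unfolding \<Theta>_def e by simp
      have T2: "\<Theta> (real M) = q ^ M * (- (1/2) * X2 + X3)"
        unfolding \<Theta>_def e by simp
      show ?thesis unfolding V_def g_Suc T1 T2 by (simp add: algebra_simps add_divide_distrib)
    qed
    finally show ?case by (simp add: add.commute)
  qed
  have "(\<lambda>M. q ^ M) \<longlonglongrightarrow> 0" using q by (intro LIMSEQ_power_zero) auto
  hence "V \<longlonglongrightarrow> (1 + q) * (1 - 0) / (1 - q) / 2 * X2 + (0 - 1) * X3"
    unfolding V_def g_def by (intro tendsto_intros) (use q x in auto)
  also have "(1 + q) * (1 - 0) / (1 - q) / 2 * X2 + (0 - 1) * X3 = ((1 + q) / (1 - q) / 2 - 1 / x) / x\<^sup>2"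
    using x by (simp add: X2_def X3_def diff_divide_distrib power2_eq_square power3_eq_cube)
  finally show "V \<longlonglongrightarrow> ((1 + exp (- x)) / (1 - exp (- x)) / 2 - 1 / x) / x\<^sup>2" by (simp only: q_def)
qed (auto simp: ppar_nonneg)

text \<open>Euler's product for the sine at the imaginary point z = i x / (2 pi), where it turns
  into the product for 2 sinh (x / 2) / x; the sine is purely imaginary there, so the limit is taken
  in imaginary parts.\<close>

lemma sinh_product:
  assumes x: "x > (0::real)"
  shows "(\<lambda>n. \<Prod>k<n. 1 + (x / (2 * pi * real (Suc k)))\<^sup>2) \<longlonglongrightarrow> (exp (x / 2) - exp (- (x / 2))) / x"
proof -
  define z where "z = \<i> * complex_of_real (x / (2 * pi))"
  have pz: "of_real pi * z = \<i> * of_real (x / 2)" by (simp add: z_def)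
  have z2: "1 - z\<^sup>2 / of_nat k ^ 2 = of_real (1 + (x / (2 * pi * real k))\<^sup>2)" for k
    by (simp add: z_def power_mult_distrib power_divide)
  have "(\<lambda>n. Im (of_real pi * z * (\<Prod>k=1..n. 1 - z^2 / of_nat k^2))) \<longlonglongrightarrow> Im (sin (of_real pi * z))"
    by (intro tendsto_Im sin_product_formula_complex)
  also have "Im (sin (of_real pi * z)) = (exp (x / 2) - exp (- (x / 2))) / 2"
  proof -
    have e: "\<i> * (\<i> * complex_of_real (x / 2)) = complex_of_real (- (x / 2))"
      "- complex_of_real (- (x / 2)) = complex_of_real (x / 2)" by simp_all
    have "sin (of_real pi * z) = (of_real (exp (- (x / 2))) - of_real (exp (x / 2))) / (2 * \<i>)"
      by (simp only: pz sin_exp_eq e exp_of_real)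
    also have "\<dots> = \<i> * of_real ((exp (x / 2) - exp (- (x / 2))) / 2)"
      by (simp add: field_simps)
    finally have h: "sin (of_real pi * z) = \<i> * of_real ((exp (x / 2) - exp (- (x / 2))) / 2)" .
    show ?thesis unfolding h by simp
  qed
  also have "(\<lambda>n. Im (of_real pi * z * (\<Prod>k=1..n. 1 - z^2 / of_nat k^2)))
     = (\<lambda>n. (x / 2) * (\<Prod>k=1..n. 1 + (x / (2 * pi * real k))\<^sup>2))"
  proof
    fix n
    define P where "P = (\<Prod>k=1..n. 1 + (x / (2 * pi * real k))\<^sup>2)"
    have "(\<Prod>k=1..n. 1 - z^2 / of_nat k^2) = complex_of_real P"
      unfolding P_def of_real_prod by (rule prod.cong[OF refl z2])
    thus "Im (of_real pi * z * (\<Prod>k=1..n. 1 - z^2 / of_nat k^2)) = (x / 2) * (\<Prod>k=1..n. 1 + (x / (2 * pi * real k))\<^sup>2)"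
      unfolding pz P_def[symmetric] by simp
  qed
  finally have "(\<lambda>n. (x / 2) * (\<Prod>k=1..n. 1 + (x / (2 * pi * real k))\<^sup>2) / (x / 2)) \<longlonglongrightarrow> (exp (x / 2) - exp (- (x / 2))) / 2 / (x / 2)"
    by (intro tendsto_divide tendsto_const) (use x in auto)
  moreover have "(\<Prod>k=1..n. 1 + (x / (2 * pi * real k))\<^sup>2) = (\<Prod>k<n. 1 + (x / (2 * pi * real (Suc k)))\<^sup>2)" for n
    by (simp only: One_nat_def prod.atLeast1_atMost_eq)
  moreover have "(exp (x / 2) - exp (- (x / 2))) / 2 / (x / 2) = (exp (x / 2) - exp (- (x / 2))) / x"
    using x by (simp add: field_simps)
  moreover have "x / 2 * p / (x / 2) = p" for p using x by simp
  ultimately show ?thesis by (simp only:)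
qed

lemma summable_inverse_Suc_square: "summable (\<lambda>n. C / (real (Suc n))\<^sup>2)"
  using summable_mult[OF inverse_squares_sums[THEN sums_summable], of C] by (simp add: add.commute)

text \<open>Logarithmic derivative of the product for sinh. Termwise differentiation is justified by
  a majorant of order 1 / n^2 for the derivatives on the bounded interval (0, x + 1).\<close>

lemma coth_partial_fractions:
  assumes x: "x > (0::real)"
  shows "(\<lambda>n. 2 * x / (x\<^sup>2 + (2 * pi * real (Suc n))\<^sup>2)) sums ((1 + exp (- x)) / (1 - exp (- x)) / 2 - 1 / x)"
proof -
  let ?f = "\<lambda>n x. ln (1 + (x / (2 * pi * real (Suc n)))\<^sup>2)"
  let ?f' = "\<lambda>n x. 2 * x / (x\<^sup>2 + (2 * pi * real (Suc n))\<^sup>2)"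
  have bd: "norm (?f' n y) \<le> (2 * (x + 1) / (4 * pi\<^sup>2)) / (real (Suc n))\<^sup>2" if "y \<in> {0<..<x+1}" for n y
  proof -
    have "?f' n y \<le> 2 * (x + 1) / (0 + (2 * pi * real (Suc n))\<^sup>2)"
      by (rule frac_le) (use that in auto)
    thus ?thesis using that by (simp add: power_mult_distrib)
  qed
  have fs: "(\<lambda>n. ?f n y) sums ln ((exp (y / 2) - exp (- (y / 2))) / y)" if "y > 0" for y
    unfolding sums_def
  proof -
    have "(\<lambda>N. ln (\<Prod>k<N. 1 + (y / (2 * pi * real (Suc k)))\<^sup>2)) \<longlonglongrightarrow> ln ((exp (y / 2) - exp (- (y / 2))) / y)"
      by (rule tendsto_ln[OF sinh_product[OF that]]) (use that in auto)
    moreover have "ln (\<Prod>k<N. 1 + (y / (2 * pi * real (Suc k)))\<^sup>2) = (\<Sum>k<N. ?f k y)" for N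
    proof (rule ln_prod)
      have "1 + c\<^sup>2 > 0" for c :: real using zero_le_power2[of c] by linarith
      from less_imp_neq[OF this] show "1 + (y / (2 * pi * real (Suc i)))\<^sup>2 \<noteq> 0" for i by metis
    qed simp
    ultimately show "(\<lambda>N. \<Sum>k<N. ?f k y) \<longlonglongrightarrow> ln ((exp (y / 2) - exp (- (y / 2))) / y)" by simp
  qed
  have "((\<lambda>x. \<Sum>n. ?f n x) has_field_derivative (\<Sum>n. ?f' n x)) (at x)"
  proof (rule has_field_derivative_series'(2))
    show "convex {0<..<x+1}" by auto
    show "((\<lambda>x. ?f n x) has_field_derivative ?f' n y) (at y within {0<..<x+1})" if "y \<in> {0<..<x+1}" for n y
    proof -
      have pos: "1 + (y / (2 * pi * real (Suc n)))\<^sup>2 > 0" by (auto intro!: add_pos_nonneg)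
      define c where "c = 2 * pi * real (Suc n)"
      have c: "c > 0" by (simp add: c_def)
      have "((\<lambda>x. ln (1 + (x / c)\<^sup>2)) has_field_derivative (1 / (1 + (y / c)\<^sup>2) * (2 * (y / c) * (1 / c)))) (at y within {0<..<x+1})"
        by (rule derivative_eq_intros refl | use c pos in \<open>simp add: c_def; fail\<close>)+ (use c in simp)
      also have "1 / (1 + (y / c)\<^sup>2) * (2 * (y / c) * (1 / c)) = 2 * y / (y\<^sup>2 + c\<^sup>2)"
      proof -
        have "1 + (y / c)\<^sup>2 = (y\<^sup>2 + c\<^sup>2) / c\<^sup>2" using c by (simp add: field_simps)
        thus ?thesis using c by (simp add: power2_eq_square)
      qed
      finally show ?thesis by (simp only: c_def)
    qed
    show "uniformly_convergent_on {0<..<x+1} (\<lambda>N y. \<Sum>i<N. ?f' i y)"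
      by (rule Weierstrass_m_test'[OF bd summable_inverse_Suc_square])
    show "x \<in> {0<..<x+1}" "x \<in> interior {0<..<x+1}" using x by auto
    show "summable (\<lambda>n. ?f n x)" using fs[OF x] by (rule sums_summable)
  qed
  moreover have "((\<lambda>x. \<Sum>n. ?f n x) has_field_derivative (1 + exp (- x)) / (1 - exp (- x)) / 2 - 1 / x) (at x)"
  proof (rule has_field_derivative_transform_within_open[where S = "{0<..}"])
    define a b where "a = exp (x / 2)" and "b = exp (- (x / 2))"
    have "b < a" using x by (simp add: a_def b_def)
    define D S where "D = a - b" and "S = a + b"
    have D: "D > 0" using \<open>b < a\<close> by (simp add: D_def)
    have "((\<lambda>x. ln ((exp (x / 2) - exp (- (x / 2))) / x)) has_field_derivative
        1 / ((exp (x / 2) - exp (- (x / 2))) / x) *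
         (((exp (x / 2) * (1/2) - exp (- (x / 2)) * (- (1/2))) * x - (exp (x / 2) - exp (- (x / 2))) * 1) / (x * x))) (at x)"
      by (rule derivative_eq_intros refl | use x D in \<open>simp add: D_def a_def b_def; fail\<close>)+
    also have "1 / ((exp (x / 2) - exp (- (x / 2))) / x) *
         (((exp (x / 2) * (1/2) - exp (- (x / 2)) * (- (1/2))) * x - (exp (x / 2) - exp (- (x / 2))) * 1) / (x * x))
       = 1 / (D / x) * ((S / 2 * x - D) / (x * x))"
    proof -
      have "a * (1/2) - b * (- (1/2)) = S / 2" by (simp add: S_def)
      thus ?thesis unfolding a_def[symmetric] b_def[symmetric] D_def[symmetric] mult_1_right by (simp only:)
    qed
    also have "\<dots> = S / D / 2 - 1 / x" using D x by (simp add: field_simps)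
    also have "S / D = (1 + exp (- x)) / (1 - exp (- x))"
    proof -
      have "a * b = 1" "exp (- x) = b * b" by (simp_all add: a_def b_def flip: exp_add)
      hence "1 + exp (- x) = b * S" "1 - exp (- x) = b * D" by (simp_all add: S_def D_def algebra_simps)
      moreover have "b \<noteq> 0" by (simp add: b_def)
      ultimately show ?thesis by simp
    qed
    finally show "((\<lambda>x. ln ((exp (x / 2) - exp (- (x / 2))) / x)) has_field_derivative (1 + exp (- x)) / (1 - exp (- x)) / 2 - 1 / x) (at x)" .
    show "ln ((exp (y / 2) - exp (- (y / 2))) / y) = (\<Sum>n. ?f n y)" if "y \<in> {0<..}" for y
      using sums_unique[OF fs[of y]] that by simp
  qed (use x in auto)
  ultimately have "(\<Sum>n. ?f' n x) = (1 + exp (- x)) / (1 - exp (- x)) / 2 - 1 / x"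
    by (rule DERIV_unique)
  moreover have "summable (\<lambda>n. ?f' n x)"
    by (rule summable_comparison_test'[OF summable_inverse_Suc_square]) (rule bd, use x in auto)
  ultimately show ?thesis by (simp add: sums_iff)
qed

lemma nn_integral_powr_over_square_plus_square:
  assumes s: "- 1 < s" "s < (1::real)" and c: "c > 0"
  shows "(\<integral>\<^sup>+x. ennreal (indicator {0..} x * (2 * x powr s / (x\<^sup>2 + c\<^sup>2))) \<partial>lborel)
     = ennreal (2 * c powr (s - 1) * (pi / (2 * cos (pi * s / 2))))"
proof -
  have "(\<integral>\<^sup>+x. ennreal (indicator {0..} x * (2 * x powr s / (x\<^sup>2 + c\<^sup>2))) \<partial>lborel)
     = ennreal \<bar>c\<bar> * (\<integral>\<^sup>+y. ennreal (indicator {0..} (0 + c * y) * (2 * (0 + c * y) powr s / ((0 + c * y)\<^sup>2 + c\<^sup>2))) \<partial>lborel)"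
    by (rule nn_integral_real_affine) (use c in auto)
  also have "\<dots> = ennreal c * (\<integral>\<^sup>+y. ennreal (2 * c powr (s - 2)) * ennreal (indicator {0..} y * (y powr s / (1 + y\<^sup>2))) \<partial>lborel)"
  proof -
    have "ennreal (indicator {0..} (0 + c * y) * (2 * (0 + c * y) powr s / ((0 + c * y)\<^sup>2 + c\<^sup>2)))
       = ennreal (2 * c powr (s - 2)) * ennreal (indicator {0..} y * (y powr s / (1 + y\<^sup>2)))" for y
    proof (cases "y \<ge> 0")
      case True
      have "c powr s = c\<^sup>2 * c powr (s - 2)" using c by (simp add: powr_diff)
      moreover have "(c * y)\<^sup>2 + c\<^sup>2 = c\<^sup>2 * (1 + y\<^sup>2)" by (simp add: power_mult_distrib algebra_simps)
      ultimately have "2 * (c * y) powr s / ((c * y)\<^sup>2 + c\<^sup>2) = 2 * c powr (s - 2) * (y powr s / (1 + y\<^sup>2))"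
        using c True by (simp add: powr_mult)
      thus ?thesis using True c by (simp add: ennreal_mult'[symmetric])
    next
      case False
      hence "c * y < 0" using c by (simp add: mult_pos_neg)
      thus ?thesis using False by simp
    qed
    thus ?thesis using c by simp
  qed
  also have "(\<integral>\<^sup>+y. ennreal (2 * c powr (s - 2)) * ennreal (indicator {0..} y * (y powr s / (1 + y\<^sup>2))) \<partial>lborel)
     = ennreal (2 * c powr (s - 2)) * ennreal (pi / (2 * cos (pi * s / 2)))"
    unfolding nn_integral_powr_over_one_plus_square[OF s, symmetric] by (rule nn_integral_cmult) auto
  also have "ennreal c * (ennreal (2 * c powr (s - 2)) * ennreal (pi / (2 * cos (pi * s / 2))))
      = ennreal (c * (2 * c powr (s - 2) * (pi / (2 * cos (pi * s / 2)))))"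
    using c by (simp add: ennreal_mult'[symmetric])
  also have "c * (2 * c powr (s - 2) * (pi / (2 * cos (pi * s / 2)))) = 2 * (c * c powr (s - 2)) * (pi / (2 * cos (pi * s / 2)))"
    by (simp only: mult_ac)
  also have "c * c powr (s - 2) = c powr (s - 1)" using c powr_add[of c 1 "s - 2"] by simp
  finally show ?thesis .
qed

lemma cos_half_pi_pos: "- 1 < s \<Longrightarrow> s < 1 \<Longrightarrow> cos (pi * s / 2) > 0"
  using mult_strict_left_mono[of "- 1" s pi] mult_strict_left_mono[of s 1 pi]
  by (intro cos_gt_zero_pi) auto

text \<open>
  Writing \<open>t powr (- s - 2)\<close> as a Gamma integral turns \<open>zeta1 s\<close> into a Mellin transform of the Laplace transform
  of \<open>ppar\<close>; the partial fractions of coth then produce the Dirichlet series of \<open>zeta1 (1 - s)\<close>.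
\<close>

lemma functional_equation_real:
  assumes s: "- 1 < s" "s < (0::real)"
  shows "zeta1 (of_real s) * of_real (Gamma (s + 2) * (2 * cos (pi * s / 2)))
           = of_real (s * (s + 1) * (2 * pi) powr s) * zeta1 (of_real (1 - s))"
proof -
  define r where "r = (LINT t:{0..}|lborel. ppar t * t powr (- s - 2))"
  define c where "c = pi / (2 * cos (pi * s / 2))"
  have cos_pos: "cos (pi * s / 2) > 0" using cos_half_pi_pos[of s] s by simp
  have cpos: "c > 0" using cos_pos by (simp add: c_def)
  have G: "Gamma (s + 2) > 0" using s by (intro Gamma_real_pos) auto
  note i = zeta1_real_conv_integral(1)[OF s]
  have r0: "r \<ge> 0" unfolding r_def set_lebesgue_integral_def
    by (intro integral_nonneg_AE AE_I2) (auto simp: ppar_nonneg split: split_indicator)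
  have nn_r: "(\<integral>\<^sup>+t. ennreal (indicator {0..} t * (ppar t * t powr (- s - 2))) \<partial>lborel) = ennreal r"
    using nn_integral_eq_integral[OF i[unfolded set_integrable_def]]
    by (simp add: r_def set_lebesgue_integral_def ppar_nonneg)
  \<comment> \<open>At t = 0 the Gamma integral diverges, but ppar 0 = 0 makes the integrand on the
    right vanish identically.\<close>
  have t_rep: "ennreal (Gamma (s + 2)) * ennreal (indicator {0..} t * (ppar t * t powr (- s - 2)))
      = (\<integral>\<^sup>+x. ennreal (indicator {0..} t * ppar t) * ennreal (indicator {0..} x * (x powr (s + 1) * exp (- (t * x)))) \<partial>lborel)" for t
  proof (cases "t > 0")
    case True
    have "(\<integral>\<^sup>+x. ennreal (indicator {0..} t * ppar t) * ennreal (indicator {0..} x * (x powr (s + 1) * exp (- (t * x)))) \<partial>lborel)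
       = ennreal (indicator {0..} t * ppar t) * (\<integral>\<^sup>+x. ennreal (indicator {0..} x * (x powr ((s + 2) - 1) * exp (- (t * x)))) \<partial>lborel)"
      by (subst nn_integral_cmult) (auto simp: add.commute)
    also have "\<dots> = ennreal (indicator {0..} t * ppar t) * ennreal (Gamma (s + 2) * t powr (- (s + 2)))"
      using s True by (subst nn_integral_gamma) auto
    finally show ?thesis using True G ppar_nonneg[of t]
      by (simp add: ennreal_mult'[symmetric] mult_ac)
  qed (auto simp: ppar_def not_less indicator_def)
  have x_rep: "(\<integral>\<^sup>+t. ennreal (indicator {0..} t * ppar t) * ennreal (indicator {0..} x * (x powr (s + 1) * exp (- (t * x)))) \<partial>lborel)
      = (\<Sum>n. ennreal (indicator {0..} x * (2 * x powr s / (x\<^sup>2 + (2 * pi * real (Suc n))\<^sup>2))))" for x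
  proof (cases "x > 0")
    case True
    have "(\<integral>\<^sup>+t. ennreal (indicator {0..} t * ppar t) * ennreal (indicator {0..} x * (x powr (s + 1) * exp (- (t * x)))) \<partial>lborel)
       = (\<integral>\<^sup>+t. ennreal (x powr (s + 1)) * ennreal (indicator {0..} t * (ppar t * exp (- (x * t)))) \<partial>lborel)"
      using True ppar_nonneg by (intro nn_integral_cong) (simp add: ennreal_mult'[symmetric] mult_ac split: split_indicator)
    also have "\<dots> = ennreal (x powr (s + 1)) * ennreal (((1 + exp (- x)) / (1 - exp (- x)) / 2 - 1 / x) / x\<^sup>2)"
      unfolding laplace_ppar[OF True, symmetric] by (rule nn_integral_cmult) auto
    also have "\<dots> = ennreal (x powr (s + 1) / x\<^sup>2 * ((1 + exp (- x)) / (1 - exp (- x)) / 2 - 1 / x))"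
      by (subst ennreal_mult'[symmetric]) (auto simp: mult_ac)
    also have "\<dots> = (\<Sum>n. ennreal (x powr (s + 1) / x\<^sup>2 * (2 * x / (x\<^sup>2 + (2 * pi * real (Suc n))\<^sup>2))))"
      by (rule suminf_ennreal_eq[symmetric, OF _ sums_mult[OF coth_partial_fractions[OF True]]]) (use True in auto)
    finally show ?thesis
    proof -
      have "x powr (s + 1) / x\<^sup>2 * (2 * x / y) = indicator {0..} x * (2 * x powr s / y)" for y
        using True by (simp add: powr_add power2_eq_square)
      thus "(\<integral>\<^sup>+t. ennreal (indicator {0..} t * ppar t) * ennreal (indicator {0..} x * (x powr (s + 1) * exp (- (t * x)))) \<partial>lborel)
          = (\<Sum>n. ennreal (x powr (s + 1) / x\<^sup>2 * (2 * x / (x\<^sup>2 + (2 * pi * real (Suc n))\<^sup>2)))) \<Longrightarrow> ?thesis"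
        by (simp only:)
    qed
  next
    case False
    hence "indicator {0..} x * x powr p = 0" for p by (cases "x = 0") auto
    moreover have "indicator {0..} x * (x powr p * y) = (indicator {0..} x * x powr p) * y"
       "indicator {0..} x * (2 * x powr p / y) = (indicator {0..} x * x powr p) * (2 / y)" for p y :: real by simp_all
    ultimately show ?thesis by (simp only: mult_zero_left ennreal_0 mult_zero_right suminf_zero) simp
  qed
  have z1: "(\<lambda>n. complex_of_real (real (Suc n) powr (s - 1))) sums zeta1 (of_real (1 - s))"
  proof -
    have "of_nat (Suc n) powr - complex_of_real (1 - s) = complex_of_real (real (Suc n) powr (s - 1))" for n
      using powr_of_real[of "real (Suc n)" "s - 1"] by simp
    thus ?thesis using zeta1_sums[of "of_real (1 - s)"] s by simp
  qed
  \<comment> \<open>The Dirichlet series shows that \<open>zeta1\<close> is real at 1 - s > 1, so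
    the comparison can be carried out among nonnegative reals.\<close>
  define Z where "Z = Re (zeta1 (of_real (1 - s)))"
  have Zs: "(\<lambda>n. real (Suc n) powr (s - 1)) sums Z"
    using sums_Re[OF z1] by (simp add: Z_def)
  have Zc: "zeta1 (of_real (1 - s)) = of_real Z"
    using sums_unique2[OF z1] sums_of_real[OF Zs, where 'a = complex] by simp
  have "ennreal (Gamma (s + 2) * r) = ennreal (Gamma (s + 2)) * ennreal r"
    using G by (simp add: ennreal_mult')
  also have "\<dots> = (\<integral>\<^sup>+t. ennreal (Gamma (s + 2)) * ennreal (indicator {0..} t * (ppar t * t powr (- s - 2))) \<partial>lborel)"
    unfolding nn_r[symmetric] by (rule nn_integral_cmult[symmetric]) auto
  \<comment> \<open>Tonelli's theorem; all factors are nonnegative, so the exchange asks for no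
    convergence.\<close>
  also have "\<dots> = (\<integral>\<^sup>+x. (\<integral>\<^sup>+t. ennreal (indicator {0..} t * ppar t) * ennreal (indicator {0..} x * (x powr (s + 1) * exp (- (t * x)))) \<partial>lborel) \<partial>lborel)"
    unfolding t_rep by (rule lborel_pair.Fubini') auto
  also have "\<dots> = (\<Sum>n. \<integral>\<^sup>+x. ennreal (indicator {0..} x * (2 * x powr s / (x\<^sup>2 + (2 * pi * real (Suc n))\<^sup>2))) \<partial>lborel)"
    unfolding x_rep by (rule nn_integral_suminf) auto
  also have "\<dots> = (\<Sum>n. ennreal (2 * (2 * pi) powr (s - 1) * c * real (Suc n) powr (s - 1)))"
  proof (rule suminf_cong)
    fix n
    have "(2 * pi * real (Suc n)) powr (s - 1) = (2 * pi) powr (s - 1) * real (Suc n) powr (s - 1)"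
      by (rule powr_mult)
    thus "(\<integral>\<^sup>+x. ennreal (indicator {0..} x * (2 * x powr s / (x\<^sup>2 + (2 * pi * real (Suc n))\<^sup>2))) \<partial>lborel)
       = ennreal (2 * (2 * pi) powr (s - 1) * c * real (Suc n) powr (s - 1))"
      using s by (subst nn_integral_powr_over_square_plus_square) (auto simp: c_def mult_ac)
  qed
  also have "\<dots> = ennreal (2 * (2 * pi) powr (s - 1) * c * Z)"
    by (rule suminf_ennreal_eq[OF _ sums_mult[OF Zs]]) (use cpos in auto)
  finally have "Gamma (s + 2) * r = 2 * (2 * pi) powr (s - 1) * c * Z"
  proof (rule ennreal_inj[THEN iffD1, rotated 2])
    have "Z \<ge> 0" using sums_le[OF _ sums_zero Zs] by simp
    thus "0 \<le> 2 * (2 * pi) powr (s - 1) * c * Z" using cpos by simp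
  qed (use G r0 in auto)
  hence "Gamma (s + 2) * r * (2 * cos (pi * s / 2)) = (2 * pi) powr (s - 1) * Z * (c * (2 * cos (pi * s / 2))) * 2"
    by (simp only: mult_ac)
  also have "c * (2 * cos (pi * s / 2)) = pi" using cos_pos by (simp add: c_def)
  also have "(2 * pi) powr (s - 1) * Z * pi * 2 = ((2 * pi) * (2 * pi) powr (s - 1)) * Z" by (simp only: mult_ac)
  also have "(2 * pi) * (2 * pi) powr (s - 1) = (2 * pi) powr s" using powr_add[of "2 * pi" 1 "s - 1"] by simp
  finally have E: "Gamma (s + 2) * r * (2 * cos (pi * s / 2)) = (2 * pi) powr s * Z" .
  have "zeta1 (of_real s) * of_real (Gamma (s + 2) * (2 * cos (pi * s / 2)))
     = of_real (s * (s + 1) * (Gamma (s + 2) * r * (2 * cos (pi * s / 2))))"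
    unfolding zeta1_real_conv_integral(2)[OF s] r_def[symmetric] by (simp only: of_real_mult mult_ac)
  also have "\<dots> = of_real (s * (s + 1) * (2 * pi) powr s) * of_real Z"
    unfolding E by (simp only: of_real_mult mult_ac)
  finally show ?thesis unfolding Zc .
qed

section \<open>Taylor coefficients of zeta at 1 and at 0\<close>

text \<open>Holomorphic version of - s zeta(1 - s): the factor s cancels the pole at 0, so that the
  functional equation can be expanded in powers of s there.\<close>

definition zeta_refl :: "complex \<Rightarrow> complex" where
  "zeta_refl s = 1 - s / 2 - s * (1 - s) * (2 - s) * zeta_tail (1 - s)"

lemma zeta_refl_conv_zeta1: "s \<noteq> 0 \<Longrightarrow> zeta_refl s = - s * zeta1 (1 - s)"
  by (simp add: zeta_refl_def zeta1_def field_simps)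

lemma holomorphic_zeta_refl: "zeta_refl holomorphic_on {s. Re s < 2}"
  unfolding zeta_refl_def [abs_def]
  by (intro holomorphic_intros holomorphic_on_compose_gen[OF _ holomorphic_zeta_tail, unfolded o_def]) auto

text \<open>The identity theorem extends the real identity from the segment (-1, 0). Written with
  Gamma (s + 2) and \<open>zeta_refl\<close>, both sides are holomorphic on the whole strip, in
  particular at 0.\<close>

lemma functional_equation_strip:
  assumes s: "- 1 < Re s" "Re s < 1"
  shows "zeta1 s * (Gamma (s + 2) * (2 * cos (of_real pi * s / 2)))
           = - (s + 1) * of_real (2 * pi) powr s * zeta_refl s"
proof -
  define A where "A = {s. - 1 < Re s} \<inter> {s. Re s < 1}"
  define h where "h = (\<lambda>s. zeta1 s * (Gamma (s + 2) * (2 * cos (of_real pi * s / 2))) + (s + 1) * of_real (2 * pi) powr s * zeta_refl s)"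
  have "h s = 0"
  proof (rule analytic_continuation[where S = A and U = "of_real ` {-1<..<0}" and \<xi> = "- 1/2" and f = h])
    have "s + 2 \<notin> \<int>\<^sub>\<le>\<^sub>0" if "s \<in> A" for s
      using that by (auto simp: A_def elim!: nonpos_Ints_cases dest!: arg_cong[of _ _ Re])
    thus "h holomorphic_on A"
      unfolding h_def
      by (intro holomorphic_intros holomorphic_on_subset[OF holomorphic_zeta1] holomorphic_on_subset[OF holomorphic_zeta_refl])
         (auto simp: A_def)
    show "open A" unfolding A_def by (intro open_Int open_halfspace_Re_gt open_halfspace_Re_lt)
    show "connected A" unfolding A_def
      by (intro convex_connected convex_Int convex_halfspace_Re_gt convex_halfspace_Re_lt)
    show "- 1/2 islimpt complex_of_real ` {-1<..<0}"
      unfolding islimpt_approachable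
    proof (intro allI impI)
      fix e :: real assume e: "e > 0"
      \<comment> \<open>The cap 1/4 keeps -1/2 + d inside the segment when e is large.\<close>
      define d where "d = min (e / 2) (1 / 4)"
      have "complex_of_real (- 1/2 + d) \<noteq> - 1/2"
      proof
        assume "complex_of_real (- 1/2 + d) = - 1/2"
        from arg_cong[OF this, of Re] show False using e by (auto simp: d_def min_def split: if_splits)
      qed
      moreover have "dist (complex_of_real (- 1/2 + d)) (- 1/2) < e"
        using e by (simp add: dist_norm d_def min_def)
      moreover have "complex_of_real (- 1/2 + d) \<in> complex_of_real ` {-1<..<0}"
        using e by (intro imageI) (auto simp: d_def min_def)
      ultimately show "\<exists>x'\<in>complex_of_real ` {-1<..<0}. x' \<noteq> - 1/2 \<and> dist x' (- 1/2) < e" by blast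
    qed
    fix z assume "z \<in> complex_of_real ` {-1<..<0}"
    then obtain x where x: "z = of_real x" "- 1 < x" "x < 0" by auto
    have G: "Gamma (z + 2) * (2 * cos (of_real pi * z / 2)) = of_real (Gamma (x + 2) * (2 * cos (pi * x / 2)))"
      using Gamma_complex_of_real[of "x + 2"] cos_of_real[of "pi * x / 2", where 'a = complex] by (simp add: x(1))
    have P: "of_real (2 * pi) powr z = complex_of_real ((2 * pi) powr x)"
      unfolding x(1) by (rule powr_of_real) simp
    have R: "zeta_refl z = - z * zeta1 (of_real (1 - x))"
      using zeta_refl_conv_zeta1[of z] x by simp
    show "h z = 0"
      unfolding h_def G P R using functional_equation_real[OF x(2,3)] by (simp add: x(1) algebra_simps)
  qed (use s in \<open>auto simp: A_def\<close>)
  hence "zeta1 s * (Gamma (s + 2) * (2 * cos (of_real pi * s / 2))) = - ((s + 1) * of_real (2 * pi) powr s * zeta_refl s)"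
    by (simp only: h_def eq_neg_iff_add_eq_0)
  thus ?thesis by (simp only: mult_minus_left)
qed

text \<open>The asymmetric functional equation solved for zeta(s). For Re s < 0 the argument 1 - s
  lies in the half-plane Re > 1, so only values of \<open>zeta1\<close> already under control
  enter.\<close>

definition zeta_left :: "complex \<Rightarrow> complex" where
  "zeta_left s = of_real (2 * pi) powr s / of_real pi * Gamma (1 - s) * sin (of_real pi * s / 2) * zeta1 (1 - s)"

lemma holomorphic_zeta_left: "zeta_left holomorphic_on {s. Re s < 0}"
proof -
  have "1 - s \<notin> \<int>\<^sub>\<le>\<^sub>0" if "Re s < 0" for s
    using that by (auto elim!: nonpos_Ints_cases dest!: arg_cong[of _ _ Re])
  thus ?thesis
    unfolding zeta_left_def [abs_def]
    by (intro holomorphic_intros holomorphic_on_compose_gen[OF _ holomorphic_zeta1, unfolded o_def]) auto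
qed

text \<open>The strip contains no integer, so s, s + 1 and sin (pi s) do not vanish. The reflection
  formula and the double angle formula then exchange the factor Gamma (s) cos (pi s / 2) on the left
  for Gamma (1 - s) sin (pi s / 2) on the right.\<close>

lemma zeta1_eq_zeta_left:
  assumes s: "- 1 < Re s" "Re s < 0"
  shows "zeta1 s = zeta_left s"
proof -
  have s0: "s \<noteq> 0" "s + 1 \<noteq> 0" using s by (auto simp: complex_eq_iff)
  have nint: "s \<notin> \<int>" using s by (auto elim!: Ints_cases)
  hence sin0: "sin (of_real pi * s) \<noteq> 0" by (simp add: sin_eq_0 Ints_def image_iff mult.commute)
  have np: "s \<notin> \<int>\<^sub>\<le>\<^sub>0" "s + 1 \<notin> \<int>\<^sub>\<le>\<^sub>0"
    using nint by (auto elim!: nonpos_Ints_cases) (metis Ints_1 Ints_diff Ints_of_int add_diff_cancel_right')+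
  have "Gamma (s + 2) = (s + 1) * Gamma (s + 1)" using Gamma_plus1[OF np(2)] by (simp add: add.assoc)
  also have "Gamma (s + 1) = s * Gamma s" using Gamma_plus1[OF np(1)] by simp
  finally have G2: "Gamma (s + 2) = (s + 1) * (s * Gamma s)" .
  have "(s + 1) * s * (zeta1 s * Gamma s * (2 * cos (of_real pi * s / 2))) = (s + 1) * s * (of_real (2 * pi) powr s * zeta1 (1 - s))"
  proof -
    have gen: "- (s + 1) * P * (- s * Z) = (s + 1) * s * (P * Z)" for P Z by (simp add: algebra_simps)
    have a: "(s + 1) * s * (zeta1 s * Gamma s * (2 * cos (of_real pi * s / 2))) = zeta1 s * ((s + 1) * (s * Gamma s) * (2 * cos (of_real pi * s / 2)))"
      by (simp only: mult_ac)
    have b: "zeta1 s * ((s + 1) * (s * Gamma s) * (2 * cos (of_real pi * s / 2)))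
       = - (s + 1) * of_real (2 * pi) powr s * (- s * zeta1 (1 - s))"
      using functional_equation_strip[OF s(1) less_trans[OF s(2) zero_less_one]]
      unfolding G2 zeta_refl_conv_zeta1[OF s0(1)] .
    show ?thesis by (rule trans[OF a trans[OF b gen]])
  qed
  hence 1: "zeta1 s * Gamma s * (2 * cos (of_real pi * s / 2)) = of_real (2 * pi) powr s * zeta1 (1 - s)"
    using s0 by simp
  have dbl: "sin (of_real pi * s) = 2 * sin (of_real pi * s / 2) * cos (of_real pi * s / 2)"
    using sin_double[of "of_real pi * s / 2"] by simp
  have refl: "Gamma s * Gamma (1 - s) * sin (of_real pi * s) = of_real pi"
    using sin0 by (simp add: Gamma_reflection_complex)
  have "zeta1 s * of_real pi = zeta1 s * (Gamma s * Gamma (1 - s) * sin (of_real pi * s))"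
    by (simp only: refl)
  also have "\<dots> = (zeta1 s * Gamma s * (2 * cos (of_real pi * s / 2))) * Gamma (1 - s) * sin (of_real pi * s / 2)"
    unfolding dbl by (simp only: mult_ac)
  also have "\<dots> = of_real (2 * pi) powr s * zeta1 (1 - s) * Gamma (1 - s) * sin (of_real pi * s / 2)"
    unfolding 1 by simp
  finally have "zeta1 s * of_real pi / of_real pi = of_real (2 * pi) powr s * zeta1 (1 - s) * Gamma (1 - s) * sin (of_real pi * s / 2) / of_real pi"
    by (simp only:)
  thus ?thesis by (simp add: zeta_left_def mult_ac)
qed

text \<open>To exploit the choice in \<open>zeta\<close>, a function with both required properties
  on the punctured plane must be exhibited. \<open>zeta1\<close> and \<open>zeta_left\<close> agree
  on their common strip and glue to such a function; the identity theorem on the connected punctured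
  plane then shows that \<open>zeta\<close> is this function.\<close>

lemma zeta_eq_zeta1:
  assumes s: "Re s > - 1" "s \<noteq> 1"
  shows "zeta s = zeta1 s"
proof -
  define A where "A = {s. Re s > - 1} - {1}"
  define f where "f = (\<lambda>s. if s \<in> A then zeta1 s else zeta_left s)"
  have "f holomorphic_on A \<union> {s. Re s < 0}"
    unfolding f_def
  proof (rule holomorphic_on_If_Un)
    show "zeta1 holomorphic_on A" using holomorphic_zeta1 by (simp add: A_def)
    show "open A" unfolding A_def by (intro open_Diff open_halfspace_Re_gt) auto
  qed (auto simp: A_def holomorphic_zeta_left open_halfspace_Re_lt zeta1_eq_zeta_left)
  also have "A \<union> {s. Re s < 0} = - {1}" by (auto simp: A_def)
  finally have f: "f holomorphic_on - {1}" .
  have fs: "(\<lambda>n. of_nat (Suc n) powr (- s)) sums f s" if "Re s > 1" for s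
  proof -
    have "s \<in> A" using that by (auto simp: A_def)
    thus ?thesis using zeta1_sums[OF that] by (simp add: f_def)
  qed
  have "zeta holomorphic_on (- {1}) \<and> (\<forall>s. Re s > 1 \<longrightarrow> (\<lambda>n. of_nat (Suc n) powr (- s)) sums zeta s)"
    unfolding zeta_def by (rule someI[of _ f]) (use f fs in blast)
  hence z: "zeta holomorphic_on - {1}" "\<And>s. Re s > 1 \<Longrightarrow> (\<lambda>n. of_nat (Suc n) powr (- s)) sums zeta s" by auto
  have "zeta s = f s"
  proof (rule analytic_continuation_open[where s = "{s. Re s > 1}" and s' = "- {1}" and f = zeta and g = f and z = s])
    show "open {s. Re s > 1}" by (rule open_halfspace_Re_gt)
    show "{s. Re s > 1} \<noteq> {}" by (auto intro!: exI[of _ 2])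
    show "connected (- {1 :: complex})" by (rule connected_punctured_universe) simp
    show "zeta z = f z" if "z \<in> {s. Re s > 1}" for z
      using sums_unique2[OF z(2) fs] that by simp
    show "open (- {1 :: complex})" by auto
    show "{s. Re s > 1} \<subseteq> - {1}" by auto
    show "zeta holomorphic_on - {1}" "f holomorphic_on - {1}" by (fact z(1), fact f)
    show "s \<in> - {1}" using s by simp
  qed
  moreover have "s \<in> A" using s by (simp add: A_def)
  ultimately show ?thesis by (simp add: f_def)
qed

text \<open>Taylor data of \<open>zeta_tail\<close> in real form: exponent k + 2 belongs to the
  point k, so the exponents 2 and 3 encode zeta near 0 and near 1. The logarithmic moment is minus
  the derivative of \<open>zeta_tail\<close> there.\<close>

definition ppar_moment :: "nat \<Rightarrow> real" where
  "ppar_moment k = (LINT w:{1..}|lborel. ppar w / w ^ k)"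

definition ppar_log_moment :: "nat \<Rightarrow> real" where
  "ppar_log_moment k = (LINT w:{1..}|lborel. ppar w * ln w / w ^ k)"

lemma of_real_powr_minus_of_nat:
  "t > 0 \<Longrightarrow> complex_of_real t powr - of_nat k = of_real (1 / t ^ k)"
  using powr_of_real[of t "- real k"] by (simp add: powr_minus powr_realpow field_simps)

lemma zeta_tail_nat: "zeta_tail (of_nat k) = of_real (ppar_moment (k + 2))"
proof -
  have "zeta_tail (of_nat k) = (LINT t:{1..}|lborel. complex_of_real (ppar t / t ^ (k + 2)))"
    unfolding zeta_tail_def mellin1_def
  proof (rule set_lebesgue_integral_cong, simp, intro allI impI)
    fix t :: real assume t: "t \<in> {1..}"
    have "- (of_nat k + 2) = - (of_nat (k + 2) :: complex)" by simp
    hence "complex_of_real t powr - (of_nat k + 2) = of_real (1 / t ^ (k + 2))"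
      using of_real_powr_minus_of_nat[of t "k + 2"] t by (simp only:) simp
    thus "ppar t *\<^sub>R complex_of_real t powr - (of_nat k + 2) = complex_of_real (ppar t / t ^ (k + 2))" by (simp add: scaleR_conv_of_real)
  qed
  thus ?thesis by (simp add: ppar_moment_def set_integral_complex_of_real del: of_real_divide)
qed

lemma zeta_tail_nat_has_field_derivative:
  "(zeta_tail has_field_derivative - of_real (ppar_log_moment (k + 2))) (at (of_nat k))"
proof -
  have "(LINT t:{1..}|lborel. (ppar t * ln t) *\<^sub>R (complex_of_real t powr - (of_nat k + 2)))
     = (LINT t:{1..}|lborel. complex_of_real (ppar t * ln t / t ^ (k + 2)))"
  proof (rule set_lebesgue_integral_cong, simp, intro allI impI)
    fix t :: real assume t: "t \<in> {1..}"
    have "- (of_nat k + 2) = - (of_nat (k + 2) :: complex)" by simp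
    hence "complex_of_real t powr - (of_nat k + 2) = of_real (1 / t ^ (k + 2))"
      using of_real_powr_minus_of_nat[of t "k + 2"] t by (simp only:) simp
    thus "(ppar t * ln t) *\<^sub>R complex_of_real t powr - (of_nat k + 2) = complex_of_real (ppar t * ln t / t ^ (k + 2))" by (simp add: scaleR_conv_of_real)
  qed
  hence "(LINT t:{1..}|lborel. (ppar t * ln t) *\<^sub>R (complex_of_real t powr - (of_nat k + 2))) = of_real (ppar_log_moment (k + 2))"
    by (simp add: ppar_log_moment_def set_integral_complex_of_real del: of_real_divide of_real_mult)
  thus ?thesis using zeta_tail_has_field_derivative[of "of_nat k"] by simp
qed

text \<open>After removal of the pole 1 / w, zeta(1 + w) is the holomorphic function
  \<open>g\<close>, so the two constants are g(0) and - g'(0), the sign coming from the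
  normalisation of \<open>stieltjes\<close>.\<close>

lemma stieltjes_0_1:
  "\<gamma>0 = 1/2 + 2 * ppar_moment 3" "\<gamma>1 = 2 * ppar_log_moment 3 - 3 * ppar_moment 3"
proof -
  define g where "g = (\<lambda>w. 1/2 + (1 + w) * (2 + w) * zeta_tail (1 + w))"
  have "g holomorphic_on {s. Re s > - 2}"
    unfolding g_def by (intro holomorphic_intros holomorphic_on_compose_gen[OF _ holomorphic_zeta_tail, unfolded o_def]) auto
  hence g: "g has_fps_expansion fps_expansion g 0"
    by (rule has_fps_expansion_fps_expansion[rotated 2]) (auto simp: open_halfspace_Re_gt)
  have L: "(\<lambda>w. inverse w + g w) has_laurent_expansion inverse fls_X + fps_to_fls (fps_expansion g 0)"
    by (intro has_laurent_expansion_add has_laurent_expansion_inverse has_laurent_expansion_fps_X has_laurent_expansion_fps g)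
  have "eventually (\<lambda>w. zeta (1 + w) = inverse w + g w) (at 0)"
  proof -
    have "eventually (\<lambda>w::complex. w \<in> ball 0 1 - {0}) (at 0)"
      by (rule eventually_at_in_open) auto
    thus ?thesis
    proof eventually_elim
      case (elim w)
      have "\<bar>Re w\<bar> < 1" using elim abs_Re_le_cmod[of w] by simp
      hence "zeta (1 + w) = zeta1 (1 + w)" using elim by (intro zeta_eq_zeta1) auto
      thus ?case by (simp add: zeta1_def g_def inverse_eq_divide)
    qed
  qed
  hence "(\<lambda>w. zeta (1 + w)) has_laurent_expansion inverse fls_X + fps_to_fls (fps_expansion g 0)"
    using has_laurent_expansion_cong[OF _ refl, of "\<lambda>w. zeta (1 + w)" "\<lambda>w. inverse w + g w"] L by simp
  hence LE: "laurent_expansion zeta 1 = inverse fls_X + fps_to_fls (fps_expansion g 0)"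
    by (rule laurent_expansion_eqI)
  have dt: "(zeta_tail has_field_derivative - of_real (ppar_log_moment 3)) (at (1 + 0))"
    using zeta_tail_nat_has_field_derivative[of 1] by (simp add: numeral_3_eq_3)
  have zt: "zeta_tail 1 = of_real (ppar_moment 3)" using zeta_tail_nat[of 1] by (simp add: numeral_3_eq_3)
  have "((\<lambda>w. zeta_tail (1 + w)) has_field_derivative - of_real (ppar_log_moment 3) * 1) (at 0)"
    by (rule DERIV_chain2[where f = zeta_tail and g = "\<lambda>w. 1 + w", OF dt]) (auto intro!: derivative_eq_intros)
  hence "(g has_field_derivative 3 * of_real (ppar_moment 3) - 2 * of_real (ppar_log_moment 3)) (at 0)"
    unfolding g_def by (auto intro!: derivative_eq_intros simp: zt)
  hence g1: "deriv g 0 = 3 * of_real (ppar_moment 3) - 2 * of_real (ppar_log_moment 3)" by (rule DERIV_imp_deriv)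
  have g0: "g 0 = 1/2 + 2 * of_real (ppar_moment 3)" by (simp add: g_def zt)
  have "fls_nth (laurent_expansion zeta 1) 0 = g 0"
    by (simp add: LE fps_expansion_def fls_inverse_X)
  thus "\<gamma>0 = 1/2 + 2 * ppar_moment 3" by (simp add: stieltjes_def g0)
  have "fls_nth (laurent_expansion zeta 1) 1 = deriv g 0"
    by (simp add: LE fps_expansion_def fls_inverse_X)
  thus "\<gamma>1 = 2 * ppar_log_moment 3 - 3 * ppar_moment 3" by (simp add: stieltjes_def g1)
qed

lemma tail_weight_inverse_square: "tail_weight (\<lambda>w. 1 / w\<^sup>2) (\<lambda>w. - 2 / w ^ 3)"
proof
  show "((\<lambda>w. 1 / w\<^sup>2) has_real_derivative - 2 / y ^ 3) (at y)" if "y > 0" for y :: real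
    using that by (auto intro!: derivative_eq_intros simp: power2_eq_square power3_eq_cube)
  show "continuous_on {0<..} (\<lambda>w::real. - 2 / w ^ 3)" by (intro continuous_intros) auto
  show "((\<lambda>w::real. 1 / w\<^sup>2) \<longlongrightarrow> 0) at_top" by real_asymp
  show "set_integrable lborel {c..} (\<lambda>w. - 2 / w ^ 3)" if "c > 0" for c :: real
  proof -
    have "set_integrable lborel {c..} (\<lambda>w. 2 / w ^ 3)"
    proof (rule set_integrable_FTC_nonneg(1)[where F = "\<lambda>w. - 1 / w\<^sup>2" and L = 0])
      show "((\<lambda>w::real. - 1 / w\<^sup>2) \<longlongrightarrow> 0) at_top" by real_asymp
      show "((\<lambda>w. - 1 / w\<^sup>2) has_real_derivative 2 / x ^ 3) (at x)" if "c \<le> x" for x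
        using that \<open>c > 0\<close> by (auto intro!: derivative_eq_intros simp: power2_eq_square power3_eq_cube)
    qed (use that in \<open>auto simp: set_borel_measurable_def\<close>)
    from set_integrable_mult_right[OF this, of "-1"] show ?thesis by simp
  qed
qed

text \<open>Euler-Maclaurin for the harmonic numbers involves the same moment of \<open>ppar\<close>
  as the Laurent coefficient. The identification gives access to the limit of harm n - ln n and to
  the value of Digamma at 1.\<close>

lemma stieltjes_0_eq_euler_mascheroni: "\<gamma>0 = euler_mascheroni"
proof (rule LIMSEQ_unique)
  interpret tail_weight "\<lambda>w. 1 / w\<^sup>2" "\<lambda>w. - 2 / w ^ 3" by (rule tail_weight_inverse_square)
  let ?t = "saw_tail (\<lambda>w. 1 / w\<^sup>2) (\<lambda>w. - 2 / w ^ 3)"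
  have c: "(LINT w:{1..}|lborel. ppar w * (- 2 / w ^ 3)) = - 2 * ppar_moment 3"
    unfolding ppar_moment_def set_integral_mult_right[symmetric] by (simp add: mult.commute)
  have D: "harm n - ln (real n) = \<gamma>0 + 1 / (2 * real n) + ?t (real n)" if "n \<ge> 1" for n
  proof -
    \<comment> \<open>The summand is -1/y rather than 1/y, because its derivative is then the weight
      1/y^2.\<close>
    have E: "saw (real n) * (- 1 / real n) + (\<Sum>l=1..nat \<lfloor>real n\<rfloor>. - 1 / real l) - (- ln (real n)) + ?t (real n)
       = (- 1 / 1) / 2 - (- ln 1) + (LINT w:{1..}|lborel. ppar w * (- 2 / w ^ 3))"
      by (rule euler_maclaurin_tail)
         (use that in \<open>auto intro!: derivative_eq_intros simp: power2_eq_square field_simps\<close>)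
    have s: "saw (real n) = - 1/2" by (simp add: saw_def)
    have "(\<Sum>l=1..n. - 1 / real l) = - harm n"
      by (simp add: harm_def sum_negf inverse_eq_divide)
    hence h: "(\<Sum>l=1..nat \<lfloor>real n\<rfloor>. - 1 / real l) = - harm n" by simp
    show ?thesis using E unfolding c s h stieltjes_0_1(1) by simp
  qed
  have ev: "eventually (\<lambda>n. \<gamma>0 + 1 / (2 * real n) + ?t (real n) = harm n - ln (real n)) sequentially"
    by (rule eventually_mono[OF eventually_ge_at_top[of 1]]) (rule D[symmetric])
  have "(\<lambda>n. \<gamma>0 + 1 / (2 * real n) + ?t (real n)) \<longlonglongrightarrow> \<gamma>0 + 0 + 0"
  proof (intro tendsto_add tendsto_const)
    show "(\<lambda>n. 1 / (2 * real n)) \<longlonglongrightarrow> 0" by real_asymp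
    show "(\<lambda>n. ?t (real n)) \<longlonglongrightarrow> 0"
      by (rule filterlim_compose[OF tail_tendsto_0 filterlim_real_sequentially])
  qed
  thus "(\<lambda>n. harm n - ln (real n)) \<longlonglongrightarrow> \<gamma>0" using Lim_transform_eventually[OF _ ev] by simp
qed (rule euler_mascheroni_LIMSEQ)

lemma has_fps_expansion_nth_cong:
  fixes f g :: "complex \<Rightarrow> complex"
  assumes "f has_fps_expansion F" "g has_fps_expansion F'" "eventually (\<lambda>s. f s = g s) (nhds 0)"
  shows "fps_nth F n = fps_nth F' n"
  using fps_nth_fps_expansion[OF assms(1)] fps_nth_fps_expansion[OF assms(2)]
    higher_deriv_cong_ev[OF assms(3) refl] by simp

lemma fps_mult_nth_2: "fps_nth (f * g) 2 = fps_nth f 0 * fps_nth g 2 + fps_nth f 1 * fps_nth g 1 + fps_nth f 2 * fps_nth g 0"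
  for f g :: "'a :: comm_ring_1 fps"
  by (simp add: fps_mult_nth numeral_2_eq_2 algebra_simps)

text \<open>The derivative of Gamma is Gamma times Digamma, so the coefficients come from Digamma 1
  = - \<gamma> and Polygamma 1 1 = pi^2 / 6, the latter being the sum of the inverse
  squares.\<close>

lemma Gamma_1_plus_fps:
  obtains C :: "complex fps" where "(\<lambda>s. Gamma (1 + s)) has_fps_expansion C"
    "fps_nth C 0 = 1" "fps_nth C 1 = - of_real \<gamma>0" "fps_nth C 2 = of_real ((\<gamma>0\<^sup>2 + pi\<^sup>2 / 6) / 2)"
proof -
  define f :: "complex \<Rightarrow> complex" where "f = (\<lambda>s. Gamma (1 + s))"
  have np: "1 + s \<notin> \<int>\<^sub>\<le>\<^sub>0" if "Re s > - 1" for s :: complex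
    using that by (auto elim!: nonpos_Ints_cases dest!: arg_cong[of _ _ Re])
  have o: "open {s. Re s > - 1}" by (rule open_halfspace_Re_gt)
  have c: "(\<lambda>s. Gamma (1 + s)) has_fps_expansion fps_expansion f 0"
    unfolding f_def
    by (rule has_fps_expansion_fps_expansion[OF o]) (auto intro!: holomorphic_intros np)
  have c0: "fps_nth (fps_expansion f 0) 0 = 1" by (simp add: fps_expansion_def f_def)
  have d: "(f has_field_derivative f s * Digamma (1 + s)) (at s)" if "Re s > - 1" for s
  proof -
    have "((\<lambda>s. Gamma (1 + s)) has_field_derivative Gamma (1 + s) * Digamma (1 + s) * 1) (at s)"
      by (rule DERIV_chain2[where f = Gamma and g = "\<lambda>s. 1 + s", OF has_field_derivative_Gamma])
         (use np[OF that] in \<open>auto intro!: derivative_eq_intros\<close>)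
    thus ?thesis by (simp add: f_def)
  qed
  have d0: "deriv f s = f s * Digamma (1 + s)" if "Re s > - 1" for s
    by (rule DERIV_imp_deriv[OF d[OF that]])
  have c1: "fps_nth (fps_expansion f 0) 1 = - of_real \<gamma>0"
    using d0[of 0] by (simp add: fps_expansion_def f_def stieltjes_0_eq_euler_mascheroni)
  have "((\<lambda>s. f s * Digamma (1 + s)) has_field_derivative f 0 * Digamma (1 + 0) * Digamma (1 + 0) + f 0 * Polygamma 1 (1 + 0)) (at 0)"
  proof -
    have "((\<lambda>s. Digamma (1 + s)) has_field_derivative Polygamma (Suc 0) (1 + 0 :: complex) * 1) (at 0)"
      by (rule DERIV_chain2[where f = Digamma and g = "\<lambda>s. 1 + s", OF has_field_derivative_Polygamma])
         (auto intro!: derivative_eq_intros)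
    from DERIV_mult[OF d[of 0] this] show ?thesis by (simp add: mult_ac add.commute)
  qed
  hence "deriv (\<lambda>s. f s * Digamma (1 + s)) 0 = f 0 * Digamma (1 + 0) * Digamma (1 + 0) + f 0 * Polygamma 1 (1 + 0)"
    by (rule DERIV_imp_deriv)
  moreover have "deriv (deriv f) 0 = deriv (\<lambda>s. f s * Digamma (1 + s)) 0"
    by (rule deriv_cong_ev[OF _ refl], rule eventually_mono[OF eventually_nhds_in_open[OF o]]) (auto simp: d0)
  moreover have "Polygamma 1 (1 :: complex) = of_real (pi\<^sup>2 / 6)"
  proof -
    have "Polygamma 1 (1 :: real) = (\<Sum>n. 1 / (real n + 1)\<^sup>2)"
      by (simp add: Polygamma_def add.commute inverse_eq_divide power2_eq_square)
    also have "\<dots> = pi\<^sup>2 / 6" using sums_unique[OF inverse_squares_sums] by (simp add: add.commute)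
    finally have h: "Polygamma 1 (1 :: real) = pi\<^sup>2 / 6" .
    have "Polygamma 1 (of_real (1::real)) = complex_of_real (Polygamma 1 1)"
      by (rule Polygamma_of_real) simp
    thus ?thesis unfolding of_real_1 h .
  qed
  ultimately have "deriv (deriv f) 0 = of_real (\<gamma>0\<^sup>2 + pi\<^sup>2 / 6)"
    by (simp add: f_def stieltjes_0_eq_euler_mascheroni power2_eq_square)
  hence c2: "fps_nth (fps_expansion f 0) 2 = of_real ((\<gamma>0\<^sup>2 + pi\<^sup>2 / 6) / 2)"
    by (simp add: fps_expansion_def numeral_2_eq_2)
  show ?thesis by (rule that[OF c c0 c1 c2])
qed

text \<open>Both sides of the functional equation are expanded at 0 after cancelling the factor s +
  1. The coefficient of s gives zeta'(0) = - ln (2 pi) / 2, that of s^2 gives zeta''(0) / 2; in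
  terms of moments these are \<open>ppar_moment 2 - 1\<close> and
  \<open>ppar_moment 2 - ppar_log_moment 2 - 1\<close>.\<close>

lemma ppar_moment_2: "ppar_moment 2 = 1 - ln (2 * pi) / 2" (is ?A)
  and ppar_moment_2_diff: "ppar_moment 2 - ppar_log_moment 2
    = 1 + (\<gamma>1 + \<gamma>0\<^sup>2 / 2 - pi\<^sup>2 / 24 - (ln (2 * pi))\<^sup>2 / 2) / 2" (is ?B)
proof -
  define z0 l0 z1 l1 :: complex where "z0 = of_real (ppar_moment 2)" and "l0 = of_real (ppar_log_moment 2)"
    and "z1 = of_real (ppar_moment 3)" and "l1 = of_real (ppar_log_moment 3)"
  define \<Lambda> :: complex where "\<Lambda> = of_real (ln (2 * pi))"
  have o: "open {s. Re s > - 1}" by (rule open_halfspace_Re_gt)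
  have T: "zeta_tail has_fps_expansion fps_expansion zeta_tail 0"
    by (rule has_fps_expansion_fps_expansion[OF o _ holomorphic_zeta_tail]) auto
  have Tn: "fps_nth (fps_expansion zeta_tail 0) 0 = z0" "fps_nth (fps_expansion zeta_tail 0) (Suc 0) = - l0"
    using zeta_tail_nat[of 0] DERIV_imp_deriv[OF zeta_tail_nat_has_field_derivative[of 0]]
    by (simp_all add: fps_expansion_def z0_def l0_def numeral_2_eq_2)
  define r where "r = (\<lambda>s. zeta_tail (1 - s))"
  have "r holomorphic_on {s. Re s < 2}"
    unfolding r_def by (intro holomorphic_intros holomorphic_on_compose_gen[OF _ holomorphic_zeta_tail, unfolded o_def]) auto
  hence S: "r has_fps_expansion fps_expansion r 0"
    by (rule has_fps_expansion_fps_expansion[rotated 2]) (auto simp: open_halfspace_Re_lt)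
  have "(r has_field_derivative - of_real (ppar_log_moment 3) * (- 1)) (at 0)"
    unfolding r_def using zeta_tail_nat_has_field_derivative[of 1]
    by (intro DERIV_chain2[where f = zeta_tail and g = "\<lambda>w. 1 - w"])
       (auto intro!: derivative_eq_intros simp: numeral_3_eq_3)
  hence Sn: "fps_nth (fps_expansion r 0) 0 = z1" "fps_nth (fps_expansion r 0) (Suc 0) = l1"
    using zeta_tail_nat[of 1]
    by (simp_all add: fps_expansion_def z1_def l1_def r_def numeral_3_eq_3 DERIV_imp_deriv)
  obtain C :: "complex fps" where C: "(\<lambda>s. Gamma (1 + s)) has_fps_expansion C"
    "fps_nth C 0 = 1" "fps_nth C 1 = - of_real \<gamma>0" "fps_nth C 2 = of_real ((\<gamma>0\<^sup>2 + pi\<^sup>2 / 6) / 2)"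
    by (rule Gamma_1_plus_fps)
  define A where "A = fps_const (1/2) - inverse (1 - fps_X) + fps_X * (fps_X + 1) * fps_expansion zeta_tail 0"
  have A: "zeta1 has_fps_expansion A"
  proof -
    have "(\<lambda>s. 1/2 - inverse (1 - s) + s * (s + 1) * zeta_tail s) has_fps_expansion A"
      unfolding A_def
      by (intro fps_expansion_intros T) auto
    moreover have "(\<lambda>s. 1/2 - inverse (1 - s) + s * (s + 1) * zeta_tail s) = zeta1"
    proof
      fix s :: complex
      have "- inverse (1 - s) = 1 / (s - 1)" by (simp add: inverse_eq_divide minus_divide_right)
      thus "1/2 - inverse (1 - s) + s * (s + 1) * zeta_tail s = zeta1 s" by (simp add: zeta1_def)
    qed
    ultimately show ?thesis by simp
  qed
  have geo: "fps_nth (inverse (1 - fps_X :: complex fps)) n = 1" for n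
    using fps_inverse_idempotent[of "Abs_fps (\<lambda>n. 1) :: complex fps"] by (simp add: fps_inverse_gp')
  have An: "fps_nth A 0 = - 1/2" "fps_nth A 1 = - 1 + z0" "fps_nth A 2 = - 1 + z0 - l0"
    unfolding A_def by (simp_all add: geo Tn fps_mult_nth_2 fps_mult_nth numeral_2_eq_2)
  define m where "m = 1 - fps_X * fps_const (1/2) - fps_X * (1 - fps_X) * (fps_const 2 - fps_X) * fps_expansion r 0"
  have m: "zeta_refl has_fps_expansion m"
  proof -
    have "(\<lambda>s. 1 - s * (1/2) - s * (1 - s) * (2 - s) * r s) has_fps_expansion m"
      unfolding m_def by (intro fps_expansion_intros S)
    moreover have "(\<lambda>s. 1 - s * (1/2) - s * (1 - s) * (2 - s) * r s) = zeta_refl"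
      by (simp add: zeta_refl_def r_def fun_eq_iff)
    ultimately show ?thesis by simp
  qed
  have mn: "fps_nth m 0 = 1" "fps_nth m 1 = - 1/2 - 2 * z1" "fps_nth m 2 = - (2 * l1 - 3 * z1)"
    unfolding m_def by (simp_all add: Sn fps_mult_nth numeral_2_eq_2 algebra_simps)
  let ?L = "A * (C * (fps_const 2 * fps_cos (of_real pi / 2 :: complex)))" and ?R = "- (fps_exp \<Lambda> * m)"
  have L: "(\<lambda>s. zeta1 s * (Gamma (1 + s) * (2 * cos (of_real pi / 2 * s)))) has_fps_expansion ?L"
    by (intro fps_expansion_intros A C(1))
  have R: "(\<lambda>s. - (exp (\<Lambda> * s) * zeta_refl s)) has_fps_expansion ?R"
    by (intro fps_expansion_intros m)
  have "eventually (\<lambda>s::complex. s \<in> ball 0 1) (nhds 0)"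
    by (rule eventually_nhds_in_open) auto
  hence ev: "eventually (\<lambda>s. zeta1 s * (Gamma (1 + s) * (2 * cos (of_real pi / 2 * s))) = - (exp (\<Lambda> * s) * zeta_refl s)) (nhds 0)"
  proof eventually_elim
    case (elim s)
    have s: "\<bar>Re s\<bar> < 1" using elim abs_Re_le_cmod[of s] by simp
    hence s1: "s + 1 \<noteq> 0" "s + 1 \<notin> \<int>\<^sub>\<le>\<^sub>0"
      by (auto elim!: nonpos_Ints_cases dest!: arg_cong[of _ _ Re])
    have G: "Gamma (s + 2) = (s + 1) * Gamma (1 + s)" using Gamma_plus1[OF s1(2)] by (simp add: add_ac)
    have P: "of_real (2 * pi) powr s = exp (\<Lambda> * s)"
    proof -
      have "complex_of_real (2 * pi) \<noteq> 0" by simp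
      hence "of_real (2 * pi) powr s = exp (s * Ln (complex_of_real (2 * pi)))" by (simp only: powr_def if_False)
      also have "Ln (complex_of_real (2 * pi)) = \<Lambda>" unfolding \<Lambda>_def by (rule Ln_of_real) simp
      finally show ?thesis by (simp only: mult.commute)
    qed
    have "(s + 1) * (zeta1 s * (Gamma (1 + s) * (2 * cos (of_real pi / 2 * s)))) = (s + 1) * (- (exp (\<Lambda> * s) * zeta_refl s))"
    proof -
      have s2: "- 1 < Re s" "Re s < 1" using s by auto
      have c: "complex_of_real pi / 2 * s = of_real pi * s / 2" by simp
      have "- (s + 1) * E * Z = (s + 1) * (- (E * Z))" for E Z by (simp add: algebra_simps)
      moreover have "(s + 1) * (zeta1 s * (X * Y)) = zeta1 s * ((s + 1) * X * Y)" for X Y by (simp only: mult_ac)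
      ultimately show ?thesis
        using functional_equation_strip[OF s2] unfolding G P c by (simp only:)
    qed
    thus ?case by (rule mult_left_cancel[OF s1(1), THEN iffD1])
  qed
  have 1: "fps_nth ?L 1 = fps_nth ?R 1" and 2: "fps_nth ?L 2 = fps_nth ?R 2"
    by (rule has_fps_expansion_nth_cong[OF L R ev])+
  define g0 g1 P :: complex where "g0 = of_real \<gamma>0" and "g1 = of_real \<gamma>1" and "P = of_real pi"
  define D where "D = fps_const 2 * fps_cos (of_real pi / 2 :: complex)"
  have Dn: "fps_nth D 0 = 2" "fps_nth D 1 = 0" "fps_nth D 2 = - (P\<^sup>2 / 4)"
    by (simp_all add: D_def fps_cos_def P_def power_divide)
  have En: "fps_nth (fps_exp \<Lambda>) 0 = 1" "fps_nth (fps_exp \<Lambda>) 1 = \<Lambda>" "fps_nth (fps_exp \<Lambda>) 2 = \<Lambda>\<^sup>2 / 2"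
    by simp_all
  have Cn: "fps_nth C 0 = 1" "fps_nth C 1 = - g0" "fps_nth C 2 = (g0\<^sup>2 + P\<^sup>2 / 6) / 2"
    using C by (simp_all add: g0_def P_def)
  have gs: "g0 = 1/2 + 2 * z1" "g1 = 2 * l1 - 3 * z1"
    unfolding g0_def g1_def z1_def l1_def stieltjes_0_1 by simp_all
  \<comment> \<open>In - s zeta(1 - s) the Laurent coefficients of zeta at 1 reappear shifted by one
    place, both with a minus sign.\<close>
  have m': "fps_nth m 1 = - g0" "fps_nth m 2 = - g1" unfolding mn gs by simp_all
  have n1: "fps_nth (f * g) 1 = fps_nth f 0 * fps_nth g 1 + fps_nth f 1 * fps_nth g 0" for f g :: "complex fps"
    by (simp add: fps_mult_nth)
  have n0: "fps_nth (f * g) 0 = fps_nth f 0 * fps_nth g 0" for f g :: "complex fps"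
    by simp
  have "(- 1/2) * (- (2 * g0)) + (- 1 + z0) * 2 = - (\<Lambda> - g0)"
    using 1 unfolding D_def[symmetric] fps_neg_nth n1 n0 An Cn Dn En mn(1) m' by (simp add: algebra_simps)
  hence "2 * z0 = 2 - \<Lambda>" by (simp add: algebra_simps)
  hence e1: "z0 = 1 - \<Lambda> / 2" by (simp add: field_simps)
  \<comment> \<open>The terms pi^2 / 6 from Gamma and - pi^2 / 4 from the cosine combine to - pi^2 /
    12.\<close>
  have CD: "fps_nth (C * D) 0 = 2" "fps_nth (C * D) 1 = - (2 * g0)" "fps_nth (C * D) 2 = g0\<^sup>2 - P\<^sup>2 / 12"
    unfolding fps_mult_nth_2 n1 n0 Cn Dn by (simp_all add: field_simps)
  have "(- 1/2) * (g0\<^sup>2 - P\<^sup>2 / 12) + (- 1 + z0) * (- (2 * g0)) + (- 1 + z0 - l0) * 2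
      = - (1 * - g1 + \<Lambda> * - g0 + \<Lambda>\<^sup>2 / 2 * 1)"
    using 2 unfolding D_def[symmetric] fps_neg_nth fps_mult_nth_2[of A] fps_mult_nth_2[of "fps_exp \<Lambda>"] CD An En mn(1) m' .
  hence e2: "(- 1 + z0 - l0) * 2 = g1 + g0\<^sup>2 / 2 - P\<^sup>2 / 24 - \<Lambda>\<^sup>2 / 2"
    unfolding e1 by (simp add: field_simps)
  have "complex_of_real (ppar_moment 2) = of_real (1 - ln (2 * pi) / 2)"
    using e1 unfolding z0_def \<Lambda>_def of_real_diff of_real_divide of_real_1 of_real_numeral .
  thus ?A by (simp only: of_real_eq_iff)
  have "complex_of_real ((- 1 + ppar_moment 2 - ppar_log_moment 2) * 2) = of_real (\<gamma>1 + \<gamma>0\<^sup>2 / 2 - pi\<^sup>2 / 24 - (ln (2 * pi))\<^sup>2 / 2)"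
    using e2 unfolding z0_def l0_def g0_def g1_def P_def \<Lambda>_def
    by (simp only: of_real_diff of_real_divide of_real_1 of_real_numeral of_real_add of_real_power of_real_mult of_real_minus)
  hence "(- 1 + ppar_moment 2 - ppar_log_moment 2) * 2 = \<gamma>1 + \<gamma>0\<^sup>2 / 2 - pi\<^sup>2 / 24 - (ln (2 * pi))\<^sup>2 / 2"
    by (simp only: of_real_eq_iff)
  moreover have "m - l = 1 + X / 2" if "(- 1 + m - l) * 2 = X" for m l X :: real
    using that by (simp add: field_simps)
  ultimately show ?B by blast
qed

section \<open>Tail representations of R1 and R2\<close>

text \<open>\<open>tail1\<close> is the remainder in Stirling's formula, \<open>tail2\<close> that
  of the harmonic sum, \<open>tail3\<close> that of the sum of (1 + ln l) / l; \<open>tail4\<close>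
  arises when \<open>tail1\<close> u / u is integrated.\<close>

abbreviation tail1 :: "real \<Rightarrow> real" where "tail1 \<equiv> saw_tail (\<lambda>w. 1 / w) (\<lambda>w. - 1 / w\<^sup>2)"
abbreviation tail2 :: "real \<Rightarrow> real" where "tail2 \<equiv> saw_tail (\<lambda>w. 1 / w\<^sup>2) (\<lambda>w. - 2 / w ^ 3)"
abbreviation tail3 :: "real \<Rightarrow> real" where "tail3 \<equiv> saw_tail (\<lambda>w. ln w / w\<^sup>2) (\<lambda>w. (1 - 2 * ln w) / w ^ 3)"
abbreviation tail4 :: "real \<Rightarrow> real" where "tail4 \<equiv> saw_tail (\<lambda>w. ln w / w) (\<lambda>w. (1 - ln w) / w\<^sup>2)"

interpretation t1: tail_weight "\<lambda>w. 1 / w" "\<lambda>w. - 1 / w\<^sup>2"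
proof
  show "((\<lambda>w. 1 / w) has_real_derivative - 1 / y\<^sup>2) (at y)" if "y > 0" for y :: real
    using that by (auto intro!: derivative_eq_intros simp: power2_eq_square)
  show "continuous_on {0<..} (\<lambda>w::real. - 1 / w\<^sup>2)" by (intro continuous_intros) auto
  show "((\<lambda>w::real. 1 / w) \<longlongrightarrow> 0) at_top" by real_asymp
  show "set_integrable lborel {c..} (\<lambda>w. - 1 / w\<^sup>2)" if "c > 0" for c :: real
    using set_integrable_mult_right[OF integral_inverse_square(1)[OF that], of "-1"] by simp
qed

interpretation t2: tail_weight "\<lambda>w. 1 / w\<^sup>2" "\<lambda>w. - 2 / w ^ 3"
  by (rule tail_weight_inverse_square)

lemma set_integrable_inverse_cube: "set_integrable lborel {1..} (\<lambda>w::real. 1 / w ^ 3)"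
  using set_integrable_mult_right[OF t2.int[of 1], of "-1/2"] by simp

lemma set_integrable_ln_inverse_cube: "set_integrable lborel {1..} (\<lambda>w::real. ln w / w ^ 3)"
proof (rule set_integrable_FTC_nonneg(1)[where F = "\<lambda>w. - (1 + 2 * ln w) / (4 * w\<^sup>2)" and L = 0])
  show "((\<lambda>w::real. - (1 + 2 * ln w) / (4 * w\<^sup>2)) \<longlongrightarrow> 0) at_top" by real_asymp
  show "((\<lambda>w. - (1 + 2 * ln w) / (4 * w\<^sup>2)) has_real_derivative ln x / x ^ 3) (at x)" if "1 \<le> x" for x :: real
    using that by (auto intro!: derivative_eq_intros simp: power2_eq_square power3_eq_cube field_simps)
qed (auto simp: set_borel_measurable_def)

interpretation t3: tail_weight "\<lambda>w. ln w / w\<^sup>2" "\<lambda>w. (1 - 2 * ln w) / w ^ 3"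
proof
  show "((\<lambda>w. ln w / w\<^sup>2) has_real_derivative (1 - 2 * ln y) / y ^ 3) (at y)" if "y > 0" for y :: real
    using that by (auto intro!: derivative_eq_intros simp: power2_eq_square power3_eq_cube field_simps)
  show c: "continuous_on {0<..} (\<lambda>w::real. (1 - 2 * ln w) / w ^ 3)" by (intro continuous_intros) auto
  show "((\<lambda>w::real. ln w / w\<^sup>2) \<longlongrightarrow> 0) at_top" by real_asymp
  have "set_integrable lborel {1..} (\<lambda>w::real. 1 / w ^ 3 - 2 * (ln w / w ^ 3))"
    by (intro set_integral_diff(1) set_integrable_mult_right set_integrable_inverse_cube set_integrable_ln_inverse_cube)
  hence "set_integrable lborel {1..} (\<lambda>w::real. (1 - 2 * ln w) / w ^ 3)"
    by (simp add: diff_divide_distrib)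
  thus "set_integrable lborel {c..} (\<lambda>w. (1 - 2 * ln w) / w ^ 3)" if "c > 0" for c :: real
    by (rule integrable_Ici_from_1[OF c _ that])
qed

interpretation t4: tail_weight "\<lambda>w. ln w / w" "\<lambda>w. (1 - ln w) / w\<^sup>2"
proof
  show "((\<lambda>w. ln w / w) has_real_derivative (1 - ln y) / y\<^sup>2) (at y)" if "y > 0" for y :: real
    using that by (auto intro!: derivative_eq_intros simp: power2_eq_square field_simps)
  show "continuous_on {0<..} (\<lambda>w::real. (1 - ln w) / w\<^sup>2)" by (intro continuous_intros) auto
  show "((\<lambda>w::real. ln w / w) \<longlongrightarrow> 0) at_top" by real_asymp
  show "set_integrable lborel {c..} (\<lambda>w. (1 - ln w) / w\<^sup>2)" if "c > 0" for c :: real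
    using set_integral_diff(1)[OF integral_inverse_square(1)[OF that] integrable_ln_over_square(1)[OF that]]
    by (simp add: diff_divide_distrib)
qed

lemma tail1_bound: "y > 0 \<Longrightarrow> \<bar>tail1 y\<bar> \<le> 1 / (4 * y)"
  using t1.tail_bound[of y] by simp

lemma tail2_bound: "y > 0 \<Longrightarrow> \<bar>tail2 y\<bar> \<le> 1 / (4 * y\<^sup>2)"
  using t2.tail_bound[of y] by simp

text \<open>Stirling's formula for real y with exact remainder. Its constant is 1 minus the second
  moment of \<open>ppar\<close>, that is - zeta'(0), which the functional equation has
  evaluated.\<close>

lemma euler_maclaurin_ln:
  assumes "y > 0"
  shows "saw y * ln y + (\<Sum>l=1..nat \<lfloor>y\<rfloor>. ln (real l)) - (y * ln y - y) + tail1 y = ln (2 * pi) / 2"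
proof -
  have "saw y * ln y + (\<Sum>l=1..nat \<lfloor>y\<rfloor>. ln (real l)) - (y * ln y - y) + tail1 y
     = ln 1 / 2 - (1 * ln 1 - 1) + (LINT w:{1..}|lborel. ppar w * (- 1 / w\<^sup>2))"
    by (rule t1.euler_maclaurin_tail) (use assms in \<open>auto intro!: derivative_eq_intros\<close>)
  also have "(LINT w:{1..}|lborel. ppar w * (- 1 / w\<^sup>2)) = - ppar_moment 2"
    unfolding ppar_moment_def set_lebesgue_integral_def by simp
  finally show ?thesis by (simp add: ppar_moment_2)
qed

lemma euler_maclaurin_inverse:
  assumes "y > 0"
  shows "- saw y / y - harm (nat \<lfloor>y\<rfloor>) + ln y + tail2 y = - \<gamma>0"
proof -
  have "saw y * (- 1 / y) + (\<Sum>l=1..nat \<lfloor>y\<rfloor>. - 1 / real l) - (- ln y) + tail2 y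
     = - 1 / 1 / 2 - (- ln 1) + (LINT w:{1..}|lborel. ppar w * (- 2 / w ^ 3))"
    by (rule t2.euler_maclaurin_tail)
       (use assms in \<open>auto intro!: derivative_eq_intros simp: power2_eq_square field_simps\<close>)
  also have "(LINT w:{1..}|lborel. ppar w * (- 2 / w ^ 3)) = - 2 * ppar_moment 3"
    unfolding ppar_moment_def set_integral_mult_right[symmetric] by (simp add: mult.commute)
  also have "(\<Sum>l=1..nat \<lfloor>y\<rfloor>. - 1 / real l) = - harm (nat \<lfloor>y\<rfloor>)"
    by (simp add: harm_def sum_negf inverse_eq_divide)
  finally show ?thesis by (simp add: stieltjes_0_1)
qed

lemma ppar_moment_integrable:
  "set_integrable lborel {1..} (\<lambda>w. ppar w / w\<^sup>2)" "set_integrable lborel {1..} (\<lambda>w. ppar w * ln w / w\<^sup>2)"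
  "set_integrable lborel {1..} (\<lambda>w. ppar w / w ^ 3)" "set_integrable lborel {1..} (\<lambda>w. ppar w * ln w / w ^ 3)"
proof -
  show a: "set_integrable lborel {1..} (\<lambda>w. ppar w / w\<^sup>2)"
    using set_integrable_mult_right[OF t1.int_ppar[of 1], of "-1"] by simp
  show b: "set_integrable lborel {1..} (\<lambda>w. ppar w / w ^ 3)"
    using set_integrable_mult_right[OF t2.int_ppar[of 1], of "-1/2"] by simp
  have "set_integrable lborel {1..} (\<lambda>w. ppar w / w\<^sup>2 - ppar w * ((1 - ln w) / w\<^sup>2))"
    by (intro set_integral_diff(1) a t4.int_ppar) auto
  moreover have "ppar w / w\<^sup>2 - ppar w * ((1 - ln w) / w\<^sup>2) = ppar w * ln w / w\<^sup>2" for w :: real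
    by (simp add: algebra_simps diff_divide_distrib)
  ultimately show "set_integrable lborel {1..} (\<lambda>w. ppar w * ln w / w\<^sup>2)" by simp
  have "set_integrable lborel {1..} (\<lambda>w. 1/2 * (ppar w / w ^ 3 - ppar w * ((1 - 2 * ln w) / w ^ 3)))"
    by (intro set_integral_diff(1) set_integrable_mult_right b t3.int_ppar) auto
  moreover have "1/2 * (ppar w / w ^ 3 - ppar w * ((1 - 2 * ln w) / w ^ 3)) = ppar w * ln w / w ^ 3" for w :: real
    by (simp add: algebra_simps diff_divide_distrib)
  ultimately show "set_integrable lborel {1..} (\<lambda>w. ppar w * ln w / w ^ 3)" by (simp only:)
qed

lemma tail3_1: "tail3 1 = 1/2 - \<gamma>0 - \<gamma>1" (is "_ = ?rhs")
  and tail4_1: "tail4 1 = ppar_moment 2 - ppar_log_moment 2"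
proof -
  have "tail3 1 = (LINT w:{1..}|lborel. ppar w / w ^ 3 - 2 * (ppar w * ln w / w ^ 3))"
    by (simp add: saw_tail_def algebra_simps diff_divide_distrib)
  also have "\<dots> = ppar_moment 3 - (LINT w:{1..}|lborel. 2 * (ppar w * ln w / w ^ 3))"
    unfolding ppar_moment_def
    by (rule set_integral_diff(2)) (intro ppar_moment_integrable set_integrable_mult_right)+
  also have "(LINT w:{1..}|lborel. 2 * (ppar w * ln w / w ^ 3)) = 2 * ppar_log_moment 3"
    unfolding ppar_log_moment_def by (rule set_integral_mult_right)
  finally show "tail3 1 = ?rhs" unfolding stieltjes_0_1 by simp
  have "tail4 1 = (LINT w:{1..}|lborel. ppar w / w\<^sup>2 - ppar w * ln w / w\<^sup>2)"
    by (simp add: saw_tail_def algebra_simps diff_divide_distrib)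
  also have "\<dots> = ppar_moment 2 - ppar_log_moment 2"
    unfolding ppar_moment_def ppar_log_moment_def
    by (subst set_integral_diff(2)) (auto intro!: ppar_moment_integrable)
  finally show "tail4 1 = ppar_moment 2 - ppar_log_moment 2" .
qed

text \<open>Summing (1 + ln l) / l instead of ln l / l is dictated by the weight: the derivative of
  (1 + ln y) / y is - ln y / y^2 with no further term. The additional harmonic sum accounts for the
  \<gamma> on the right.\<close>

lemma euler_maclaurin_ln_inverse:
  assumes "y > 0"
  shows "- saw y * (1 + ln y) / y - (\<Sum>l=1..nat \<lfloor>y\<rfloor>. (1 + ln (real l)) / real l) + ln y + (ln y)\<^sup>2 / 2 + tail3 y
           = - \<gamma>0 - \<gamma>1"
proof -
  have "saw y * (- (1 + ln y) / y) + (\<Sum>l=1..nat \<lfloor>y\<rfloor>. - (1 + ln (real l)) / real l) - (- ln y - (ln y)\<^sup>2 / 2) + tail3 y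
     = - (1 + ln 1) / 1 / 2 - (- ln 1 - (ln 1)\<^sup>2 / 2) + (LINT w:{1..}|lborel. ppar w * ((1 - 2 * ln w) / w ^ 3))"
  proof (rule t3.euler_maclaurin_tail)
    show "((\<lambda>y. - (1 + ln y) / y) has_real_derivative ln y / y\<^sup>2) (at y)" if "y > 0" for y :: real
      using that by (auto intro!: derivative_eq_intros simp: power2_eq_square field_simps)
    show "((\<lambda>y. - ln y - (ln y)\<^sup>2 / 2) has_real_derivative - (1 + ln y) / y) (at y)" if "y > 0" for y :: real
      using that by (auto intro!: derivative_eq_intros simp: power2_eq_square field_simps)
  qed fact
  also have "(LINT w:{1..}|lborel. ppar w * ((1 - 2 * ln w) / w ^ 3)) = tail3 1"
    by (simp add: saw_tail_def)
  also have "(\<Sum>l=1..nat \<lfloor>y\<rfloor>. - (1 + ln (real l)) / real l) = - (\<Sum>l=1..nat \<lfloor>y\<rfloor>. (1 + ln (real l)) / real l)"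
    by (simp only: minus_divide_left[symmetric] sum_negf)
  finally have E: "saw y * (- (1 + ln y) / y) + - (\<Sum>l=1..nat \<lfloor>y\<rfloor>. (1 + ln (real l)) / real l) - (- ln y - (ln y)\<^sup>2 / 2) + tail3 y
     = - (1 + ln 1) / 1 / 2 - (- ln 1 - (ln 1)\<^sup>2 / 2) + (1/2 - \<gamma>0 - \<gamma>1)" unfolding tail3_1 .
  have "saw y * (- (1 + ln y) / y) = - saw y * (1 + ln y) / y"
    by (simp only: mult_minus_left mult_minus_right times_divide_eq_right)
  moreover have "- (1 + ln 1) / 1 / 2 - (- ln 1 - (ln 1)\<^sup>2 / 2) = (- 1/2 :: real)" by simp
  ultimately show ?thesis using E by linarith
qed

text \<open>\<open>R1\<close> is up to sign the Euler-Maclaurin remainder of the harmonic sum, hence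
  of order 1 / y^2, which is what makes \<open>S1\<close> converge.\<close>

lemma R1_conv_tail:
  assumes "y > 0"
  shows "R1 y = - tail2 y"
proof -
  have "(frac y - 1/2) / y = saw y / y" by (simp only: saw_def)
  moreover have "- saw y / y = - (saw y / y)" by simp
  ultimately show ?thesis
    using euler_maclaurin_inverse[OF assms] unfolding R1_def H_def by linarith
qed

text \<open>Expanding ln (y / l) splits the sum in \<open>R2\<close> into a count and the sums of ln
  l, 1/l and ln l / l. The three summation formulas replace these sums by tails, the count is y -
  saw y - 1/2, and all elementary terms cancel.\<close>

lemma R2_conv_tail:
  assumes y: "y > 0"
  shows "R2 y = - tail3 y + (ln y - 1) * tail2 y + tail1 y / y"
proof -
  define n where "n = nat \<lfloor>y\<rfloor>"
  define A where "A = (\<Sum>l=1..n. ln (real l))"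
  define B where "B = (\<Sum>l=1..n. 1 / real l)"
  define C where "C = (\<Sum>l=1..n. ln (real l) / real l)"
  have "real n = y - frac y" using y by (simp add: n_def frac_def)
  hence n: "real n = y - saw y - 1/2" by (simp add: saw_def)
  have hB: "harm n = B" by (simp add: harm_def B_def inverse_eq_divide)
  have hBC: "(\<Sum>l=1..n. (1 + ln (real l)) / real l) = B + C"
    by (simp add: B_def C_def add_divide_distrib sum.distrib)
  have T1: "tail1 y = ln (2 * pi) / 2 - saw y * ln y - A + y * ln y - y"
    using euler_maclaurin_ln[OF y] by (simp add: A_def n_def)
  have T2: "tail2 y = - \<gamma>0 + saw y / y + B - ln y"
    using euler_maclaurin_inverse[OF y] unfolding n_def[symmetric] hB by simp
  have T3: "tail3 y = - \<gamma>0 - \<gamma>1 + saw y * (1 + ln y) / y + B + C - ln y - (ln y)\<^sup>2 / 2"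
    using euler_maclaurin_ln_inverse[OF y] unfolding n_def[symmetric] hBC by simp
  have "(\<Sum>l=1..n. (1 + y / real l) * ln (y / real l) + 2 * (1 - y / real l))
      = (\<Sum>l=1..n. ln y - ln (real l) + y * ln y * (1 / real l) - y * (ln (real l) / real l) + 2 - 2 * y * (1 / real l))"
  proof (rule sum.cong[OF refl])
    fix l assume "l \<in> {1..n}"
    hence L: "ln (y / real l) = ln y - ln (real l)" using y by (simp add: ln_div)
    show "(1 + y / real l) * ln (y / real l) + 2 * (1 - y / real l)
      = ln y - ln (real l) + y * ln y * (1 / real l) - y * (ln (real l) / real l) + 2 - 2 * y * (1 / real l)"
      unfolding L by (simp add: algebra_simps diff_divide_distrib)
  qed
  also have "\<dots> = real n * ln y - A + y * ln y * B - y * C + 2 * real n - 2 * y * B"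
    by (simp add: sum.distrib sum_subtractf A_def B_def C_def sum_distrib_left)
  finally have sum: "(\<Sum>l=1..n. (1 + y / real l) * ln (y / real l) + 2 * (1 - y / real l))
      = real n * ln y - A + y * ln y * B - y * C + 2 * real n - 2 * y * B" .
  have R: "R2 y = 1 / y * (1/2 * ln (2 * pi) + 1 + 1/2 * ln y) + (2 - \<gamma>0) * ln y - 1/2 * (ln y)\<^sup>2 + 2 * \<gamma>0 + \<gamma>1 - 3
          + 1 / y * (real n * ln y - A + y * ln y * B - y * C + 2 * real n - 2 * y * B)"
    unfolding R2_def n_def[symmetric] sum ..
  define r \<Lambda> \<sigma> u where "r = 1 / y" and "\<Lambda> = ln (2 * pi)" and "\<sigma> = saw y" and "u = ln y"
  have ry: "r * y = 1" using y by (simp add: r_def)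
  have "r * (real n * u - A + y * u * B - y * C + 2 * real n - 2 * y * B)
      = (r * y) * (u + u * B - C + 2 - 2 * B) - \<sigma> * u * r - u * r / 2 - A * r - 2 * \<sigma> * r - r"
    unfolding n \<sigma>_def[symmetric] by (simp add: algebra_simps)
  hence R': "R2 y = r * (1/2 * \<Lambda> + 1 + 1/2 * u) + (2 - \<gamma>0) * u - 1/2 * u\<^sup>2 + 2 * \<gamma>0 + \<gamma>1 - 3
      + ((u + u * B - C + 2 - 2 * B) - \<sigma> * u * r - u * r / 2 - A * r - 2 * \<sigma> * r - r)"
    unfolding R r_def[symmetric] \<Lambda>_def[symmetric] u_def[symmetric] ry mult_1_left by (rule arg_cong)
  have T1': "tail1 y / y = (r * y) * (u - 1) + r * (\<Lambda> / 2 - \<sigma> * u - A)"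
  proof -
    have "tail1 y / y = r * tail1 y" by (simp add: r_def)
    also have "\<dots> = (r * y) * (u - 1) + r * (\<Lambda> / 2 - \<sigma> * u - A)"
      unfolding T1 \<Lambda>_def[symmetric] u_def[symmetric] \<sigma>_def[symmetric] by (simp add: algebra_simps)
    finally show ?thesis .
  qed
  have T2': "tail2 y = - \<gamma>0 + \<sigma> * r + B - u" unfolding T2 u_def r_def \<sigma>_def by simp
  have T3': "tail3 y = - \<gamma>0 - \<gamma>1 + \<sigma> * (1 + u) * r + B + C - u - u\<^sup>2 / 2" unfolding T3 u_def r_def \<sigma>_def by simp
  show ?thesis
    unfolding R' T1' T2' T3' ry u_def[symmetric] by (simp add: algebra_simps power2_eq_square)
qed

section \<open>The Vasyunin function\<close>

lemma set_integral_Ici_limit: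
  fixes f :: "real \<Rightarrow> real"
  assumes meas: "f \<in> borel_measurable borel" and nn: "\<And>t. a \<le> t \<Longrightarrow> 0 \<le> f t"
    and I: "\<And>M. M \<ge> Mmin \<Longrightarrow> (f has_integral V M) {a..real M}" and lim: "V \<longlonglongrightarrow> L"
  shows "set_integrable lborel {a..} f" "(LINT t:{a..}|lborel. f t) = L"
proof -
  note [measurable] = meas
  have eq: "(\<integral>\<^sup>+t. ennreal (indicator {a..} t * f t) \<partial>lborel) = ennreal L"
    by (rule nn_integral_Ici_limit[OF assms])
  show "set_integrable lborel {a..} f"
    unfolding set_integrable_def
    by (rule integrableI_nonneg) (use nn eq in \<open>auto split: split_indicator\<close>)
  have L: "L \<ge> 0"
  proof (rule LIMSEQ_le_const[OF lim], intro exI[of _ Mmin] allI impI)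
    show "0 \<le> V M" if "Mmin \<le> M" for M
      by (rule has_integral_nonneg[OF I[OF that]]) (use nn in auto)
  qed
  show "(LINT t:{a..}|lborel. f t) = L"
    unfolding set_lebesgue_integral_def
    by (rule integral_eq_nn_integral[THEN trans]) (use nn eq L in \<open>auto split: split_indicator\<close>)
qed

text \<open>
  Antiderivatives of \<open>frac t / t\<close> and \<open>frac t / t\<^sup>2\<close>, vanishing at 0 and at infinity respectively.
\<close>

definition frac_prim :: "real \<Rightarrow> real" where
  "frac_prim t = (if t \<le> 0 then 0 else ln t / 2 + ln (2 * pi) / 2 - tail1 t)"

definition frac_prim2 :: "real \<Rightarrow> real" where
  "frac_prim2 t = - tail2 t - 1 / (2 * t)"

text \<open>Stirling's formula with the empty sum: on (0, 1) the remainder is elementary, and the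
  constant ln (2 pi) / 2 is what makes the antiderivative vanish at 0.\<close>

lemma frac_prim_le_1:
  assumes "0 \<le> t" "t \<le> 1"
  shows "frac_prim t = t"
proof (cases "t = 0 \<or> t = 1")
  case False
  hence t: "0 < t" "t < 1" using assms by auto
  hence "saw t = t - 1/2" "nat \<lfloor>t\<rfloor> = 0" by (auto simp: saw_def frac_eq floor_eq_iff)
  hence "(t - 1/2) * ln t - (t * ln t - t) + tail1 t = ln (2 * pi) / 2"
    using euler_maclaurin_ln[of t] t by simp
  moreover have "(t - 1/2) * ln t = t * ln t - ln t / 2" by (simp add: algebra_simps)
  ultimately have "ln t / 2 + ln (2 * pi) / 2 - tail1 t = t" by linarith
  thus ?thesis using t by (simp add: frac_prim_def)
next
  case True
  thus ?thesis using euler_maclaurin_ln[of 1] by (auto simp: frac_prim_def)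
qed

lemma frac_prim_has_derivative:
  assumes t: "t > 0" "t \<notin> \<int>"
  shows "(frac_prim has_real_derivative frac t / t) (at t)"
proof -
  have "((\<lambda>t. ln t / 2 + ln (2 * pi) / 2 - tail1 t) has_real_derivative 1 / t / 2 + 0 - - (saw t * (1 / t))) (at t)"
    by (intro DERIV_diff DERIV_add DERIV_cdivide DERIV_const t1.tail_has_derivative t)
       (use t in \<open>auto intro!: derivative_eq_intros\<close>)
  also have "1 / t / 2 + 0 - - (saw t * (1 / t)) = frac t / t"
    using t by (simp add: saw_def field_simps)
  finally show ?thesis
    by (rule has_field_derivative_transform_within_open[where S = "{0<..}"]) (use t in \<open>auto simp: frac_prim_def\<close>)
qed

lemma isCont_frac_prim_pos: "t > 0 \<Longrightarrow> isCont frac_prim t"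
proof -
  assume t: "t > 0"
  have "isCont (\<lambda>t. ln t / 2 + ln (2 * pi) / 2 - tail1 t) t"
    by (intro continuous_intros t1.isCont_tail) (use t in auto)
  moreover have "eventually (\<lambda>z. ln z / 2 + ln (2 * pi) / 2 - tail1 z = frac_prim z) (nhds t)"
    by (rule eventually_mono[OF eventually_nhds_in_open[of "{0<..}"]]) (use t in \<open>auto simp: frac_prim_def\<close>)
  ultimately show ?thesis by (simp cong: isCont_cong)
qed

lemma continuous_on_frac_prim: "continuous_on {0..} frac_prim"
proof -
  have "continuous_on {0..1} frac_prim"
    by (rule continuous_on_eq[OF continuous_on_id]) (simp add: frac_prim_le_1)
  moreover have "continuous_on {1..} frac_prim"
    by (intro continuous_at_imp_continuous_on ballI isCont_frac_prim_pos) auto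
  ultimately have "continuous_on ({0..1} \<union> {1..}) frac_prim"
    by (intro continuous_on_closed_Un) auto
  moreover have "{0..1} \<union> {1..} = {0::real..}" by auto
  ultimately show ?thesis by simp
qed

lemma frac_prim2_has_derivative:
  assumes t: "t > 0" "t \<notin> \<int>"
  shows "(frac_prim2 has_real_derivative frac t / t\<^sup>2) (at t)"
proof -
  have "(frac_prim2 has_real_derivative (- (- (saw t * (1 / t\<^sup>2))) - (- 1 / (2 * t\<^sup>2)))) (at t)"
    unfolding frac_prim2_def [abs_def]
    by (intro DERIV_diff DERIV_minus t2.tail_has_derivative t)
       (use t in \<open>auto intro!: derivative_eq_intros simp: power2_eq_square\<close>)
  also have "- (- (saw t * (1 / t\<^sup>2))) - (- 1 / (2 * t\<^sup>2)) = frac t / t\<^sup>2"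
    using t by (simp add: saw_def field_simps)
  finally show ?thesis .
qed

lemma isCont_frac_prim2: "t > 0 \<Longrightarrow> isCont frac_prim2 t"
  unfolding frac_prim2_def [abs_def] by (intro continuous_intros t2.isCont_tail) auto

lemma finite_scaled_Ints:
  assumes c: "c > (0::real)"
  shows "finite ({w. c * w \<in> \<int>} \<inter> {a..b})"
proof (rule finite_subset)
  show "{w. c * w \<in> \<int>} \<inter> {a..b} \<subseteq> (\<lambda>z. z / c) ` (\<int> \<inter> {c * a..c * b})"
  proof
    fix w assume "w \<in> {w. c * w \<in> \<int>} \<inter> {a..b}"
    hence "c * w \<in> \<int> \<inter> {c * a..c * b}" "w = c * w / c" using c by auto
    thus "w \<in> (\<lambda>z. z / c) ` (\<int> \<inter> {c * a..c * b})" by (metis imageI)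
  qed
qed (simp add: finite_Ints_inter_Icc)

lemma has_integral_frac_over:
  assumes c: "c > 0" and x: "x \<ge> 0"
  shows "((\<lambda>t. frac (c * t) / t) has_integral frac_prim (c * x)) {0..x}"
proof -
  have "((\<lambda>t. frac (c * t) / t) has_integral frac_prim (c * x) - frac_prim (c * 0)) {0..x}"
  proof (rule fundamental_theorem_of_calculus_interior_strong[OF finite_scaled_Ints[OF c] x])
    show "continuous_on {0..x} (\<lambda>t. frac_prim (c * t))"
      by (rule continuous_on_compose2[OF continuous_on_frac_prim]) (use c in \<open>auto intro!: continuous_intros\<close>)
    fix t assume t: "t \<in> {0<..<x} - {w. c * w \<in> \<int>} \<inter> {0..x}"
    hence t': "c * t > 0" "c * t \<notin> \<int>" using c by auto
    have "((\<lambda>t. frac_prim (c * t)) has_real_derivative frac (c * t) / (c * t) * c) (at t)"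
      by (rule DERIV_chain2[where f = frac_prim and g = "\<lambda>t. c * t", OF frac_prim_has_derivative[OF t']]) (auto intro!: derivative_eq_intros)
    thus "((\<lambda>t. frac_prim (c * t)) has_vector_derivative frac (c * t) / t) (at t)"
      using c t by (simp add: has_real_derivative_iff_has_vector_derivative)
  qed
  thus ?thesis by (simp add: frac_prim_le_1)
qed

definition vasyunin :: "real \<Rightarrow> real" where
  "vasyunin x = (LINT w:{0<..}|lborel. frac w * frac (x * w) / w\<^sup>2)"

text \<open>On [N, N + 1] frac w = w - N, so the integrand is frac (x w) / w - N frac (x w) / w^2,
  and both parts have known antiderivatives. Summation by parts over the intervals converts the
  multiples N of increments of \<open>frac_prim2\<close> into its values at the multiples of
  x.\<close>

lemma vasyunin_partial:
  assumes x: "x > 0" and N: "N \<ge> 1"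
  shows "((\<lambda>w. frac w * frac (x * w) / w\<^sup>2) has_integral
     frac_prim (x * real N) - x * real N * frac_prim2 (x * real N) + x * (\<Sum>k<N. frac_prim2 (x * real (Suc k)))) {0..real N}"
  using N
proof (induction N rule: dec_induct)
  case base
  have "((\<lambda>w. frac w * frac (x * w) / w\<^sup>2) has_integral frac_prim (x * 1)) {0..1}"
  proof (rule has_integral_spike_finite[OF _ _ has_integral_frac_over[OF x]])
    fix w :: real assume "w \<in> {0..1} - {0, 1}"
    hence "frac w = w" "w > 0" by (auto simp: frac_eq)
    thus "frac w * frac (x * w) / w\<^sup>2 = frac (x * w) / w" by (simp add: power2_eq_square)
  qed auto
  thus ?case by simp
next
  case (step N)
  let ?f = "\<lambda>w. frac w * frac (x * w) / w\<^sup>2"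
  let ?F = "\<lambda>w. frac_prim (x * w) - real N * x * frac_prim2 (x * w)"
  have "(?f has_integral ?F (real N + 1) - ?F (real N)) {real N..real N + 1}"
  proof (rule fundamental_theorem_of_calculus_interior_strong[OF finite_scaled_Ints[OF x]])
    show "continuous_on {real N..real N + 1} ?F"
    proof (intro continuous_intros continuous_at_imp_continuous_on ballI)
      fix w assume "w \<in> {real N..real N + 1}"
      hence w: "x * w > 0" using step x by auto
      show "isCont (\<lambda>w. frac_prim (x * w)) w"
        by (rule isCont_o2[where g = frac_prim and f = "\<lambda>w. x * w", OF _ isCont_frac_prim_pos[OF w]]) (auto intro!: continuous_intros)
      show "isCont (\<lambda>w. frac_prim2 (x * w)) w"
        by (rule isCont_o2[where g = frac_prim2 and f = "\<lambda>w. x * w", OF _ isCont_frac_prim2[OF w]]) (auto intro!: continuous_intros)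
    qed
    fix w assume w: "w \<in> {real N<..<real N + 1} - {w. x * w \<in> \<int>} \<inter> {real N..real N + 1}"
    hence w': "x * w > 0" "x * w \<notin> \<int>" "w > 0" using x step by auto
    have fr: "frac w = w - real N" using w frac_eq_on_piece[of "int N" w] by auto
    have d1: "((\<lambda>w. frac_prim (x * w)) has_real_derivative frac (x * w) / (x * w) * x) (at w)"
      by (rule DERIV_chain2[where f = frac_prim and g = "\<lambda>w. x * w", OF frac_prim_has_derivative[OF w'(1,2)]]) (auto intro!: derivative_eq_intros)
    have d2: "((\<lambda>w. frac_prim2 (x * w)) has_real_derivative frac (x * w) / (x * w)\<^sup>2 * x) (at w)"
      by (rule DERIV_chain2[where f = frac_prim2 and g = "\<lambda>w. x * w", OF frac_prim2_has_derivative[OF w'(1,2)]]) (auto intro!: derivative_eq_intros)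
    have "(?F has_real_derivative frac (x * w) / (x * w) * x - real N * x * (frac (x * w) / (x * w)\<^sup>2 * x)) (at w)"
      by (intro DERIV_diff DERIV_cmult d1 d2)
    also have "frac (x * w) / (x * w) * x - real N * x * (frac (x * w) / (x * w)\<^sup>2 * x) = ?f w"
      unfolding fr using x w'(3) by (simp add: divide_simps power2_eq_square) (simp add: algebra_simps)
    finally show "(?F has_vector_derivative ?f w) (at w)"
      by (simp add: has_real_derivative_iff_has_vector_derivative)
  qed auto
  from has_integral_combine[OF _ _ step.IH this]
  have "(?f has_integral frac_prim (x * real N) - x * real N * frac_prim2 (x * real N) + x * (\<Sum>k<N. frac_prim2 (x * real (Suc k)))
     + (?F (real N + 1) - ?F (real N))) {0..real N + 1}"
    by auto
  also have "frac_prim (x * real N) - x * real N * frac_prim2 (x * real N) + x * (\<Sum>k<N. frac_prim2 (x * real (Suc k)))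
     + (?F (real N + 1) - ?F (real N))
     = frac_prim (x * real (Suc N)) - x * real (Suc N) * frac_prim2 (x * real (Suc N)) + x * (\<Sum>k<Suc N. frac_prim2 (x * real (Suc k)))"
    by (simp add: algebra_simps)
  finally show ?case by (simp add: add.commute)
qed

lemma abs_R1_le: "y > 0 \<Longrightarrow> \<bar>R1 y\<bar> \<le> 1 / (4 * y\<^sup>2)"
  using tail2_bound[of y] by (simp add: R1_conv_tail)

lemma abs_R1_scaled_le: "y > 0 \<Longrightarrow> \<bar>R1 (real (Suc k) * y)\<bar> \<le> 1 / (4 * y\<^sup>2) / (real (Suc k))\<^sup>2"
  using abs_R1_le[of "real (Suc k) * y"] by (simp add: power_mult_distrib mult_ac)

lemma summable_R1_scaled: "y > 0 \<Longrightarrow> summable (\<lambda>k. R1 (real (Suc k) * y))"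
  by (rule summable_comparison_test'[OF summable_inverse_Suc_square[of "1 / (4 * y\<^sup>2)"]])
     (use abs_R1_scaled_le[of y] in \<open>simp only: real_norm_def\<close>)

text \<open>frac_prim2 (k x) is R1 (k x) - 1 / (2 k x), so the sum yields x S1(x) and - harm N / 2.
  The latter cancels the ln N / 2 from \<open>frac_prim\<close> and leaves - \<gamma> / 2. In
  \<open>K\<close>, ln (2 pi) / 2 is Stirling's constant and 1/2 the limit of the boundary term with
  \<open>frac_prim2\<close>.\<close>

lemma vasyunin_conv_S1:
  assumes x: "x > 0"
  shows "set_integrable lborel {0..} (\<lambda>w. frac w * frac (x * w) / w\<^sup>2)"
    and "vasyunin x = x * S1 x + K + ln x / 2"
proof -
  let ?f = "\<lambda>w. frac w * frac (x * w) / w\<^sup>2"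
  let ?V = "\<lambda>N. frac_prim (x * real N) - x * real N * frac_prim2 (x * real N) + x * (\<Sum>k<N. frac_prim2 (x * real (Suc k)))"
  \<comment> \<open>The partial integral regrouped so that every piece has a visible limit: the
    harmonic number minus the logarithm, two tails, and a partial sum of \<open>S1\<close>.\<close>
  let ?U = "\<lambda>N. ln x / 2 + ln (2 * pi) / 2 + 1/2 - (harm N - ln (real N)) / 2 - tail1 (x * real N) + x * real N * tail2 (x * real N)
        + x * (\<Sum>k<N. R1 (real (Suc k) * x))"
  have UV: "?U N = ?V N" if "N \<ge> 1" for N
  proof -
    have p: "x * real N > 0" using x that by simp
    have "x * (\<Sum>k<N. frac_prim2 (x * real (Suc k))) = (\<Sum>k<N. x * R1 (real (Suc k) * x) - 1/2 * inverse (real (Suc k)))"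
      unfolding sum_distrib_left
    proof (rule sum.cong[OF refl])
      fix k
      have y: "real (Suc k) * x > 0" using x by simp
      have "x * (1 / (2 * (real (Suc k) * x))) = 1/2 * inverse (real (Suc k))"
        using x by (simp add: divide_simps)
      moreover have "x * frac_prim2 (x * real (Suc k)) = x * R1 (real (Suc k) * x) - x * (1 / (2 * (real (Suc k) * x)))"
        unfolding R1_conv_tail[OF y] frac_prim2_def mult.commute[of x "real (Suc k)"] by (simp only: right_diff_distrib)
      ultimately show "x * frac_prim2 (x * real (Suc k)) = x * R1 (real (Suc k) * x) - 1/2 * inverse (real (Suc k))" by simp
    qed
    also have "\<dots> = x * (\<Sum>k<N. R1 (real (Suc k) * x)) - harm N / 2"
      by (simp only: sum_subtractf sum_distrib_left [symmetric] harm_def One_nat_def sum.atLeast1_atMost_eq)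
    finally have s: "x * (\<Sum>k<N. frac_prim2 (x * real (Suc k))) = x * (\<Sum>k<N. R1 (real (Suc k) * x)) - harm N / 2" .
    have a: "frac_prim (x * real N) = (ln x + ln (real N)) / 2 + ln (2 * pi) / 2 - tail1 (x * real N)"
    proof -
      have "\<not> x * real N \<le> 0" using p by linarith
      moreover have "ln (x * real N) = ln x + ln (real N)" using x that by (intro ln_mult_pos) auto
      ultimately show ?thesis by (simp only: frac_prim_def if_False)
    qed
    have b: "x * real N * frac_prim2 (x * real N) = - (x * real N * tail2 (x * real N)) - 1/2"
    proof -
      have "z * (- tail2 z - 1 / (2 * z)) = - (z * tail2 z) - 1/2" if "z > 0" for z
        using that by (simp add: right_diff_distrib)
      from this[OF p] show ?thesis unfolding frac_prim2_def .
    qed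
    show ?thesis unfolding s a b by (simp add: add_divide_distrib diff_divide_distrib)
  qed
  have xN: "filterlim (\<lambda>N. x * real N) at_top sequentially"
    by (rule filterlim_tendsto_pos_mult_at_top[OF tendsto_const x filterlim_real_sequentially])
  have l1: "(\<lambda>N. tail1 (x * real N)) \<longlonglongrightarrow> 0"
    by (rule filterlim_compose[OF t1.tail_tendsto_0 xN])
  have "((\<lambda>y. y * tail2 y) \<longlongrightarrow> 0) at_top"
  proof (rule Lim_null_comparison)
    show "eventually (\<lambda>y. norm (y * tail2 y) \<le> 1 / (4 * y)) at_top"
      using eventually_gt_at_top[of 0]
    proof eventually_elim
      case (elim y)
      have "\<bar>y\<bar> * \<bar>tail2 y\<bar> \<le> \<bar>y\<bar> * (1 / (4 * y\<^sup>2))" by (intro mult_left_mono tail2_bound elim) auto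
      thus ?case using elim by (simp add: abs_mult power2_eq_square)
    qed
    show "((\<lambda>y::real. 1 / (4 * y)) \<longlongrightarrow> 0) at_top" by real_asymp
  qed
  hence l2: "(\<lambda>N. x * real N * tail2 (x * real N)) \<longlonglongrightarrow> 0" by (rule filterlim_compose[OF _ xN])
  have l3: "(\<lambda>N. \<Sum>k<N. R1 (real (Suc k) * x)) \<longlonglongrightarrow> S1 x"
    unfolding S1_def by (rule summable_LIMSEQ[OF summable_R1_scaled[OF x]])
  have l4: "(\<lambda>N. harm N - ln (real N)) \<longlonglongrightarrow> \<gamma>0"
    unfolding stieltjes_0_eq_euler_mascheroni by (rule euler_mascheroni_LIMSEQ)
  have "?U \<longlonglongrightarrow> ln x / 2 + ln (2 * pi) / 2 + 1/2 - \<gamma>0 / 2 - 0 + 0 + x * S1 x"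
    by (intro tendsto_intros l1 l2 l3 l4) auto
  also have "ln x / 2 + ln (2 * pi) / 2 + 1/2 - \<gamma>0 / 2 - 0 + 0 + x * S1 x = x * S1 x + K + ln x / 2"
    by (simp add: K_def add_divide_distrib diff_divide_distrib)
  finally have lim: "?V \<longlonglongrightarrow> x * S1 x + K + ln x / 2"
    by (rule Lim_transform_eventually) (rule eventually_mono[OF eventually_ge_at_top[of 1]], rule UV)
  have nn: "0 \<le> ?f t" for t by (simp add: frac_ge_0)
  note T = set_integral_Ici_limit[OF _ nn vasyunin_partial[OF x] lim]
  show i: "set_integrable lborel {0..} ?f" by (rule T(1)) auto
  have "(LINT t:{0..}|lborel. ?f t) = x * S1 x + K + ln x / 2" by (rule T(2)) auto
  moreover have "vasyunin x = (LINT t:{0..}|lborel. ?f t)"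
    unfolding vasyunin_def set_lebesgue_integral_def
    by (rule Bochner_Integration.integral_cong[OF refl]) (auto split: split_indicator)
  ultimately show "vasyunin x = x * S1 x + K + ln x / 2" by simp
qed

section \<open>Integral representations of R2 and S2\<close>

lemma R1_measurable [measurable]: "R1 \<in> borel_measurable borel"
proof -
  have "(\<lambda>n::int. harm (nat n) :: real) \<in> borel_measurable (count_space UNIV)" by simp
  from measurable_compose[OF measurable_real_floor this]
  have "(\<lambda>x::real. harm (nat \<lfloor>x\<rfloor>) :: real) \<in> borel_measurable borel" .
  thus ?thesis unfolding R1_def [abs_def] H_def by measurable
qed

lemma S1_measurable [measurable]: "S1 \<in> borel_measurable borel"
  unfolding S1_def [abs_def] by measurable

lemma set_integrable_bounded_by_inverse_square:
  fixes f :: "real \<Rightarrow> real"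
  assumes [measurable]: "f \<in> borel_measurable borel" and "c > 0"
    and "\<And>t. t \<ge> c \<Longrightarrow> \<bar>f t\<bar> \<le> B / t\<^sup>2"
  shows "set_integrable lborel {c..} f"
  unfolding set_integrable_def
proof (rule Bochner_Integration.integrable_bound)
  show "integrable lborel (\<lambda>t. indicator {c..} t *\<^sub>R (B * (1 / t\<^sup>2)))"
    using set_integrable_mult_right[OF integral_inverse_square(1)[OF assms(2)], of B] by (simp add: set_integrable_def)
  show "AE t in lborel. norm (indicator {c..} t *\<^sub>R f t) \<le> norm (indicator {c..} t *\<^sub>R (B * (1 / t\<^sup>2)))"
  proof (intro AE_I2)
    fix t :: real
    show "norm (indicator {c..} t *\<^sub>R f t) \<le> norm (indicator {c..} t *\<^sub>R (B * (1 / t\<^sup>2)))"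
    proof (cases "t \<ge> c")
      case True
      have "\<bar>f t\<bar> \<le> \<bar>B / t\<^sup>2\<bar>" using assms(3)[OF True] by linarith
      thus ?thesis using True by simp
    qed auto
  qed
qed auto

lemma tendsto_id_mult_tail2: "((\<lambda>y. y * tail2 y) \<longlongrightarrow> 0) at_top"
  and tendsto_ln_mult_tail2: "((\<lambda>y. ln y * tail2 y) \<longlongrightarrow> 0) at_top"
proof -
  show "((\<lambda>y. y * tail2 y) \<longlongrightarrow> 0) at_top"
  proof (rule Lim_null_comparison)
    show "eventually (\<lambda>y. norm (y * tail2 y) \<le> 1 / (4 * y)) at_top"
      using eventually_gt_at_top[of 0]
    proof eventually_elim
      case (elim y)
      have "\<bar>y\<bar> * \<bar>tail2 y\<bar> \<le> \<bar>y\<bar> * (1 / (4 * y\<^sup>2))" by (intro mult_left_mono tail2_bound elim) auto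
      thus ?case using elim by (simp add: abs_mult power2_eq_square)
    qed
    show "((\<lambda>y::real. 1 / (4 * y)) \<longlongrightarrow> 0) at_top" by real_asymp
  qed
  show "((\<lambda>y. ln y * tail2 y) \<longlongrightarrow> 0) at_top"
  proof (rule Lim_null_comparison)
    show "eventually (\<lambda>y. norm (ln y * tail2 y) \<le> ln y / (4 * y\<^sup>2)) at_top"
      using eventually_ge_at_top[of 1]
    proof eventually_elim
      case (elim y)
      have "\<bar>ln y\<bar> * \<bar>tail2 y\<bar> \<le> \<bar>ln y\<bar> * (1 / (4 * y\<^sup>2))" using elim by (intro mult_left_mono tail2_bound) auto
      thus ?case using elim by (simp add: abs_mult)
    qed
    show "((\<lambda>y::real. ln y / (4 * y\<^sup>2)) \<longlongrightarrow> 0) at_top" by real_asymp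
  qed
qed

text \<open>\<open>R1\<close> = - \<open>tail2\<close> has the antiderivative tail1 t - t * tail2 t,
  and R1 t / t has tail3 t - ln t * tail2 t; both vanish at infinity. This reveals the closed form
  of \<open>R2\<close> as a second remainder generated from \<open>R1\<close> by a simple
  kernel.\<close>

lemma R2_conv_integral:
  assumes y: "y > 0"
  shows "set_integrable lborel {y..} (\<lambda>t. (1 / t - 1 / y) * R1 t)" (is ?A)
    and "R2 y = (LINT t:{y..}|lborel. (1 / t - 1 / y) * R1 t)" (is ?B)
proof -
  define F where "F = (\<lambda>t. (tail3 t - ln t * tail2 t) - (tail1 t - t * tail2 t) / y)"
  show i: ?A
  proof (rule set_integrable_bounded_by_inverse_square[where B = "1 / (4 * y)"])
    fix t assume t: "t \<ge> y"
    have "\<bar>1 / t - 1 / y\<bar> \<le> 1 / y" using t y frac_le[of 1 1 y t] by auto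
    hence "\<bar>1 / t - 1 / y\<bar> * \<bar>R1 t\<bar> \<le> 1 / y * (1 / (4 * t\<^sup>2))"
      using t y by (intro mult_mono abs_R1_le) auto
    thus "\<bar>(1 / t - 1 / y) * R1 t\<bar> \<le> 1 / (4 * y) / t\<^sup>2" by (simp add: abs_mult)
  qed (use y in auto)
  have "(LINT t:{y..}|lborel. (1 / t - 1 / y) * R1 t) = 0 - F y"
  proof (rule set_integral_FTC_at_top[where X = \<int>, OF finite_Ints_inter_Icc i])
    show "continuous_on {y..} F"
      unfolding F_def
      by (intro continuous_intros continuous_at_imp_continuous_on ballI t1.isCont_tail t2.isCont_tail t3.isCont_tail)
         (use y in auto)
    show "(F has_vector_derivative (1 / t - 1 / y) * R1 t) (at t)" if "y < t" "t \<notin> \<int>" for t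
    proof -
      have t: "t > 0" "t \<notin> \<int>" using y that by auto
      have l: "(ln has_real_derivative 1 / t) (at t)" using t by (auto intro!: derivative_eq_intros)
      have "(F has_real_derivative
         (- (saw t * (ln t / t\<^sup>2)) - (1 / t * tail2 t + - (saw t * (1 / t\<^sup>2)) * ln t))
          - (- (saw t * (1 / t)) - (1 * tail2 t + - (saw t * (1 / t\<^sup>2)) * t)) / y) (at t)"
        unfolding F_def
        by (intro DERIV_diff DERIV_mult DERIV_cdivide DERIV_ident l t1.tail_has_derivative t2.tail_has_derivative t3.tail_has_derivative t)
      also have "(- (saw t * (ln t / t\<^sup>2)) - (1 / t * tail2 t + - (saw t * (1 / t\<^sup>2)) * ln t))
          - (- (saw t * (1 / t)) - (1 * tail2 t + - (saw t * (1 / t\<^sup>2)) * t)) / y = (1 / t - 1 / y) * R1 t"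
      proof -
        have "saw t * (1 / t\<^sup>2) * t = saw t * (1 / t)" using t by (simp add: power2_eq_square)
        thus ?thesis unfolding R1_conv_tail[OF t(1)] by (simp add: algebra_simps)
      qed
      finally show ?thesis by (simp add: has_real_derivative_iff_has_vector_derivative)
    qed
    have "(F \<longlongrightarrow> (0 - 0) - (0 - 0) / y) at_top"
      unfolding F_def
      by (intro tendsto_intros t1.tail_tendsto_0 t3.tail_tendsto_0 tendsto_id_mult_tail2 tendsto_ln_mult_tail2) (use y in auto)
    thus "(F \<longlongrightarrow> 0) at_top" by simp
  qed
  thus ?B unfolding R2_conv_tail[OF y] F_def using y by (simp add: algebra_simps diff_divide_distrib)
qed

text \<open>Under t = m u the weight 1/t - 1/(m x) and dt scale reciprocally, so each R2 (m x)
  becomes an integral over the same half-line with the same weight, and only R1 (m u) depends on m.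
  A bound of order 1 / (m^2 u^2) permits summation under the integral.\<close>

lemma S2_conv_integral:
  assumes x: "x > 0"
  shows "S2 x = (LINT t:{x..}|lborel. (1 / t - 1 / x) * S1 t)"
proof -
  let ?g = "\<lambda>k u. indicator {x..} u *\<^sub>R ((1 / u - 1 / x) * R1 (real (Suc k) * u))"
  have bd: "\<bar>(1 / t - 1 / x) * R1 (real (Suc k) * t)\<bar> \<le> 1 / (4 * x) / (real (Suc k))\<^sup>2 / t\<^sup>2" if t: "t \<ge> x" for t k
  proof -
    have "\<bar>1 / t - 1 / x\<bar> \<le> 1 / x" using t x frac_le[of 1 1 x t] by auto
    hence "\<bar>1 / t - 1 / x\<bar> * \<bar>R1 (real (Suc k) * t)\<bar> \<le> 1 / x * (1 / (4 * t\<^sup>2) / (real (Suc k))\<^sup>2)"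
      using t x by (intro mult_mono abs_R1_scaled_le) auto
    thus ?thesis by (simp add: abs_mult mult_ac)
  qed
  have gi: "integrable lborel (?g k)" for k
    using set_integrable_bounded_by_inverse_square[of "\<lambda>t. (1 / t - 1 / x) * R1 (real (Suc k) * t)", OF _ x bd]
    by (simp add: set_integrable_def)
  have R2k: "R2 (real (Suc k) * x) = (\<integral>u. ?g k u \<partial>lborel)" for k
  proof -
    define m where "m = real (Suc k)"
    have m: "m > 0" by (simp add: m_def)
    have "R2 (m * x) = (\<integral>t. indicator {m * x..} t *\<^sub>R ((1 / t - 1 / (m * x)) * R1 t) \<partial>lborel)"
      using R2_conv_integral(2)[of "m * x"] m x by (simp add: set_lebesgue_integral_def)
    also have "\<dots> = \<bar>m\<bar> *\<^sub>R (\<integral>u. indicator {m * x..} (0 + m * u) *\<^sub>R ((1 / (0 + m * u) - 1 / (m * x)) * R1 (0 + m * u)) \<partial>lborel)"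
      by (rule lborel_integral_real_affine) (use m in auto)
    also have "\<dots> = (\<integral>u. m * (indicator {m * x..} (0 + m * u) *\<^sub>R ((1 / (0 + m * u) - 1 / (m * x)) * R1 (0 + m * u))) \<partial>lborel)"
      using m by simp
    also have "\<dots> = (\<integral>u. indicator {x..} u *\<^sub>R ((1 / u - 1 / x) * R1 (m * u)) \<partial>lborel)"
    proof (rule Bochner_Integration.integral_cong[OF refl])
      fix u
      have a: "m * (1 / (m * u) - 1 / (m * x)) = 1 / u - 1 / x"
        using m by (simp add: right_diff_distrib)
      have b: "indicat_real {m * x..} (m * u) = indicator {x..} u" using m by (auto split: split_indicator)
      have c: "m * (I *\<^sub>R (D * E)) = I *\<^sub>R ((m * D) * E)" for I D E :: real
        by (simp only: real_scaleR_def mult_ac)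
      show "m * (indicator {m * x..} (0 + m * u) *\<^sub>R ((1 / (0 + m * u) - 1 / (m * x)) * R1 (0 + m * u)))
         = indicator {x..} u *\<^sub>R ((1 / u - 1 / x) * R1 (m * u))"
        unfolding add_0 c a b ..
    qed
    finally show ?thesis by (simp add: m_def)
  qed
  have "(\<lambda>k. \<integral>u. ?g k u \<partial>lborel) sums (\<integral>u. (\<Sum>k. ?g k u) \<partial>lborel)"
  proof (rule sums_integral[OF gi])
    have sm: "summable (\<lambda>k. norm (?g k u))" for u
    proof (rule summable_comparison_test'[OF summable_inverse_Suc_square[of "1 / (4 * x) / u\<^sup>2"]])
      fix k
      show "norm (norm (?g k u)) \<le> 1 / (4 * x) / u\<^sup>2 / (real (Suc k))\<^sup>2"
        using bd[of u k] x by (cases "u \<ge> x") (simp_all add: mult_ac)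
    qed
    show "AE u in lborel. summable (\<lambda>k. norm (?g k u))" using sm by simp
    show "summable (\<lambda>k. \<integral>u. norm (?g k u) \<partial>lborel)"
    proof (rule summable_comparison_test'[OF summable_inverse_Suc_square[of "1 / (4 * x) * (1 / x)"]])
      fix k
      have "(\<integral>u. norm (?g k u) \<partial>lborel) \<le> (\<integral>u. indicator {x..} u *\<^sub>R (1 / (4 * x) / (real (Suc k))\<^sup>2 * (1 / u\<^sup>2)) \<partial>lborel)"
      proof (rule integral_mono)
        show "integrable lborel (\<lambda>u. norm (?g k u))" using gi by (rule integrable_norm)
        show "integrable lborel (\<lambda>u. indicator {x..} u *\<^sub>R (1 / (4 * x) / (real (Suc k))\<^sup>2 * (1 / u\<^sup>2)))"
          using set_integrable_mult_right[OF integral_inverse_square(1)[OF x], of "1 / (4 * x) / (real (Suc k))\<^sup>2"]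
          by (simp add: set_integrable_def)
        show "norm (?g k u) \<le> indicator {x..} u *\<^sub>R (1 / (4 * x) / (real (Suc k))\<^sup>2 * (1 / u\<^sup>2))" for u
          using bd[of u k] by (cases "u \<ge> x") simp_all
      qed
      also have "\<dots> = (LINT u:{x..}|lborel. 1 / (4 * x) / (real (Suc k))\<^sup>2 * (1 / u\<^sup>2))"
        by (simp only: set_lebesgue_integral_def)
      also have "\<dots> = 1 / (4 * x) / (real (Suc k))\<^sup>2 * (LINT u:{x..}|lborel. 1 / u\<^sup>2)"
        by (rule set_integral_mult_right)
      also have "\<dots> = 1 / (4 * x) / (real (Suc k))\<^sup>2 * (1 / x)"
        unfolding integral_inverse_square(2)[OF x] ..
      also have "\<dots> = 1 / (4 * x) * (1 / x) / (real (Suc k))\<^sup>2"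
        by (simp only: times_divide_eq_right times_divide_eq_left mult_1_left mult_1_right divide_divide_eq_left mult_ac)
      finally show "norm (\<integral>u. norm (?g k u) \<partial>lborel) \<le> 1 / (4 * x) * (1 / x) / (real (Suc k))\<^sup>2"
        unfolding real_norm_def[of "integral\<^sup>L lborel _"] by (subst abs_of_nonneg) auto
    qed
  qed
  hence "S2 x = (\<integral>u. (\<Sum>k. ?g k u) \<partial>lborel)"
    unfolding S2_def R2k by (rule sums_unique[symmetric])
  also have "\<dots> = (\<integral>u. indicator {x..} u *\<^sub>R ((1 / u - 1 / x) * S1 u) \<partial>lborel)"
  proof (rule Bochner_Integration.integral_cong[OF refl])
    fix u
    show "(\<Sum>k. ?g k u) = indicator {x..} u *\<^sub>R ((1 / u - 1 / x) * S1 u)"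
    proof (cases "u \<ge> x")
      case True
      have "(\<Sum>k. (1 / u - 1 / x) * R1 (real (Suc k) * u)) = (1 / u - 1 / x) * S1 u"
        unfolding S1_def by (rule suminf_mult[OF summable_R1_scaled]) (use True x in auto)
      thus ?thesis using True by simp
    qed simp
  qed
  finally show ?thesis by (simp add: set_lebesgue_integral_def)
qed

lemma abs_S1_le: "y > 0 \<Longrightarrow> \<bar>S1 y\<bar> \<le> (\<Sum>k. 1 / (4 * (real (Suc k))\<^sup>2)) / y\<^sup>2"
proof -
  assume y: "y > 0"
  have s: "summable (\<lambda>k. 1 / 4 / (real (Suc k))\<^sup>2)" by (rule summable_inverse_Suc_square)
  have le: "norm (R1 (real (Suc k) * y)) \<le> 1 / y\<^sup>2 * (1 / (4 * (real (Suc k))\<^sup>2))" for k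
    using abs_R1_scaled_le[OF y, of k] by simp
  have s': "summable (\<lambda>k. 1 / y\<^sup>2 * (1 / (4 * (real (Suc k))\<^sup>2)))"
    by (rule summable_mult) (use s in simp)
  have "\<bar>S1 y\<bar> \<le> (\<Sum>k. norm (R1 (real (Suc k) * y)))"
    unfolding S1_def real_norm_def[symmetric]
    by (rule summable_norm, rule summable_comparison_test'[OF s']) (use le in auto)
  also have "\<dots> \<le> (\<Sum>k. 1 / y\<^sup>2 * (1 / (4 * (real (Suc k))\<^sup>2)))"
    by (rule suminf_le[OF le _ s'], rule summable_comparison_test'[OF s']) (use le in auto)
  also have "\<dots> = 1 / y\<^sup>2 * (\<Sum>k. 1 / (4 * (real (Suc k))\<^sup>2))"
    by (rule suminf_mult) (use s in simp)
  finally show ?thesis by simp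
qed

section \<open>Asymptotics of the logarithmic primitive of the Vasyunin function\<close>

definition vasyunin_prim :: "real \<Rightarrow> real" where
  "vasyunin_prim X = (LINT t:{0<..X}|lborel. vasyunin t / t)"

lemma frac_prim_nonneg:
  assumes "t \<ge> 0"
  shows "frac_prim t \<ge> 0"
  using has_integral_nonneg[OF has_integral_frac_over[of 1 t]] assms by (simp add: frac_ge_0)

lemma frac_prim_measurable [measurable]: "frac_prim \<in> borel_measurable borel"
proof -
  have "(\<lambda>x. indicator {0..} x *\<^sub>R frac_prim x) \<in> borel_measurable borel"
    by (rule borel_measurable_continuous_on_indicator[OF _ continuous_on_frac_prim]) auto
  also have "(\<lambda>x. indicator {0..} x *\<^sub>R frac_prim x) = frac_prim"
    by (auto simp: fun_eq_iff frac_prim_def split: split_indicator)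
  finally show ?thesis .
qed

text \<open>Since frac = saw + 1/2, each integral is a tail at 1 plus an elementary part: they are
  1/2 + \<open>tail2 1\<close> and 1/2 + \<open>tail3 1\<close>.\<close>

lemma frac_integrals:
  "set_integrable lborel {1..} (\<lambda>w::real. frac w / w\<^sup>2)"
  "(LINT w:{1..}|lborel. frac w / w\<^sup>2) = 1 - \<gamma>0"
  "set_integrable lborel {1..} (\<lambda>w::real. frac w * ln w / w\<^sup>2)"
  "(LINT w:{1..}|lborel. frac w * ln w / w\<^sup>2) = 1 - \<gamma>0 - \<gamma>1"
proof -
  show i1: "set_integrable lborel {1..} (\<lambda>w::real. frac w / w\<^sup>2)"
  proof (rule set_integrable_bounded_by_inverse_square[where B = 1])
    show "\<bar>frac t / t\<^sup>2\<bar> \<le> 1 / t\<^sup>2" for t :: real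
      using divide_right_mono[OF abs_frac_le[of t], of "t\<^sup>2"] by simp
  qed auto
  show i2: "set_integrable lborel {1..} (\<lambda>w::real. frac w * ln w / w\<^sup>2)"
    unfolding set_integrable_def
  proof (rule Bochner_Integration.integrable_bound[OF integrable_ln_over_square(1)[OF zero_less_one, unfolded set_integrable_def]])
    show "AE x in lborel. norm (indicator {1..} x *\<^sub>R (frac x * ln x / x\<^sup>2)) \<le> norm (indicator {1..} x *\<^sub>R (ln x / (x::real)\<^sup>2))"
    proof (intro AE_I2)
      fix x :: real
      have "\<bar>frac x\<bar> * \<bar>ln x / x\<^sup>2\<bar> \<le> 1 * \<bar>ln x / x\<^sup>2\<bar>" by (intro mult_right_mono abs_frac_le) auto
      thus "norm (indicator {1..} x *\<^sub>R (frac x * ln x / x\<^sup>2)) \<le> norm (indicator {1..} x *\<^sub>R (ln x / x\<^sup>2))"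
        by (auto simp: abs_mult split: split_indicator)
    qed
  qed auto
  have "(LINT w:{1..}|lborel. frac w / w\<^sup>2) = 0 - frac_prim2 1"
  proof (rule set_integral_FTC_at_top[where X = \<int>, OF finite_Ints_inter_Icc i1])
    show "continuous_on {1..} frac_prim2"
      by (intro continuous_at_imp_continuous_on ballI isCont_frac_prim2) auto
    show "(frac_prim2 has_vector_derivative frac t / t\<^sup>2) (at t)" if "1 < t" "t \<notin> \<int>" for t
      using frac_prim2_has_derivative[of t] that by (simp add: has_real_derivative_iff_has_vector_derivative)
    have "(frac_prim2 \<longlongrightarrow> - 0 - 0) at_top"
      unfolding frac_prim2_def [abs_def]
    proof (intro tendsto_diff tendsto_minus t2.tail_tendsto_0)
      show "((\<lambda>t::real. 1 / (2 * t)) \<longlongrightarrow> 0) at_top" by real_asymp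
    qed
    thus "(frac_prim2 \<longlongrightarrow> 0) at_top" by simp
  qed
  moreover have "tail2 1 = - 2 * ppar_moment 3"
    unfolding ppar_moment_def set_integral_mult_right[symmetric] by (simp add: saw_tail_def mult.commute)
  ultimately show "(LINT w:{1..}|lborel. frac w / w\<^sup>2) = 1 - \<gamma>0"
    by (simp add: frac_prim2_def stieltjes_0_1(1))
  have "(LINT w:{1..}|lborel. frac w * ln w / w\<^sup>2) = 0 - (- tail3 1 - (1 + ln 1) / (2 * 1))"
  proof (rule set_integral_FTC_at_top[where X = \<int> and F = "\<lambda>t. - tail3 t - (1 + ln t) / (2 * t)", OF finite_Ints_inter_Icc i2])
    show "continuous_on {1..} (\<lambda>t. - tail3 t - (1 + ln t) / (2 * t))"
      by (intro continuous_intros continuous_at_imp_continuous_on ballI t3.isCont_tail) auto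
    show "((\<lambda>t. - tail3 t - (1 + ln t) / (2 * t)) has_vector_derivative frac t * ln t / t\<^sup>2) (at t)" if "1 < t" "t \<notin> \<int>" for t
    proof -
      have t: "t > 0" using that by simp
      have "((\<lambda>t. - tail3 t - (1 + ln t) / (2 * t)) has_real_derivative - (- (saw t * (ln t / t\<^sup>2))) - (- ln t / (2 * t\<^sup>2))) (at t)"
        by (intro DERIV_diff DERIV_minus t3.tail_has_derivative t that)
           (use t in \<open>auto intro!: derivative_eq_intros simp: power2_eq_square field_simps\<close>)
      also have "- (- (saw t * (ln t / t\<^sup>2))) - (- ln t / (2 * t\<^sup>2)) = frac t * ln t / t\<^sup>2"
        using t by (simp add: saw_def field_simps)
      finally show ?thesis by (simp add: has_real_derivative_iff_has_vector_derivative)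
    qed
    have "((\<lambda>t. - tail3 t - (1 + ln t) / (2 * t)) \<longlongrightarrow> - 0 - 0) at_top"
    proof (intro tendsto_diff tendsto_minus t3.tail_tendsto_0)
      show "((\<lambda>t::real. (1 + ln t) / (2 * t)) \<longlongrightarrow> 0) at_top" by real_asymp
    qed
    thus "((\<lambda>t. - tail3 t - (1 + ln t) / (2 * t)) \<longlongrightarrow> 0) at_top" by simp
  qed
  thus "(LINT w:{1..}|lborel. frac w * ln w / w\<^sup>2) = 1 - \<gamma>0 - \<gamma>1"
    unfolding tail3_1 by simp
qed

lemma vasyunin_nonneg: "vasyunin x \<ge> 0"
  unfolding vasyunin_def set_lebesgue_integral_def
  by (intro integral_nonneg_AE AE_I2) (auto simp: frac_ge_0 split: split_indicator)

lemma vasyunin_measurable [measurable]: "vasyunin \<in> borel_measurable borel"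
proof -
  have "(\<lambda>x::real. \<integral>w. indicator {0<..} w *\<^sub>R (frac w * frac (x * w) / w\<^sup>2) \<partial>(lborel :: real measure)) \<in> borel_measurable borel"
    by measurable
  thus ?thesis unfolding vasyunin_def [abs_def] set_lebesgue_integral_def .
qed

lemma nn_integral_vasyunin:
  assumes x: "x > 0"
  shows "(\<integral>\<^sup>+w. ennreal (indicator {0<..} w * (frac w * frac (x * w) / w\<^sup>2)) \<partial>lborel) = ennreal (vasyunin x)"
proof -
  have "set_integrable lborel {0<..} (\<lambda>w. frac w * frac (x * w) / w\<^sup>2)"
    by (rule set_integrable_subset[OF vasyunin_conv_S1(1)[OF x]]) auto
  from nn_integral_eq_integral[OF this[unfolded set_integrable_def]]
  show ?thesis by (simp add: vasyunin_def set_lebesgue_integral_def frac_ge_0)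
qed

lemma nn_integral_frac_over:
  assumes c: "c > 0" and x: "x \<ge> 0"
  shows "(\<integral>\<^sup>+t. ennreal (indicator {0<..x} t * (frac (c * t) / t)) \<partial>lborel) = ennreal (frac_prim (c * x))"
proof -
  have "(\<integral>\<^sup>+t. ennreal (indicator {0..x} t * (frac (c * t) / t)) \<partial>lborel) = ennreal (frac_prim (c * x))"
    by (rule nn_integral_has_integral_lebesgue[OF _ has_integral_frac_over[OF c x]]) (simp add: frac_ge_0)
  moreover have "(\<integral>\<^sup>+t. ennreal (indicator {0..x} t * (frac (c * t) / t)) \<partial>lborel) = (\<integral>\<^sup>+t. ennreal (indicator {0<..x} t * (frac (c * t) / t)) \<partial>lborel)"
    by (intro nn_integral_cong) (auto split: split_indicator)
  ultimately show ?thesis by simp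
qed

text \<open>Integrating over the parameter first leaves frac (w t) / t, whose integral up to X is
  frac_prim (w X). The exchange takes place in the extended reals, so that integrability of vasyunin
  t / t near 0 comes out once the right-hand side is evaluated.\<close>

lemma nn_integral_vasyunin_prim:
  assumes X: "X > 0"
  shows "(\<integral>\<^sup>+t. ennreal (indicator {0<..X} t * (vasyunin t / t)) \<partial>lborel)
     = (\<integral>\<^sup>+w. ennreal (indicator {0<..} w * (frac w / w\<^sup>2 * frac_prim (w * X))) \<partial>lborel)"
proof -
  have "(\<integral>\<^sup>+t. ennreal (indicator {0<..X} t * (vasyunin t / t)) \<partial>lborel)
     = (\<integral>\<^sup>+t. (\<integral>\<^sup>+w. ennreal (indicator {0<..X} t / t) * ennreal (indicator {0<..} w * (frac w * frac (t * w) / w\<^sup>2)) \<partial>lborel) \<partial>lborel)"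
  proof (rule nn_integral_cong)
    fix t :: real
    have "(\<integral>\<^sup>+w. ennreal (indicator {0<..X} t / t) * ennreal (indicator {0<..} w * (frac w * frac (t * w) / w\<^sup>2)) \<partial>lborel)
      = ennreal (indicator {0<..X} t / t) * (\<integral>\<^sup>+w. ennreal (indicator {0<..} w * (frac w * frac (t * w) / w\<^sup>2)) \<partial>lborel)"
      by (rule nn_integral_cmult) auto
    also have "\<dots> = ennreal (indicator {0<..X} t * (vasyunin t / t))"
    proof (cases "t > 0 \<and> t \<le> X")
      case True
      thus ?thesis by (subst nn_integral_vasyunin) (simp_all add: ennreal_mult'[symmetric])
    qed auto
    finally show "ennreal (indicator {0<..X} t * (vasyunin t / t)) = (\<integral>\<^sup>+w. ennreal (indicator {0<..X} t / t) * ennreal (indicator {0<..} w * (frac w * frac (t * w) / w\<^sup>2)) \<partial>lborel)" ..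
  qed
  also have "\<dots> = (\<integral>\<^sup>+w. (\<integral>\<^sup>+t. ennreal (indicator {0<..X} t / t) * ennreal (indicator {0<..} w * (frac w * frac (t * w) / w\<^sup>2)) \<partial>lborel) \<partial>lborel)"
    by (rule lborel_pair.Fubini') measurable
  also have "\<dots> = (\<integral>\<^sup>+w. ennreal (indicator {0<..} w * (frac w / w\<^sup>2 * frac_prim (w * X))) \<partial>lborel)"
  proof (rule nn_integral_cong)
    fix w :: real
    show "(\<integral>\<^sup>+t. ennreal (indicator {0<..X} t / t) * ennreal (indicator {0<..} w * (frac w * frac (t * w) / w\<^sup>2)) \<partial>lborel)
       = ennreal (indicator {0<..} w * (frac w / w\<^sup>2 * frac_prim (w * X)))"
    proof (cases "w > 0")
      case True
      have "(\<integral>\<^sup>+t. ennreal (indicator {0<..X} t / t) * ennreal (indicator {0<..} w * (frac w * frac (t * w) / w\<^sup>2)) \<partial>lborel)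
         = (\<integral>\<^sup>+t. ennreal (frac w / w\<^sup>2) * ennreal (indicator {0<..X} t * (frac (w * t) / t)) \<partial>lborel)"
        using True by (intro nn_integral_cong)
          (auto simp: ennreal_mult'[symmetric] frac_ge_0 mult_ac split: split_indicator)
      also have "\<dots> = ennreal (frac w / w\<^sup>2) * ennreal (frac_prim (w * X))"
        unfolding nn_integral_frac_over[OF True less_imp_le[OF X], symmetric] by (rule nn_integral_cmult) auto
      finally show ?thesis using True by (simp add: ennreal_mult'[symmetric] frac_ge_0)
    qed auto
  qed
  finally show ?thesis .
qed

lemma S1_integrable:
  assumes c: "c > 0"
  shows "set_integrable lborel {c..} S1" "set_integrable lborel {c..} (\<lambda>t. S1 t / t)"
    "S2 c = (LINT t:{c..}|lborel. S1 t / t) - (LINT t:{c..}|lborel. S1 t) / c"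
proof -
  define B where "B = (\<Sum>k. 1 / (4 * (real (Suc k))\<^sup>2))"
  have b: "\<bar>S1 t\<bar> \<le> B / t\<^sup>2" if "t \<ge> c" for t using abs_S1_le[of t] that c by (simp add: B_def)
  show i1: "set_integrable lborel {c..} S1"
    by (rule set_integrable_bounded_by_inverse_square[OF _ c b]) auto
  show i2: "set_integrable lborel {c..} (\<lambda>t. S1 t / t)"
  proof (rule set_integrable_bounded_by_inverse_square[where B = "B / c"])
    fix t assume t: "t \<ge> c"
    have "\<bar>S1 t\<bar> / t \<le> B / t\<^sup>2 / c"
      by (rule frac_le) (use b[OF t] order_trans[OF abs_ge_zero b[OF t]] t c in auto)
    thus "\<bar>S1 t / t\<bar> \<le> B / c / t\<^sup>2" using t c by (simp add: mult_ac)
  qed (use c in auto)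
  have "S2 c = (LINT t:{c..}|lborel. S1 t / t - 1 / c * S1 t)"
    unfolding S2_conv_integral[OF c] by (simp add: left_diff_distrib)
  also have "\<dots> = (LINT t:{c..}|lborel. S1 t / t) - (LINT t:{c..}|lborel. 1 / c * S1 t)"
    by (intro set_integral_diff(2) i2 set_integrable_mult_right i1)
  also have "(LINT t:{c..}|lborel. 1 / c * S1 t) = 1 / c * (LINT t:{c..}|lborel. S1 t)"
    by (rule set_integral_mult_right)
  finally show "S2 c = (LINT t:{c..}|lborel. S1 t / t) - (LINT t:{c..}|lborel. S1 t) / c" by simp
qed

lemma set_integrable_vasyunin_over:
  assumes c: "c > 0"
  shows "set_integrable lborel {c..} (\<lambda>t. vasyunin t / t\<^sup>2)"
    "(LINT t:{c..}|lborel. vasyunin t / t\<^sup>2) = (LINT t:{c..}|lborel. S1 t / t) + (K + (1 + ln c) / 2) / c"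
proof -
  note i1 = S1_integrable(2)[OF c]
  have i2: "set_integrable lborel {c..} (\<lambda>t. K * (1 / t\<^sup>2) + 1/2 * (ln t / t\<^sup>2))"
    by (intro set_integral_add(1) set_integrable_mult_right integral_inverse_square integrable_ln_over_square c)
  have eq: "vasyunin t / t\<^sup>2 = S1 t / t + (K * (1 / t\<^sup>2) + 1/2 * (ln t / t\<^sup>2))" if "t \<in> {c..}" for t
    unfolding vasyunin_conv_S1(2)[OF less_le_trans[OF c that[unfolded atLeast_iff]]]
    using that c by (simp add: add_divide_distrib power2_eq_square)
  have i3: "set_integrable lborel {c..} (\<lambda>t. S1 t / t + (K * (1 / t\<^sup>2) + 1/2 * (ln t / t\<^sup>2)))"
    by (rule set_integral_add(1)[OF i1 i2])
  show "set_integrable lborel {c..} (\<lambda>t. vasyunin t / t\<^sup>2)"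
    by (rule set_integrable_cong[THEN iffD1, OF refl refl _ i3]) (use eq in auto)
  have "(LINT t:{c..}|lborel. vasyunin t / t\<^sup>2) = (LINT t:{c..}|lborel. S1 t / t + (K * (1 / t\<^sup>2) + 1/2 * (ln t / t\<^sup>2)))"
    by (rule set_lebesgue_integral_cong) (use eq in auto)
  also have "\<dots> = (LINT t:{c..}|lborel. S1 t / t) + (LINT t:{c..}|lborel. K * (1 / t\<^sup>2) + 1/2 * (ln t / t\<^sup>2))"
    by (rule set_integral_add(2)[OF i1 i2])
  also have "(LINT t:{c..}|lborel. K * (1 / t\<^sup>2) + 1/2 * (ln t / t\<^sup>2))
     = (LINT t:{c..}|lborel. K * (1 / t\<^sup>2)) + (LINT t:{c..}|lborel. 1/2 * (ln t / t\<^sup>2))"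
    by (intro set_integral_add(2) set_integrable_mult_right integral_inverse_square integrable_ln_over_square c)
  also have "(LINT t:{c..}|lborel. K * (1 / t\<^sup>2)) = K * (1 / c)"
    unfolding integral_inverse_square(2)[OF c, symmetric] by (rule set_integral_mult_right)
  also have "(LINT t:{c..}|lborel. 1/2 * (ln t / t\<^sup>2)) = 1/2 * ((1 + ln c) / c)"
    unfolding integrable_ln_over_square(2)[OF c, symmetric] by (rule set_integral_mult_right)
  finally show "(LINT t:{c..}|lborel. vasyunin t / t\<^sup>2) = (LINT t:{c..}|lborel. S1 t / t) + (K + (1 + ln c) / 2) / c"
    by (simp add: add_divide_distrib)
qed

text \<open>An antiderivative of frac_prim u / u for u > 0 off the integers; - tail1 u * ln u +
  tail4 u is the part belonging to - tail1 u / u.\<close>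

definition frac_prim_over_prim :: "real \<Rightarrow> real" where
  "frac_prim_over_prim u = (ln u)\<^sup>2 / 4 + ln (2 * pi) / 2 * ln u - tail1 u * ln u + tail4 u"

text \<open>Up to w = 1 / X the integrand is the constant X, as \<open>frac_prim\<close> is the
  identity on [0, 1]. This stretch contributes the summand 1, and the antiderivative is used only
  from 1 / X on, away from the singularity of the logarithm.\<close>

lemma has_integral_frac_prim_over:
  assumes X: "X \<ge> 1"
  shows "((\<lambda>w. frac_prim (w * X) / w) has_integral 1 + (frac_prim_over_prim X - tail4 1)) {0..1}"
proof -
  have i0: "((\<lambda>w. frac_prim (w * X) / w) has_integral 1) {0..1 / X}"
  proof (rule has_integral_spike_finite)
    show "((\<lambda>w. X) has_integral 1) {0..1 / X}"
      using has_integral_const_real[of X 0 "1 / X"] X by simp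
    show "frac_prim (w * X) / w = X" if "w \<in> {0..1 / X} - {0}" for w
    proof -
      have "w * X \<le> 1" "w > 0" using that X by (auto simp: field_simps)
      thus ?thesis using X by (simp add: frac_prim_le_1)
    qed
  qed auto
  have i1: "((\<lambda>w. frac_prim (w * X) / w) has_integral frac_prim_over_prim (1 * X) - frac_prim_over_prim (1 / X * X)) {1 / X..1}"
  proof (rule fundamental_theorem_of_calculus_interior_strong)
    show "finite ({w. X * w \<in> \<int>} \<inter> {1 / X..1})" by (rule finite_scaled_Ints) (use X in auto)
    show "1 / X \<le> 1" using X by simp
    have c: "isCont frac_prim_over_prim u" if "u > 0" for u
      unfolding frac_prim_over_prim_def [abs_def]
      by (intro continuous_intros t1.isCont_tail t4.isCont_tail) (use that in auto)
    show "continuous_on {1 / X..1} (\<lambda>w. frac_prim_over_prim (w * X))"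
    proof (intro continuous_at_imp_continuous_on ballI)
      fix w assume "w \<in> {1 / X..1}"
      hence w: "w * X > 0" using X by (intro mult_pos_pos less_le_trans[of 0 "1 / X" w]) auto
      show "isCont (\<lambda>w. frac_prim_over_prim (w * X)) w"
        by (rule isCont_o2[where g = frac_prim_over_prim and f = "\<lambda>w. w * X", OF _ c[OF w]]) (auto intro!: continuous_intros)
    qed
    fix w assume w: "w \<in> {1 / X<..<1} - {w. X * w \<in> \<int>} \<inter> {1 / X..1}"
    have w0: "w > 0" using w X by (auto intro: less_trans[of 0 "1 / X" w])
    define u where "u = w * X"
    have u: "u > 0" "u \<notin> \<int>" using w w0 X by (auto simp: u_def mult.commute)
    have l: "(ln has_real_derivative 1 / u) (at u)" using u by (auto intro!: derivative_eq_intros)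
    have "(frac_prim_over_prim has_real_derivative
        2 * ln u * (1 / u) / 4 + ln (2 * pi) / 2 * (1 / u) - (- (saw u * (1 / u)) * ln u + 1 / u * tail1 u) + - (saw u * (ln u / u))) (at u)"
      unfolding frac_prim_over_prim_def [abs_def]
      by (intro DERIV_add DERIV_diff DERIV_cmult DERIV_cdivide DERIV_mult t1.tail_has_derivative t4.tail_has_derivative l u)
         (rule derivative_eq_intros l refl | simp)+
    also have "2 * ln u * (1 / u) / 4 + ln (2 * pi) / 2 * (1 / u) - (- (saw u * (1 / u)) * ln u + 1 / u * tail1 u) + - (saw u * (ln u / u))
       = frac_prim u / u"
      using u by (simp add: frac_prim_def add_divide_distrib diff_divide_distrib)
    finally have "(frac_prim_over_prim has_real_derivative frac_prim u / u) (at u)" .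
    hence "((\<lambda>w. frac_prim_over_prim (w * X)) has_real_derivative frac_prim u / u * X) (at w)"
      unfolding u_def
      by (rule DERIV_chain2[where f = frac_prim_over_prim and g = "\<lambda>w. w * X"]) (auto intro!: derivative_eq_intros)
    thus "((\<lambda>w. frac_prim_over_prim (w * X)) has_vector_derivative frac_prim (w * X) / w) (at w)"
      using X by (simp add: has_real_derivative_iff_has_vector_derivative u_def)
  qed
  have "((\<lambda>w. frac_prim (w * X) / w) has_integral 1 + (frac_prim_over_prim (1 * X) - frac_prim_over_prim (1 / X * X))) {0..1}"
    by (rule has_integral_combine[OF _ _ i0 i1]) (use X in auto)
  moreover have "frac_prim_over_prim (1 / X * X) = tail4 1" using X by (simp add: frac_prim_over_prim_def)
  ultimately show ?thesis by simp
qed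

text \<open>The w-integral is cut at 1. Below, frac w / w^2 is 1 / w and the antiderivative of the
  previous lemma applies. Above, frac_prim (w X) is replaced by its defining expression: ln (w X)
  splits, and only the small term with tail1 (w X) is left unevaluated.\<close>

lemma vasyunin_prim_expansion:
  assumes X: "X \<ge> 1"
  shows "set_integrable lborel {0<..X} (\<lambda>t. vasyunin t / t)"
    and "vasyunin_prim X = 1 + (frac_prim_over_prim X - tail4 1)
      + ((ln X / 2 + ln (2 * pi) / 2) * (1 - \<gamma>0) + (1 - \<gamma>0 - \<gamma>1) / 2
          - (LINT w:{1..}|lborel. frac w / w\<^sup>2 * tail1 (w * X)))"
    and "\<bar>LINT w:{1..}|lborel. frac w / w\<^sup>2 * tail1 (w * X)\<bar> \<le> 1 / (4 * X)"
proof -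
  let ?f = "\<lambda>w. frac w / w\<^sup>2 * frac_prim (w * X)"
  have X0: "X > 0" using X by simp
  have ae: "AE w in lborel. indicator {0<..1} w *\<^sub>R ?f w = indicator {0..1} w *\<^sub>R (frac_prim (w * X) / w)"
    using AE_lborel_singleton[of "0::real"] AE_lborel_singleton[of "1::real"]
  proof eventually_elim
    case (elim w)
    thus ?case by (cases "0 < w \<and> w < 1") (auto simp: frac_eq power2_eq_square)
  qed
  note G = set_integrable_has_integral_nonneg[OF _ _ _ has_integral_frac_prim_over[OF X]]
  have g1: "set_integrable lborel {0..1} (\<lambda>w. frac_prim (w * X) / w)"
    by (rule G(1)) (use X0 in \<open>auto intro!: divide_nonneg_nonneg frac_prim_nonneg\<close>)
  have g2: "(LINT w:{0..1}|lborel. frac_prim (w * X) / w) = 1 + (frac_prim_over_prim X - tail4 1)"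
    by (rule G(2)) (use X0 in \<open>auto intro!: divide_nonneg_nonneg frac_prim_nonneg\<close>)
  have a1: "set_integrable lborel {0<..1} ?f"
    unfolding set_integrable_def
    by (subst integrable_cong_AE[OF _ _ ae]) (use g1 in \<open>auto simp: set_integrable_def\<close>)
  have a2: "(LINT w:{0<..1}|lborel. ?f w) = 1 + (frac_prim_over_prim X - tail4 1)"
    unfolding g2[symmetric] set_lebesgue_integral_def by (rule integral_cong_AE[OF _ _ ae]) auto
  let ?c = "ln X / 2 + ln (2 * pi) / 2"
  have t1m: "set_integrable lborel {1..} (\<lambda>w. frac w / w\<^sup>2 * tail1 (w * X))"
    and t1b: "\<bar>LINT w:{1..}|lborel. frac w / w\<^sup>2 * tail1 (w * X)\<bar> \<le> 1 / (4 * X)"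
  proof -
    have bd: "norm (indicator {1..} w *\<^sub>R (frac w / w\<^sup>2 * tail1 (w * X))) \<le> indicator {1..} w *\<^sub>R (1 / (4 * X) * (1 / w\<^sup>2))" for w :: real
    proof (cases "w \<ge> 1")
      case True
      have "\<bar>tail1 (w * X)\<bar> \<le> 1 / (4 * (w * X))" by (rule tail1_bound) (use True X in auto)
      also have "\<dots> \<le> 1 / (4 * X)" by (rule divide_left_mono) (use True X in auto)
      finally have "\<bar>frac w\<bar> * \<bar>tail1 (w * X)\<bar> \<le> 1 * (1 / (4 * X))" by (intro mult_mono abs_frac_le) auto
      hence "\<bar>frac w\<bar> * \<bar>tail1 (w * X)\<bar> / w\<^sup>2 \<le> 1 * (1 / (4 * X)) / w\<^sup>2" by (rule divide_right_mono) simp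
      thus ?thesis using True by (simp add: abs_mult)
    qed auto
    have bi: "integrable lborel (\<lambda>w. indicator {1..} w *\<^sub>R (1 / (4 * X) * (1 / w\<^sup>2)))"
      using set_integrable_mult_right[OF integral_inverse_square(1)[OF zero_less_one], of "1 / (4 * X)"] by (simp add: set_integrable_def)
    \<comment> \<open>Measurability of \<open>tail1\<close> on the positive axis is read off from
      that of \<open>frac_prim\<close>.\<close>
    have "(\<lambda>w. indicator {0<..} (w * X) *\<^sub>R (ln (w * X) / 2 + ln (2 * pi) / 2 - frac_prim (w * X))) \<in> borel_measurable borel"
      by measurable
    also have "(\<lambda>w. indicator {0<..} (w * X) *\<^sub>R (ln (w * X) / 2 + ln (2 * pi) / 2 - frac_prim (w * X)))
       = (\<lambda>w. indicator {0<..} (w * X) *\<^sub>R tail1 (w * X))"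
      by (auto simp: fun_eq_iff frac_prim_def split: split_indicator)
    finally have "(\<lambda>w. indicator {1..} w *\<^sub>R (frac w / w\<^sup>2 * (indicator {0<..} (w * X) *\<^sub>R tail1 (w * X)))) \<in> borel_measurable borel"
      by measurable
    also have "(\<lambda>w. indicator {1..} w *\<^sub>R (frac w / w\<^sup>2 * (indicator {0<..} (w * X) *\<^sub>R tail1 (w * X))))
       = (\<lambda>w. indicator {1..} w *\<^sub>R (frac w / w\<^sup>2 * tail1 (w * X)))"
      using X by (auto simp: fun_eq_iff zero_less_mult_iff split: split_indicator)
    finally have m: "(\<lambda>w. indicator {1..} w *\<^sub>R (frac w / w\<^sup>2 * tail1 (w * X))) \<in> borel_measurable lborel" by simp
    have i: "integrable lborel (\<lambda>w. indicator {1..} w *\<^sub>R (frac w / w\<^sup>2 * tail1 (w * X)))"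
      by (rule Bochner_Integration.integrable_bound[OF bi m]) (use bd order_trans[OF _ abs_ge_self] in fastforce)
    thus "set_integrable lborel {1..} (\<lambda>w. frac w / w\<^sup>2 * tail1 (w * X))" by (simp add: set_integrable_def)
    have "norm (LINT w:{1..}|lborel. frac w / w\<^sup>2 * tail1 (w * X)) \<le> (\<integral>w. indicator {1..} w *\<^sub>R (1 / (4 * X) * (1 / w\<^sup>2)) \<partial>lborel)"
      unfolding set_lebesgue_integral_def by (rule Bochner_Integration.integral_norm_bound_integral[OF i bi bd])
    also have "\<dots> = (LINT w:{1..}|lborel. 1 / (4 * X) * (1 / w\<^sup>2))" by (simp only: set_lebesgue_integral_def)
    also have "\<dots> = 1 / (4 * X) * (1 / 1)"
      unfolding integral_inverse_square(2)[OF zero_less_one, symmetric] by (rule set_integral_mult_right)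
    finally show "\<bar>LINT w:{1..}|lborel. frac w / w\<^sup>2 * tail1 (w * X)\<bar> \<le> 1 / (4 * X)" by simp
  qed
  show "\<bar>LINT w:{1..}|lborel. frac w / w\<^sup>2 * tail1 (w * X)\<bar> \<le> 1 / (4 * X)" by (rule t1b)
  have feq: "?f w = (?c * (frac w / w\<^sup>2) + 1/2 * (frac w * ln w / w\<^sup>2)) - frac w / w\<^sup>2 * tail1 (w * X)" if "w \<in> {1..}" for w
  proof -
    have w: "w > 0" "\<not> w * X \<le> 0" using that X by (auto simp: not_le)
    have l: "ln (w * X) = ln w + ln X" using w X0 by (intro ln_mult_pos) auto
    have "a * ((p + q) / 2 + r / 2 - t) = ((q / 2 + r / 2) * a + 1/2 * (a * p)) - a * t" for a p q r t :: real
      by (simp add: algebra_simps add_divide_distrib)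
    thus ?thesis unfolding frac_prim_def using w(2) by (simp only: l if_False times_divide_eq_left)
  qed
  have j: "set_integrable lborel {1..} (\<lambda>w. ?c * (frac w / w\<^sup>2) + 1/2 * (frac w * ln w / w\<^sup>2))"
    by (intro set_integral_add(1) set_integrable_mult_right frac_integrals)
  have b1: "set_integrable lborel {1..} ?f"
    by (rule set_integrable_cong[THEN iffD1, OF refl refl _ set_integral_diff(1)[OF j t1m]]) (use feq in auto)
  have "(LINT w:{1..}|lborel. ?f w) = (LINT w:{1..}|lborel. (?c * (frac w / w\<^sup>2) + 1/2 * (frac w * ln w / w\<^sup>2)) - frac w / w\<^sup>2 * tail1 (w * X))"
    by (rule set_lebesgue_integral_cong) (use feq in auto)
  also have "\<dots> = (LINT w:{1..}|lborel. ?c * (frac w / w\<^sup>2) + 1/2 * (frac w * ln w / w\<^sup>2)) - (LINT w:{1..}|lborel. frac w / w\<^sup>2 * tail1 (w * X))"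
    by (rule set_integral_diff(2)[OF j t1m])
  also have "(LINT w:{1..}|lborel. ?c * (frac w / w\<^sup>2) + 1/2 * (frac w * ln w / w\<^sup>2))
     = (LINT w:{1..}|lborel. ?c * (frac w / w\<^sup>2)) + (LINT w:{1..}|lborel. 1/2 * (frac w * ln w / w\<^sup>2))"
    by (intro set_integral_add(2) set_integrable_mult_right frac_integrals)
  also have "(LINT w:{1..}|lborel. ?c * (frac w / w\<^sup>2)) = ?c * (1 - \<gamma>0)"
    unfolding frac_integrals(2)[symmetric] by (rule set_integral_mult_right)
  also have "(LINT w:{1..}|lborel. 1/2 * (frac w * ln w / w\<^sup>2)) = 1/2 * (1 - \<gamma>0 - \<gamma>1)"
    unfolding frac_integrals(4)[symmetric] by (rule set_integral_mult_right)
  finally have b2: "(LINT w:{1..}|lborel. ?f w) = ?c * (1 - \<gamma>0) + 1/2 * (1 - \<gamma>0 - \<gamma>1) - (LINT w:{1..}|lborel. frac w / w\<^sup>2 * tail1 (w * X))" .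
  have un: "{0<..} = {0<..1} \<union> {1::real..}" by auto
  have f_int: "set_integrable lborel {0<..} ?f" unfolding un by (rule set_integrable_Un[OF a1 b1]) auto
  have "(LINT w:{0<..}|lborel. ?f w) = (LINT w:{0<..1}|lborel. ?f w) + (LINT w:{1..}|lborel. ?f w)"
    unfolding un by (rule set_integral_Un_AE)
      (use a1 b1 AE_lborel_singleton[of "1::real"] in \<open>auto elim!: eventually_mono\<close>)
  note f_val = this[unfolded a2 b2]
  have nn: "0 \<le> indicator {0<..} w * (frac w / w\<^sup>2 * frac_prim (w * X))" for w :: real
    using X0 by (auto simp: frac_ge_0 split: split_indicator intro!: mult_nonneg_nonneg divide_nonneg_nonneg frac_prim_nonneg)
  have "(\<integral>\<^sup>+t. ennreal (indicator {0<..X} t * (vasyunin t / t)) \<partial>lborel)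
     = (\<integral>\<^sup>+w. ennreal (indicator {0<..} w * (frac w / w\<^sup>2 * frac_prim (w * X))) \<partial>lborel)"
    by (rule nn_integral_vasyunin_prim[OF X0])
  also have "\<dots> = ennreal (LINT w:{0<..}|lborel. ?f w)"
    using nn_integral_eq_integral[OF f_int[unfolded set_integrable_def]] nn by (simp add: set_lebesgue_integral_def)
  finally have eq: "(\<integral>\<^sup>+t. ennreal (indicator {0<..X} t * (vasyunin t / t)) \<partial>lborel) = ennreal (LINT w:{0<..}|lborel. ?f w)" .
  have nn': "0 \<le> indicator {0<..X} t * (vasyunin t / t)" for t :: real
    by (auto simp: vasyunin_nonneg split: split_indicator)
  show "set_integrable lborel {0<..X} (\<lambda>t. vasyunin t / t)"
    unfolding set_integrable_def by (rule integrableI_nonneg) (use nn' eq in auto)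
  have "vasyunin_prim X = (LINT w:{0<..}|lborel. ?f w)"
    unfolding vasyunin_prim_def set_lebesgue_integral_def
  proof (rule integral_eq_nn_integral[THEN trans])
    show "enn2real (\<integral>\<^sup>+ x. ennreal (indicat_real {0<..X} x *\<^sub>R (vasyunin x / x)) \<partial>lborel) = (LBINT x. indicat_real {0<..} x *\<^sub>R ?f x)"
      using eq nn by (simp add: set_lebesgue_integral_def integral_nonneg_AE)
  qed (use nn' in auto)
  thus "vasyunin_prim X = 1 + (frac_prim_over_prim X - tail4 1)
      + ((ln X / 2 + ln (2 * pi) / 2) * (1 - \<gamma>0) + (1 - \<gamma>0 - \<gamma>1) / 2
          - (LINT w:{1..}|lborel. frac w / w\<^sup>2 * tail1 (w * X)))"
    unfolding f_val by simp
qed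

text \<open>All tails vanish in the limit and the growing logarithmic terms are those subtracted.
  The remaining constant contains - \<open>tail4 1\<close>, where \<open>tail4 1\<close> is 1 +
  zeta''(0) / 2: this is the origin of pi^2 / 48, of \<gamma>^2 / 4 and of the squared logarithm in
  \<open>K2\<close>.\<close>

lemma vasyunin_prim_tendsto:
  "((\<lambda>X. vasyunin_prim X - K * ln X - (ln X)\<^sup>2 / 4) \<longlongrightarrow> K2 - K - 1/2) at_top"
proof -
  let ?e = "\<lambda>X. LINT w:{1..}|lborel. frac w / w\<^sup>2 * tail1 (w * X)"
  define c where "c = 1 - tail4 1 + ln (2 * pi) / 2 * (1 - \<gamma>0) + (1 - \<gamma>0 - \<gamma>1) / 2"
  have c: "c = K2 - K - 1/2"
  proof -
    have "1 - (1 + (h + g\<^sup>2 / 2 - p / 24 - \<Lambda>\<^sup>2 / 2) / 2) + \<Lambda> / 2 * (1 - g) + (1 - g - h) / 2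
        = ((1 - g / 2) * \<Lambda> + 1/4 * \<Lambda>\<^sup>2 + p / 48 - g\<^sup>2 / 4 - g - h + 3/2) - (\<Lambda> - g + 1) / 2 - 1/2"
      for \<Lambda> g h p :: real
      by (simp add: field_simps)
    thus ?thesis unfolding c_def tail4_1 ppar_moment_2_diff K2_def K_def .
  qed
  have l1: "((\<lambda>X. tail1 X * ln X) \<longlongrightarrow> 0) at_top"
  proof (rule Lim_null_comparison)
    show "eventually (\<lambda>X. norm (tail1 X * ln X) \<le> ln X / (4 * X)) at_top"
      using eventually_ge_at_top[of 1]
    proof eventually_elim
      case (elim X)
      have "\<bar>tail1 X\<bar> * \<bar>ln X\<bar> \<le> 1 / (4 * X) * \<bar>ln X\<bar>" using elim by (intro mult_right_mono tail1_bound) auto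
      thus ?case using elim by (simp add: abs_mult)
    qed
    show "((\<lambda>X::real. ln X / (4 * X)) \<longlongrightarrow> 0) at_top" by real_asymp
  qed
  have l2: "(?e \<longlongrightarrow> 0) at_top"
  proof (rule Lim_null_comparison)
    show "eventually (\<lambda>X. norm (?e X) \<le> 1 / (4 * X)) at_top"
      using eventually_ge_at_top[of 1] by eventually_elim (use vasyunin_prim_expansion(3) in auto)
    show "((\<lambda>X::real. 1 / (4 * X)) \<longlongrightarrow> 0) at_top" by real_asymp
  qed
  have "((\<lambda>X. c - tail1 X * ln X + tail4 X - ?e X) \<longlongrightarrow> c - 0 + 0 - 0) at_top"
    by (intro tendsto_intros l1 l2 t4.tail_tendsto_0)
  moreover have "eventually (\<lambda>X. c - tail1 X * ln X + tail4 X - ?e X = vasyunin_prim X - K * ln X - (ln X)\<^sup>2 / 4) at_top"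
    using eventually_ge_at_top[of 1]
  proof eventually_elim
    case (elim X)
    show ?case
    proof -
      have id: "(1 - T + \<Lambda> / 2 * (1 - g) + (1 - g - h) / 2) - s * l + f - e
        = 1 + ((l\<^sup>2 / 4 + \<Lambda> / 2 * l - s * l + f) - T) + ((l / 2 + \<Lambda> / 2) * (1 - g) + (1 - g - h) / 2 - e)
          - (\<Lambda> - g + 1) / 2 * l - l\<^sup>2 / 4"
        for T \<Lambda> g h s l f e :: real
        by (simp add: field_simps)
      show ?thesis
        unfolding vasyunin_prim_expansion(2)[OF elim] frac_prim_over_prim_def c_def K_def by (rule id)
    qed
  qed
  ultimately have "((\<lambda>X. vasyunin_prim X - K * ln X - (ln X)\<^sup>2 / 4) \<longlongrightarrow> c - 0 + 0 - 0) at_top"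
    by (rule Lim_transform_eventually)
  thus ?thesis by (simp add: c)
qed

lemma vasyunin_over_integrable:
  assumes x: "x > 0"
  shows "set_integrable lborel {0<..x} (\<lambda>t. vasyunin t / t)"
  by (rule set_integrable_subset[OF vasyunin_prim_expansion(1)[of "max 1 x"]]) auto

text \<open>Since vasyunin t / t = S1 t + K / t + ln t / (2 t), the left-hand side minus the
  logarithms on the right does not depend on x; the limit at infinity provides the constant.\<close>

lemma vasyunin_prim_conv_S1:
  assumes x: "x > 0"
  shows "vasyunin_prim x + (LINT t:{x..}|lborel. S1 t) = K2 - K - 1/2 + K * ln x + (ln x)\<^sup>2 / 4"
proof -
  let ?L = "\<lambda>t. K * ln t + (ln t)\<^sup>2 / 4"
  have step: "vasyunin_prim X = vasyunin_prim x + (LINT t:{x..X}|lborel. S1 t) + (?L X - ?L x)" if X: "X \<ge> x" for X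
  proof -
    have X0: "X > 0" using x X by simp
    have iX: "set_integrable lborel {0<..X} (\<lambda>t. vasyunin t / t)" by (rule vasyunin_over_integrable[OF X0])
    have un: "{0<..X} = {0<..x} \<union> {x..X}" using x X by auto
    have "vasyunin_prim X = vasyunin_prim x + (LINT t:{x..X}|lborel. vasyunin t / t)"
      unfolding vasyunin_prim_def un
      by (rule set_integral_Un_AE)
        (use x X AE_lborel_singleton[of x] in \<open>auto elim!: eventually_mono intro: set_integrable_subset[OF iX]\<close>)
    also have "(LINT t:{x..X}|lborel. vasyunin t / t) = (LINT t:{x..X}|lborel. S1 t + (K / t + ln t / (2 * t)))"
    proof (rule set_lebesgue_integral_cong)
      show "\<forall>t. t \<in> {x..X} \<longrightarrow> vasyunin t / t = S1 t + (K / t + ln t / (2 * t))"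
      proof (intro allI impI)
        fix t assume "t \<in> {x..X}"
        hence t: "t > 0" using x by auto
        show "vasyunin t / t = S1 t + (K / t + ln t / (2 * t))"
          unfolding vasyunin_conv_S1(2)[OF t] using t by (simp add: add_divide_distrib)
      qed
    qed simp
    also have "\<dots> = (LINT t:{x..X}|lborel. S1 t) + (LINT t:{x..X}|lborel. K / t + ln t / (2 * t))"
    proof (rule set_integral_add(2))
      show "set_integrable lborel {x..X} S1" by (rule set_integrable_subset[OF S1_integrable(1)[OF x]]) auto
      show "set_integrable lborel {x..X} (\<lambda>t. K / t + ln t / (2 * t))"
        by (rule borel_integrable_atLeastAtMost') (use x in \<open>auto intro!: continuous_intros\<close>)
    qed
    also have "(LINT t:{x..X}|lborel. K / t + ln t / (2 * t)) = ?L X - ?L x"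
    proof (rule set_integral_FTC[where X = "{}" and F = ?L])
      show "set_integrable lborel {x..X} (\<lambda>t. K / t + ln t / (2 * t))"
        by (rule borel_integrable_atLeastAtMost') (use x in \<open>auto intro!: continuous_intros\<close>)
      show "continuous_on {x..X} ?L" using x by (auto intro!: continuous_intros)
      show "(?L has_vector_derivative K / t + ln t / (2 * t)) (at t)" if "x < t" for t
        using x that unfolding has_real_derivative_iff_has_vector_derivative[symmetric]
        by (auto intro!: derivative_eq_intros simp: field_simps)
    qed (use X in auto)
    finally show ?thesis by simp
  qed
  have "((\<lambda>X. vasyunin_prim x + (LINT t:{x..X}|lborel. S1 t) - ?L x) \<longlongrightarrow> vasyunin_prim x + (LINT t:{x..}|lborel. S1 t) - ?L x) at_top"
    by (intro tendsto_intros tendsto_set_lebesgue_integral_at_top[OF _ S1_integrable(1)[OF x]]) auto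
  moreover have "eventually (\<lambda>X. vasyunin_prim x + (LINT t:{x..X}|lborel. S1 t) - ?L x = vasyunin_prim X - K * ln X - (ln X)\<^sup>2 / 4) at_top"
    using eventually_ge_at_top[of x]
  proof eventually_elim
    case (elim X)
    show ?case using step[OF elim] by linarith
  qed
  ultimately have "((\<lambda>X. vasyunin_prim X - K * ln X - (ln X)\<^sup>2 / 4) \<longlongrightarrow> vasyunin_prim x + (LINT t:{x..}|lborel. S1 t) - ?L x) at_top"
    by (rule Lim_transform_eventually)
  from tendsto_unique[OF _ this vasyunin_prim_tendsto] show ?thesis by simp
qed

text \<open>The integral of \<open>S1\<close> from x on occurs with factor -1/x in the first term
  and 1/x in the second, and cancels. The 1/2 by which \<open>K1\<close> exceeds \<open>K\<close>
  comes from the integral of ln t / (2 t^2).\<close>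

theorem vasyunin_second_order:
  assumes x: "x > 0"
  shows "vasyunin_prim x / x + (LINT t:{x..}|lborel. vasyunin t / t\<^sup>2) = S2 x + (K2 + K1 * ln x + (ln x)\<^sup>2 / 4) / x"
proof -
  define I where "I = (LINT t:{x..}|lborel. S1 t)"
  have p: "vasyunin_prim x = K2 - K - 1/2 + K * ln x + (ln x)\<^sup>2 / 4 - I"
    using vasyunin_prim_conv_S1[OF x] by (simp add: I_def)
  have q: "(LINT t:{x..}|lborel. vasyunin t / t\<^sup>2) = (S2 x + I / x) + (K + (1 + ln x) / 2) / x"
    unfolding set_integrable_vasyunin_over(2)[OF x] S1_integrable(3)[OF x] I_def by simp
  have k: "K1 = K + 1/2" by (simp add: K1_def K_def add_divide_distrib)
  have "(K2 - K - 1/2 + K * ln x + (ln x)\<^sup>2 / 4 - I) + I + (K + (1 + ln x) / 2) = K2 + K1 * ln x + (ln x)\<^sup>2 / 4"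
    unfolding k by (simp add: algebra_simps add_divide_distrib)
  hence "(K2 - K - 1/2 + K * ln x + (ln x)\<^sup>2 / 4 - I) / x + I / x + (K + (1 + ln x) / 2) / x = (K2 + K1 * ln x + (ln x)\<^sup>2 / 4) / x"
    by (simp only: add_divide_distrib[symmetric])
  thus ?thesis unfolding p q by simp
qed

section \<open>The line integrals\<close>

definition \<phi> :: "real \<Rightarrow> real" where "\<phi> y = frac (exp y) * exp (- y / 2)"

definition \<Phi> :: "real \<Rightarrow> complex" where "\<Phi> t = (\<integral>y. \<phi> y *\<^sub>R iexp (- (t * y)) \<partial>lborel)"

lemma \<phi>_measurable [measurable]: "\<phi> \<in> borel_measurable borel"
  unfolding \<phi>_def [abs_def] by measurable

lemma \<phi>_twist:
  "\<phi> y *\<^sub>R iexp (- (t * y)) = exp y *\<^sub>R (frac (exp y) *\<^sub>R (complex_of_real (exp y) powr (- Complex (1/2) t - 1)))"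
proof -
  have "complex_of_real (exp y) powr (- Complex (1/2) t - 1) = exp ((- Complex (1/2) t - 1) * complex_of_real y)"
    by (simp add: powr_def Ln_of_real)
  also have "(- Complex (1/2) t - 1) * complex_of_real y = complex_of_real (- y / 2 - y) + \<i> * complex_of_real (- (t * y))"
    by (simp add: complex_eq_iff algebra_simps)
  also have "exp (complex_of_real (- y / 2 - y) + \<i> * complex_of_real (- (t * y))) = of_real (exp (- y / 2 - y)) * iexp (- (t * y))"
    unfolding exp_add exp_of_real ..
  also have "exp (- y / 2 - y) = exp (- y / 2) / exp y" by (rule exp_diff)
  finally show ?thesis by (simp add: \<phi>_def scaleR_conv_of_real)
qed

lemma frac_powr_measurable: "(\<lambda>x. frac x *\<^sub>R (complex_of_real x powr z)) \<in> borel_measurable borel"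
  by measurable

lemma integrable_\<phi>: "integrable lborel \<phi>"
proof -
  have "set_integrable lborel {0<..} (\<lambda>x. frac x *\<^sub>R (complex_of_real x powr (- Complex (1/2) 0 - 1)))"
    by (rule zeta1_strip(1)) auto
  hence "integrable lborel (\<lambda>y. exp y *\<^sub>R (frac (exp y) *\<^sub>R (complex_of_real (exp y) powr (- Complex (1/2) 0 - 1))))"
    by (subst integrable_exp_substitution[OF frac_powr_measurable])
  hence "integrable lborel (\<lambda>y. \<phi> y *\<^sub>R iexp (- (0 * y)))" unfolding \<phi>_twist .
  hence "integrable lborel (\<lambda>y. Re (\<phi> y *\<^sub>R iexp (- (0 * y))))" by (rule integrable_Re)
  thus ?thesis by simp
qed

lemma \<Phi>_eq: "\<Phi> t = - zeta (Complex (1/2) t) / Complex (1/2) t"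
proof -
  let ?s = "Complex (1/2) t"
  have s: "?s \<noteq> 0" "?s \<noteq> 1" by (auto simp: complex_eq_iff)
  have "\<Phi> t = (LINT x:{0<..}|lborel. frac x *\<^sub>R (complex_of_real x powr (- ?s - 1)))"
    unfolding \<Phi>_def \<phi>_twist by (rule integral_exp_substitution[OF frac_powr_measurable])
  moreover have "zeta ?s = - ?s * (LINT x:{0<..}|lborel. frac x *\<^sub>R (complex_of_real x powr (- ?s - 1)))"
    using zeta_eq_zeta1[of ?s] zeta1_strip(2)[of ?s] s by simp
  ultimately show ?thesis using s by simp
qed

lemma \<Phi>_uminus: "\<Phi> (- t) = cnj (\<Phi> t)"
proof -
  have "cnj (\<Phi> t) = (\<integral>y. cnj (\<phi> y *\<^sub>R iexp (- (t * y))) \<partial>lborel)"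
    unfolding \<Phi>_def by (rule Bochner_Integration.integral_cnj[symmetric])
  also have "\<dots> = \<Phi> (- t)"
    unfolding \<Phi>_def by (rule Bochner_Integration.integral_cong[OF refl]) (simp add: scaleR_conv_of_real exp_cnj)
  finally show ?thesis ..
qed

lemma abs_\<phi>_le: "\<bar>\<phi> y\<bar> \<le> 1"
proof (cases "y \<ge> 0")
  case True
  have "\<bar>frac (exp y)\<bar> * exp (- y / 2) \<le> 1 * 1" by (intro mult_mono abs_frac_le) (use True in auto)
  thus ?thesis by (simp add: \<phi>_def abs_mult)
next
  case False
  hence "frac (exp y) = exp y" by (simp add: frac_eq)
  hence "\<phi> y = exp (y / 2)" by (simp add: \<phi>_def exp_add[symmetric])
  thus ?thesis using False by simp
qed

lemma isCont_\<phi>: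
  assumes "y \<notin> ln ` \<int>"
  shows "isCont \<phi> y"
proof -
  have "exp y \<notin> \<int>" using assms by (auto intro: image_eqI[of y ln "exp y"])
  hence "isCont frac (exp y)" using frac_has_derivative DERIV_isCont by blast
  hence "isCont (\<lambda>y. frac (exp y)) y" by (intro isCont_o2[where f = exp and g = frac]) (auto intro!: continuous_intros)
  thus ?thesis unfolding \<phi>_def [abs_def] by (intro continuous_intros) auto
qed

lemma \<phi>_autocorrelation: "(\<integral>y. \<phi> y * \<phi> (y + r) \<partial>lborel) = exp (- r / 2) * vasyunin (exp r)"
proof -
  have "(\<integral>y. \<phi> y * \<phi> (y + r) \<partial>lborel) = (\<integral>y. exp (- r / 2) * (exp y *\<^sub>R (frac (exp y) * frac (exp r * exp y) / (exp y)\<^sup>2)) \<partial>lborel)"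
  proof (rule Bochner_Integration.integral_cong[OF refl])
    fix y
    have "- y / 2 + - (y + r) / 2 = - r / 2 - y" by (simp add: field_simps)
    hence "exp (- y / 2) * exp (- (y + r) / 2) = exp (- r / 2) / exp y"
      by (simp only: exp_add[symmetric] exp_diff[symmetric])
    moreover have "exp (y + r) = exp r * exp y" by (simp add: exp_add)
    moreover have "(a * e1) * (b * e2) = E * (z *\<^sub>R (a * b / z\<^sup>2))" if "e1 * e2 = E / z" "z > 0" for a b e1 e2 E z :: real
    proof -
      have "(a * e1) * (b * e2) = a * b * (e1 * e2)" by simp
      also have "\<dots> = E * (z *\<^sub>R (a * b / z\<^sup>2))" unfolding that(1) using that(2) by (simp add: power2_eq_square)
      finally show ?thesis .
    qed
    ultimately show "\<phi> y * \<phi> (y + r) = exp (- r / 2) * (exp y *\<^sub>R (frac (exp y) * frac (exp r * exp y) / (exp y)\<^sup>2))"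
      unfolding \<phi>_def by simp
  qed
  also have "\<dots> = exp (- r / 2) * (\<integral>y. exp y *\<^sub>R (frac (exp y) * frac (exp r * exp y) / (exp y)\<^sup>2) \<partial>lborel)"
    by (rule integral_mult_right_zero)
  also have "(\<integral>y. exp y *\<^sub>R (frac (exp y) * frac (exp r * exp y) / (exp y)\<^sup>2) \<partial>lborel) = vasyunin (exp r)"
    unfolding vasyunin_def by (rule integral_exp_substitution) measurable
  finally show ?thesis .
qed

text \<open>The discontinuities of \<open>\<phi>\<close> lie at logarithms of integers, a countable
  set. Square integrability of zeta(s) / s on the critical line is thus a by-product of the
  inversion argument.\<close>

lemma \<Phi>_inversion:
  shows "integrable lborel (\<lambda>t. (cmod (\<Phi> t))\<^sup>2)"
    and "(\<integral>t. (cmod (\<Phi> t))\<^sup>2 *\<^sub>R iexp (t * r) \<partial>lborel) = complex_of_real (2 * pi * (exp (- r / 2) * vasyunin (exp r)))"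
proof -
  have A: "countable (ln ` \<int> :: real set)" by (intro countable_image) (simp add: Ints_def)
  note I = autocorrelation_inversion[OF integrable_\<phi> abs_\<phi>_le A isCont_\<phi>]
  show "integrable lborel (\<lambda>t. (cmod (\<Phi> t))\<^sup>2)" using I(1) by (simp add: \<Phi>_def)
  show "(\<integral>t. (cmod (\<Phi> t))\<^sup>2 *\<^sub>R iexp (t * r) \<partial>lborel) = complex_of_real (2 * pi * (exp (- r / 2) * vasyunin (exp r)))"
    using I(2)[of r] unfolding \<phi>_autocorrelation by (simp add: \<Phi>_def)
qed

lemma exp_half_ln: "exp (ln a / 2) = sqrt a" if "a > 0" for a :: real
  using powr_half_sqrt[of a] that by (simp add: powr_def)

lemma G_integrand_critical_line:
  assumes u: "u > 0" and v: "v > 0" and q: "q \<ge> 1"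
  shows "G_integrand q u v (Complex (1/2) t) = of_real (1 / sqrt (u * v)) *
           ((cmod (\<Phi> t))\<^sup>2 *\<^sub>R iexp (t * ln (v / u))) * of_real (1 / (1/4 + t\<^sup>2)) ^ (q - 1)"
proof -
  let ?s = "Complex (1/2) t" and ?s' = "Complex (1/2) (- t)"
  have c: "1 - ?s = ?s'" by (simp add: complex_eq_iff)
  have s: "?s \<noteq> 0" "?s' \<noteq> 0" by (auto simp: complex_eq_iff)
  have ss: "?s * ?s' = of_real (1/4 + t\<^sup>2)" by (simp add: complex_eq_iff power2_eq_square)
  have z: "zeta ?s = - \<Phi> t * ?s" "zeta ?s' = - cnj (\<Phi> t) * ?s'"
    unfolding \<Phi>_uminus[symmetric] using s by (simp_all add: \<Phi>_eq)
  have p: "complex_of_real a powr - Complex (1/2) b = of_real (1 / sqrt a) * iexp (- (b * ln a))" if "a > 0" for a b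
  proof -
    have "complex_of_real a powr - Complex (1/2) b = exp (- Complex (1/2) b * complex_of_real (ln a))"
      using that by (simp add: powr_def Ln_of_real)
    also have "- Complex (1/2) b * complex_of_real (ln a) = complex_of_real (- ln a / 2) + \<i> * complex_of_real (- (b * ln a))"
      by (simp add: complex_eq_iff)
    also have "exp (complex_of_real (- ln a / 2) + \<i> * complex_of_real (- (b * ln a))) = of_real (exp (- ln a / 2)) * iexp (- (b * ln a))"
      unfolding exp_add exp_of_real ..
    also have "exp (- ln a / 2) = 1 / sqrt a"
    proof -
      have "sqrt a = exp (ln a / 2)" using exp_half_ln[OF that] ..
      thus ?thesis by (simp add: exp_minus inverse_eq_divide)
    qed
    finally show ?thesis .
  qed
  have e: "iexp (- (t * ln u)) * iexp (- (- t * ln v)) = iexp (t * ln (v / u))"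
    using u v by (simp add: exp_add[symmetric] ln_div algebra_simps)
  have "of_real u powr - ?s * of_real v powr - ?s'
      = (of_real (1 / sqrt u) * of_real (1 / sqrt v)) * (iexp (- (t * ln u)) * iexp (- (- t * ln v)))"
    unfolding p[OF u] p[OF v] by (simp only: mult_ac)
  also have "complex_of_real (1 / sqrt u) * of_real (1 / sqrt v) = of_real (1 / sqrt (u * v))"
    by (simp add: real_sqrt_mult)
  finally have uv: "of_real u powr - ?s * of_real v powr - ?s' = of_real (1 / sqrt (u * v)) * iexp (t * ln (v / u))"
    unfolding e .
  obtain k where k: "q = Suc k" using q by (cases q) auto
  have "zeta ?s * zeta ?s' / (?s ^ q * ?s' ^ q) = (\<Phi> t * cnj (\<Phi> t)) * (?s * ?s') / ((?s * ?s') * (?s * ?s') ^ k)"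
    unfolding z k by (simp add: power_mult_distrib mult_ac)
  also have "\<dots> = (\<Phi> t * cnj (\<Phi> t)) * (1 / (?s * ?s')) ^ k"
    using s by (simp add: power_divide)
  also have "\<Phi> t * cnj (\<Phi> t) = of_real ((cmod (\<Phi> t))\<^sup>2)" by (rule complex_norm_square[symmetric])
  also have "1 / (?s * ?s') = of_real (1 / (1/4 + t\<^sup>2))" unfolding ss by simp
  finally have Z: "zeta ?s * zeta ?s' / (?s ^ q * ?s' ^ q) = of_real ((cmod (\<Phi> t))\<^sup>2) * of_real (1 / (1/4 + t\<^sup>2)) ^ k" .
  show ?thesis
    unfolding G_integrand_def c uv Z by (simp add: scaleR_conv_of_real k)
qed

theorem G_1_eq:
  assumes u: "u > 0" and v: "v > 0"
  shows "G 1 u v = of_real (vasyunin (v / u) / v)"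
proof -
  let ?r = "ln (v / u)"
  have "(\<integral>t. G_integrand 1 u v (Complex (1/2) t) * \<i> \<partial>lborel)
     = (\<integral>t. (of_real (1 / sqrt (u * v)) * ((cmod (\<Phi> t))\<^sup>2 *\<^sub>R iexp (t * ?r))) * \<i> \<partial>lborel)"
    by (subst G_integrand_critical_line[OF u v, of 1]) auto
  also have "\<dots> = of_real (1 / sqrt (u * v)) * (\<integral>t. (cmod (\<Phi> t))\<^sup>2 *\<^sub>R iexp (t * ?r) \<partial>lborel) * \<i>"
    by (simp only: integral_mult_left_zero integral_mult_right_zero)
  also have "\<dots> = of_real (1 / sqrt (u * v) * (2 * pi * (exp (- ?r / 2) * vasyunin (v / u)))) * \<i>"
    unfolding \<Phi>_inversion(2) using u v by simp
  finally have "G 1 u v = of_real (1 / sqrt (u * v) * exp (- ?r / 2) * vasyunin (v / u))"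
    unfolding G_def by (simp add: field_simps)
  also have "exp (- ?r / 2) = sqrt u / sqrt v"
  proof -
    have *: "exp (?r / 2) = sqrt (v / u)" using exp_half_ln[of "v / u"] u v by simp
    have "exp (- ?r / 2) = inverse (exp (?r / 2))" by (simp add: exp_minus)
    thus ?thesis unfolding * by (simp add: real_sqrt_divide)
  qed
  also have "1 / sqrt (u * v) * (sqrt u / sqrt v) = 1 / v"
    using u v by (simp add: real_sqrt_mult)
  finally show ?thesis by simp
qed

section \<open>The additional kernel 1 / (1/4 + t^2) for q = 2\<close>

lemma half_line_laplace:
  fixes t :: real
  shows "set_integrable lborel {0..} (\<lambda>y. exp (- y / 2) *\<^sub>R iexp (t * y))"
    and "(LINT y:{0..}|lborel. exp (- y / 2) *\<^sub>R iexp (t * y)) = - 1 / Complex (-1/2) t"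
proof -
  let ?z = "Complex (-1/2) t"
  have e: "exp (- y / 2) *\<^sub>R iexp (t * y) = exp (y *\<^sub>R ?z)" for y
  proof -
    have "y *\<^sub>R ?z = complex_of_real (- y / 2) + \<i> * complex_of_real (t * y)"
      by (simp add: complex_eq_iff)
    thus ?thesis unfolding scaleR_conv_of_real exp_of_real[symmetric] by (simp only: exp_add)
  qed
  have z: "?z \<noteq> 0" by (simp add: complex_eq_iff)
  have "set_integrable lborel {0..} (\<lambda>y::real. exp (- y / 2))"
  proof (rule set_integrable_FTC_nonneg(1)[where F = "\<lambda>y. - 2 * exp (- y / 2)" and L = 0])
    show "((\<lambda>y::real. - 2 * exp (- y / 2)) has_real_derivative exp (- x / 2)) (at x)" for x
      by (auto intro!: derivative_eq_intros)
    show "((\<lambda>y::real. - 2 * exp (- y / 2)) \<longlongrightarrow> 0) at_top" by real_asymp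
  qed (auto simp: set_borel_measurable_def)
  thus int: "set_integrable lborel {0..} (\<lambda>y. exp (- y / 2) *\<^sub>R iexp (t * y))"
    unfolding set_integrable_def
    by (rule Bochner_Integration.integrable_bound) (auto intro!: AE_I2 split: split_indicator)
  have "(LINT y:{0..}|lborel. exp (y *\<^sub>R ?z)) = 0 - exp (0 *\<^sub>R ?z) * inverse ?z"
  proof (rule set_integral_FTC_at_top[where X = "{}" and F = "\<lambda>y. exp (y *\<^sub>R ?z) * inverse ?z"])
    show "set_integrable lborel {0..} (\<lambda>y. exp (y *\<^sub>R ?z))" using int by (simp only: e)
    show "continuous_on {0..} (\<lambda>y. exp (y *\<^sub>R ?z) * inverse ?z)" by (intro continuous_intros)
    have "((\<lambda>y. exp (y *\<^sub>R ?z) * inverse ?z) has_vector_derivative (exp (x *\<^sub>R ?z) * ?z) * inverse ?z) (at x)" for x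
      by (intro has_vector_derivative_mult_left exp_scaleR_has_vector_derivative_right)
    thus "((\<lambda>y. exp (y *\<^sub>R ?z) * inverse ?z) has_vector_derivative exp (x *\<^sub>R ?z)) (at x)" for x
      using z by (simp add: mult.assoc)
    have "((\<lambda>y. exp (y *\<^sub>R ?z)) \<longlongrightarrow> 0) at_top"
    proof (rule Lim_null_comparison)
      show "eventually (\<lambda>y. norm (exp (y *\<^sub>R ?z)) \<le> exp (- y / 2)) at_top"
        by (intro always_eventually allI) (simp add: norm_exp_eq_Re)
      show "((\<lambda>y::real. exp (- y / 2)) \<longlongrightarrow> 0) at_top" by real_asymp
    qed
    thus "((\<lambda>y. exp (y *\<^sub>R ?z) * inverse ?z) \<longlongrightarrow> 0) at_top" by (rule tendsto_mult_left_zero)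
  qed auto
  thus "(LINT y:{0..}|lborel. exp (- y / 2) *\<^sub>R iexp (t * y)) = - 1 / ?z"
    unfolding e by (simp add: inverse_eq_divide)
qed

lemma two_sided_laplace:
  fixes t :: real
  shows "integrable lborel (\<lambda>y. exp (- \<bar>y\<bar> / 2) *\<^sub>R iexp (t * y))"
    and "(\<integral>y. exp (- \<bar>y\<bar> / 2) *\<^sub>R iexp (t * y) \<partial>lborel) = complex_of_real (1 / (1/4 + t\<^sup>2))"
proof -
  define g where "g = (\<lambda>t y. indicator {0..} y *\<^sub>R (exp (- y / 2) *\<^sub>R iexp (t * y)))"
  have g: "integrable lborel (g t)" "integral\<^sup>L lborel (g t) = - 1 / Complex (-1/2) t" for t
    using half_line_laplace[of t] by (simp_all add: g_def set_integrable_def set_lebesgue_integral_def)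
  have g': "integrable lborel (\<lambda>y. g (- t) (- y))" "(\<integral>y. g (- t) (- y) \<partial>lborel) = - 1 / Complex (-1/2) (- t)"
    using lborel_integrable_real_affine[OF g(1)[of "- t"], of "- 1" 0] lborel_integral_real_affine[of "-1" "g (- t)" 0] g(2)[of "- t"]
    by simp_all
  \<comment> \<open>The two half-lines overlap in the point 0, where the sum counts the value
    twice.\<close>
  have ae: "AE y in lborel. g t y + g (- t) (- y) = exp (- \<bar>y\<bar> / 2) *\<^sub>R iexp (t * y)"
    using AE_lborel_singleton[of "0::real"]
    by eventually_elim (auto simp: g_def abs_if split: split_indicator)
  have i: "integrable lborel (\<lambda>y. g t y + g (- t) (- y))" by (intro Bochner_Integration.integrable_add g g')
  have m [measurable]: "(\<lambda>y. exp (- \<bar>y\<bar> / 2) *\<^sub>R iexp (t * y)) \<in> borel_measurable lborel" by measurable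
  show "integrable lborel (\<lambda>y. exp (- \<bar>y\<bar> / 2) *\<^sub>R iexp (t * y))"
    using i integrable_cong_AE[OF borel_measurable_integrable[OF i] m ae] by simp
  have "(\<integral>y. exp (- \<bar>y\<bar> / 2) *\<^sub>R iexp (t * y) \<partial>lborel) = (\<integral>y. g t y + g (- t) (- y) \<partial>lborel)"
    using integral_cong_AE[OF borel_measurable_integrable[OF i] m ae] by simp
  also have "\<dots> = - 1 / Complex (-1/2) t + - 1 / Complex (-1/2) (- t)"
    using g g' by simp
  also have "\<dots> = complex_of_real (1 / (1/4 + t\<^sup>2))"
  proof -
    let ?a = "Complex (-1/2) t" and ?b = "Complex (-1/2) (- t)"
    have n: "?a \<noteq> 0" "?b \<noteq> 0" by (auto simp: complex_eq_iff)
    have "?a * ?b = of_real (1/4 + t\<^sup>2)" "?a + ?b = - 1" by (simp_all add: complex_eq_iff power2_eq_square)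
    moreover have "- 1 / ?a + - 1 / ?b = - (?a + ?b) / (?a * ?b)" using n by (simp add: field_simps)
    ultimately show ?thesis by simp
  qed
  finally show "(\<integral>y. exp (- \<bar>y\<bar> / 2) *\<^sub>R iexp (t * y) \<partial>lborel) = complex_of_real (1 / (1/4 + t\<^sup>2))" .
qed

text \<open>After the shift by r and the substitution w = e^y, the absolute value in the exponent
  splits the domain at w = e^r: below it the weights combine to 1 / w, above it to 1 / w^2.\<close>

lemma vasyunin_double_exponential:
  "(\<integral>y. exp (- \<bar>y\<bar> / 2) * (exp (- (r + y) / 2) * vasyunin (exp (r + y))) \<partial>lborel)
     = exp (- r / 2) * vasyunin_prim (exp r) + exp (r / 2) * (LINT t:{exp r..}|lborel. vasyunin t / t\<^sup>2)"
proof -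
  define f where "f = (\<lambda>w. if w \<le> exp r then exp (- r / 2) * (vasyunin w / w) else exp (r / 2) * (vasyunin w / w\<^sup>2))"
  have f_meas: "f \<in> borel_measurable borel" unfolding f_def by measurable
  have f_exp: "exp y *\<^sub>R f (exp y) = exp (- \<bar>y - r\<bar> / 2) * (exp (- y / 2) * vasyunin (exp y))" for y
  proof (cases "y \<le> r")
    case True
    hence "- \<bar>y - r\<bar> / 2 + - y / 2 = - r / 2" by (simp add: field_simps)
    hence "exp (- \<bar>y - r\<bar> / 2) * exp (- y / 2) = exp (- r / 2)" by (simp only: exp_add[symmetric])
    thus ?thesis using True by (simp add: f_def mult.assoc[symmetric])
  next
    case False
    hence "- \<bar>y - r\<bar> / 2 + - y / 2 = r / 2 - y" by (simp add: field_simps)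
    hence "exp (- \<bar>y - r\<bar> / 2) * exp (- y / 2) = exp (r / 2) / exp y" by (simp only: exp_add[symmetric] exp_diff[symmetric])
    thus ?thesis using False by (simp add: f_def mult.assoc[symmetric] power2_eq_square)
  qed
  have "(\<integral>y. exp (- \<bar>y\<bar> / 2) * (exp (- (r + y) / 2) * vasyunin (exp (r + y))) \<partial>lborel)
      = (\<integral>y. exp (- \<bar>y - r\<bar> / 2) * (exp (- y / 2) * vasyunin (exp y)) \<partial>lborel)"
    using lborel_integral_real_affine[of 1 "\<lambda>y. exp (- \<bar>y - r\<bar> / 2) * (exp (- y / 2) * vasyunin (exp y))" r] by simp
  also have "\<dots> = (LINT w:{0<..}|lborel. f w)"
    unfolding f_exp[symmetric] by (rule integral_exp_substitution[OF f_meas])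
  also have "{0<..} = {0<..exp r} \<union> {exp r<..}" by (auto intro: less_trans[OF exp_gt_zero])
  also have "(LINT w:{0<..exp r} \<union> {exp r<..}|lborel. f w) = (LINT w:{0<..exp r}|lborel. f w) + (LINT w:{exp r<..}|lborel. f w)"
  proof (rule set_integral_Un)
    have "set_integrable lborel {0<..exp r} (\<lambda>w. exp (- r / 2) * (vasyunin w / w))"
      by (intro set_integrable_mult_right vasyunin_over_integrable) simp
    thus "set_integrable lborel {0<..exp r} f"
      by (rule set_integrable_cong[THEN iffD1, rotated 3]) (auto simp: f_def)
    have "set_integrable lborel {exp r<..} (\<lambda>w. exp (r / 2) * (vasyunin w / w\<^sup>2))"
      by (intro set_integrable_mult_right set_integrable_subset[OF set_integrable_vasyunin_over(1)[of "exp r"]]) auto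
    thus "set_integrable lborel {exp r<..} f"
      by (rule set_integrable_cong[THEN iffD1, rotated 3]) (auto simp: f_def)
  qed auto
  also have "(LINT w:{0<..exp r}|lborel. f w) = (LINT w:{0<..exp r}|lborel. exp (- r / 2) * (vasyunin w / w))"
    by (rule set_lebesgue_integral_cong) (auto simp: f_def)
  also have "\<dots> = exp (- r / 2) * vasyunin_prim (exp r)"
    unfolding vasyunin_prim_def by (rule set_integral_mult_right)
  also have "(LINT w:{exp r<..}|lborel. f w) = (LINT w:{exp r<..}|lborel. exp (r / 2) * (vasyunin w / w\<^sup>2))"
    by (rule set_lebesgue_integral_cong) (auto simp: f_def)
  also have "\<dots> = exp (r / 2) * (LINT w:{exp r<..}|lborel. vasyunin w / w\<^sup>2)"
    by (rule set_integral_mult_right)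
  also have "(LINT w:{exp r<..}|lborel. vasyunin w / w\<^sup>2) = (LINT w:{exp r..}|lborel. vasyunin w / w\<^sup>2)"
  proof (rule set_integral_cong_set)
    show "AE x in lborel. (x \<in> {exp r..}) = (x \<in> {exp r<..})"
      using AE_lborel_singleton[of "exp r"] by eventually_elim auto
  qed (simp_all add: set_borel_measurable_def)
  finally show ?thesis .
qed

text \<open>With the kernel written as a transform in y, every inner t-integral is the unweighted
  inversion at the shifted point r + y. The exchange is licensed by integrability of the squared
  modulus in t and of the double exponential in y.\<close>

lemma \<Phi>_inversion_weighted:
  "(\<integral>t. (cmod (\<Phi> t))\<^sup>2 *\<^sub>R iexp (t * r) * of_real (1 / (1/4 + t\<^sup>2)) \<partial>lborel)
     = complex_of_real (2 * pi * (exp (- r / 2) * vasyunin_prim (exp r)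
         + exp (r / 2) * (LINT t:{exp r..}|lborel. vasyunin t / t\<^sup>2)))"
proof -
  let ?q = "\<lambda>t. (cmod (\<Phi> t))\<^sup>2"
  let ?F = "\<lambda>t y. (?q t * exp (- \<bar>y\<bar> / 2)) *\<^sub>R iexp (t * (r + y))"
  have [measurable]: "?q \<in> borel_measurable borel" using \<Phi>_inversion(1) by auto
  have e: "integrable lborel (\<lambda>y::real. exp (- \<bar>y\<bar> / 2))"
    using integrable_norm[OF two_sided_laplace(1)[of 0]] by simp
  have F_eq: "?F t y = (?q t *\<^sub>R iexp (t * r)) * (exp (- \<bar>y\<bar> / 2) *\<^sub>R iexp (t * y))" for t y
  proof -
    have "iexp (t * (r + y)) = iexp (t * r) * iexp (t * y)"
      by (simp add: exp_add[symmetric] distrib_left)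
    thus ?thesis by simp
  qed
  have F_eq': "?F t y = exp (- \<bar>y\<bar> / 2) *\<^sub>R (?q t *\<^sub>R iexp (t * (r + y)))" for t y by simp
  have int: "integrable (lborel \<Otimes>\<^sub>M lborel) (case_prod ?F)"
  proof (rule lborel_pair.Fubini_integrable)
    have "integrable lborel (\<lambda>t. ?q t * (\<integral>y. exp (- \<bar>y\<bar> / 2) \<partial>lborel))"
      by (intro integrable_mult_left \<Phi>_inversion(1))
    thus "integrable lborel (\<lambda>t. \<integral>y. norm (case_prod ?F (t, y)) \<partial>lborel)" by simp
    show "AE t in lborel. integrable lborel (\<lambda>y. case_prod ?F (t, y))"
      unfolding prod.case F_eq by (intro AE_I2 integrable_mult_right two_sided_laplace(1))
  qed measurable
  have "(\<integral>t. ?q t *\<^sub>R iexp (t * r) * of_real (1 / (1/4 + t\<^sup>2)) \<partial>lborel) = (\<integral>t. (\<integral>y. ?F t y \<partial>lborel) \<partial>lborel)"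
    unfolding F_eq integral_mult_right_zero two_sided_laplace(2) ..
  also have "\<dots> = (\<integral>y. (\<integral>t. ?F t y \<partial>lborel) \<partial>lborel)"
    by (rule lborel_pair.Fubini_integral[OF int, symmetric])
  also have "\<dots> = (\<integral>y. complex_of_real (2 * pi * (exp (- \<bar>y\<bar> / 2) * (exp (- (r + y) / 2) * vasyunin (exp (r + y))))) \<partial>lborel)"
    unfolding F_eq' integral_scaleR_right \<Phi>_inversion(2)
    by (rule Bochner_Integration.integral_cong[OF refl]) (simp add: scaleR_conv_of_real)
  also have "\<dots> = complex_of_real (2 * pi * (\<integral>y. exp (- \<bar>y\<bar> / 2) * (exp (- (r + y) / 2) * vasyunin (exp (r + y))) \<partial>lborel))"
    unfolding integral_complex_of_real integral_mult_right_zero ..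
  finally show ?thesis unfolding vasyunin_double_exponential .
qed

theorem G_2_eq:
  assumes u: "u > 0" and v: "v > 0"
  defines "x \<equiv> v / u"
  shows "G 2 u v = of_real ((vasyunin_prim x / x + (LINT t:{x..}|lborel. vasyunin t / t\<^sup>2)) / u)"
proof -
  let ?r = "ln x"
  let ?P = "vasyunin_prim x" and ?T = "LINT t:{x..}|lborel. vasyunin t / t\<^sup>2"
  have x: "x > 0" using u v by (simp add: x_def)
  have "(\<integral>t. G_integrand 2 u v (Complex (1/2) t) * \<i> \<partial>lborel)
     = (\<integral>t. (of_real (1 / sqrt (u * v)) * ((cmod (\<Phi> t))\<^sup>2 *\<^sub>R iexp (t * ?r) * of_real (1 / (1/4 + t\<^sup>2)))) * \<i> \<partial>lborel)"
    by (subst G_integrand_critical_line[OF u v, of 2]) (simp_all add: x_def mult.assoc)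
  also have "\<dots> = of_real (1 / sqrt (u * v)) * (\<integral>t. (cmod (\<Phi> t))\<^sup>2 *\<^sub>R iexp (t * ?r) * of_real (1 / (1/4 + t\<^sup>2)) \<partial>lborel) * \<i>"
    by (simp only: integral_mult_left_zero integral_mult_right_zero)
  also have "\<dots> = of_real (1 / sqrt (u * v) * (2 * pi * (exp (- ?r / 2) * ?P + exp (?r / 2) * ?T))) * \<i>"
    unfolding \<Phi>_inversion_weighted exp_ln[OF x] by simp
  finally have *: "(\<integral>t. G_integrand 2 u v (Complex (1/2) t) * \<i> \<partial>lborel)
     = of_real (1 / sqrt (u * v) * (2 * pi * (exp (- ?r / 2) * ?P + exp (?r / 2) * ?T))) * \<i>" .
  have "1 / (2 * of_real pi * \<i>) * (of_real (c * (2 * pi * d)) * \<i>) = complex_of_real (c * d)" for c d by simp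
  hence "G 2 u v = of_real (1 / sqrt (u * v) * (exp (- ?r / 2) * ?P + exp (?r / 2) * ?T))"
    unfolding G_def * .
  also have "1 / sqrt (u * v) * (exp (- ?r / 2) * ?P + exp (?r / 2) * ?T)
     = (1 / sqrt (u * v) * exp (- ?r / 2)) * ?P + (1 / sqrt (u * v) * exp (?r / 2)) * ?T"
    by (simp only: distrib_left mult.assoc)
  also have "exp (?r / 2) = sqrt v / sqrt u"
    using exp_half_ln[OF x] by (simp add: x_def real_sqrt_divide)
  also have "exp (- ?r / 2) = sqrt u / sqrt v"
    using exp_half_ln[OF x] by (simp add: x_def real_sqrt_divide exp_minus)
  also have "1 / sqrt (u * v) * (sqrt u / sqrt v) = 1 / (x * u)"
    using u v by (simp add: real_sqrt_mult x_def)
  also have "1 / sqrt (u * v) * (sqrt v / sqrt u) = 1 / u"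
    using u v by (simp add: real_sqrt_mult)
  finally show ?thesis by (simp add: add_divide_distrib)
qed

section \<open>The quadratic forms\<close>

lemma G_1_conv_S1:
  assumes u: "u > 0" and v: "v > 0"
  shows "G 1 u v = of_real (S1 (v / u) / u + (K + (ln v - ln u) / 2) / v)"
proof -
  have x: "v / u > 0" using u v by simp
  have "vasyunin (v / u) / v = S1 (v / u) / u + (K + (ln v - ln u) / 2) / v"
    unfolding vasyunin_conv_S1(2)[OF x] using u v by (simp add: ln_div add_divide_distrib)
  thus ?thesis unfolding G_1_eq[OF u v] by simp
qed

lemma G_2_conv_S2:
  assumes u: "u > 0" and v: "v > 0"
  shows "G 2 u v = of_real (S2 (v / u) / u + (K2 + K1 * (ln v - ln u) + (ln v - ln u)\<^sup>2 / 4) / v)"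
proof -
  have x: "v / u > 0" using u v by simp
  have l: "ln (v / u) = ln v - ln u" using u v by (simp add: ln_div)
  show ?thesis
    unfolding G_2_eq[OF u v] vasyunin_second_order[OF x] l using u v by (simp add: add_divide_distrib)
qed

text \<open>For m = 1 the floor is 1 and the fractional part 0, where the pattern of m > 1 would
  give 0 and 1; the resulting changes in \<open>R1\<close> cancel, so a single formula covers all
  m.\<close>

lemma R1_inverse_nat:
  assumes "m \<ge> 1"
  shows "R1 (1 / real m) / real m = 1/2 + (\<gamma>0 - 1) / real m - ln (real m) / real m"
proof (cases "m = 1")
  case True
  thus ?thesis by (simp add: R1_def H_def harm_def)
next
  case False
  hence m: "m > 1" using assms by simp
  hence "\<lfloor>1 / real m\<rfloor> = 0" by (simp add: floor_eq_iff)
  hence "H (1 / real m) = 0" "frac (1 / real m) = 1 / real m" by (simp_all add: H_def frac_def harm_def)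
  thus ?thesis using m by (simp add: R1_def ln_div field_simps)
qed

text \<open>The sum is empty for m > 1, and for m = 1 its only term, at the ratio 1, is
  zero.\<close>

lemma R2_inverse_nat:
  assumes "m \<ge> 1"
  shows "R2 (1 / real m) / real m = (ln (2 * pi) / 2 + 1) - ln (real m) / 2 - (2 - \<gamma>0) * (ln (real m) / real m)
           - (ln (real m))\<^sup>2 / real m / 2 + (2 * \<gamma>0 + \<gamma>1 - 3) / real m"
proof -
  have "(\<Sum>l = 1..nat \<lfloor>1 / real m\<rfloor>. (1 + 1 / real m / real l) * ln (1 / real m / real l) + 2 * (1 - 1 / real m / real l)) = 0"
  proof (cases "m = 1")
    case False
    hence "\<lfloor>1 / real m\<rfloor> = 0" using assms by (simp add: floor_eq_iff)
    thus ?thesis by simp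
  qed simp
  hence R: "R2 (1 / real m) = real m * (1/2 * ln (2 * pi) + 1 + 1/2 * ln (1 / real m)) + (2 - \<gamma>0) * ln (1 / real m)
          - 1/2 * (ln (1 / real m))\<^sup>2 + 2 * \<gamma>0 + \<gamma>1 - 3"
    by (simp add: R2_def)
  have l: "ln (1 / real m) = - ln (real m)" using assms by (simp add: ln_div)
  have "(M * (1/2 * \<Lambda> + 1 + 1/2 * (- z)) + (2 - g) * (- z) - 1/2 * (- z)\<^sup>2 + 2 * g + h - 3) / M
      = (\<Lambda> / 2 + 1) - z / 2 - (2 - g) * (z / M) - z\<^sup>2 / M / 2 + (2 * g + h - 3) / M" if "M > 0" for M \<Lambda> z g h :: real
    using that by (simp add: add_divide_distrib diff_divide_distrib left_diff_distrib)
  thus ?thesis unfolding R l using assms by simp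
qed

theorem mainTheorem6:
  fixes N :: nat and a :: "nat \<Rightarrow> real"
    and Q :: "nat \<Rightarrow> complex" and L M :: "nat \<Rightarrow> real" and E1 E2 :: real
  assumes "N \<ge> 1"
  defines "Q \<equiv> \<lambda>q. \<Sum>m = 1..N. \<Sum>n = 1..N. of_real (a m) * of_real (a n) * G q (real m) (real n)"
    and "L \<equiv> \<lambda>j. \<Sum>n = 1..N. a n / real n * ln (real n) ^ j"
    and "M \<equiv> \<lambda>j. \<Sum>n = 1..N. a n * ln (real n) ^ j"
    and "E1 \<equiv> \<Sum>m = 1..N. a m / real m *
           ((\<Sum>n = 1..N. a n * S1 (real n / real m)) - R1 (1 / real m))"
    and "E2 \<equiv> \<Sum>m = 1..N. a m / real m *
           ((\<Sum>n = 1..N. a n * S2 (real n / real m)) - R2 (1 / real m))"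
  shows "Q 1 = of_real
           (M 0 * (K * L 0 + 1/2 * (L 1 + 1)) - 1/2 * M 1 * L 0
            + (\<gamma>0 - 1) * L 0 - L 1 + E1)
       \<and> Q 2 = of_real
           (M 0 * (K2 * L 0 + K1 * (L 1 + 1) + 1/4 * (2 * \<gamma>0 + L 2))
            - 1/2 * M 1 * (2 * K1 * L 0 + L 1 + 1) + 1/4 * M 2 * L 0
            + (2 * \<gamma>0 + \<gamma>1 - 3) * L 0 + 1/2 * (2 * \<gamma>0 * L 1 - L 2) - 2 * L 1 + E2)"
proof
  let ?l = "\<lambda>n. ln (real n)"
  let ?D = "\<lambda>S. \<Sum>m = 1..N. a m / real m * (\<Sum>n = 1..N. a n * S (real n / real m))"
  \<comment> \<open>Outside the remainder sums only the denominator n occurs, which ties the powers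
    of ln m to \<open>M\<close> and those of ln n to \<open>L\<close>.\<close>
  have prods: "M i * L j = (\<Sum>m = 1..N. \<Sum>n = 1..N. a m * a n * (?l m ^ i * ?l n ^ j / real n))" for i j
    unfolding M_def L_def sum_product by (simp add: mult_ac)
  have D: "(\<Sum>m = 1..N. \<Sum>n = 1..N. a m * a n * (S (real n / real m) / real m)) = ?D S" for S :: "real \<Rightarrow> real"
    by (simp add: sum_distrib_left mult_ac)

  have lin: "(\<Sum>m = 1..N. \<Sum>n = 1..N. c * f m n) = c * (\<Sum>m = 1..N. \<Sum>n = 1..N. f m n)" for c :: real and f
    by (simp only: sum_distrib_left)
  have R: "(\<Sum>m = 1..N. a m / real m * R1 (1 / real m)) = M 0 / 2 + (\<gamma>0 - 1) * L 0 - L 1"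
  proof -
    have "(\<Sum>m = 1..N. a m / real m * R1 (1 / real m))
        = (\<Sum>m = 1..N. a m * ?l m ^ 0 * (1/2) + (\<gamma>0 - 1) * (a m / real m * ?l m ^ 0) - a m / real m * ?l m ^ 1)"
    proof (rule sum.cong[OF refl])
      fix m assume "m \<in> {1..N}"
      hence "a m / real m * R1 (1 / real m) = a m * (1/2 + (\<gamma>0 - 1) / real m - ?l m / real m)"
        by (simp add: R1_inverse_nat[symmetric])
      thus "a m / real m * R1 (1 / real m) = a m * ?l m ^ 0 * (1/2) + (\<gamma>0 - 1) * (a m / real m * ?l m ^ 0) - a m / real m * ?l m ^ 1"
        by (simp add: distrib_left right_diff_distrib left_diff_distrib diff_divide_distrib)
    qed
    also have "\<dots> = M 0 * (1/2) + (\<gamma>0 - 1) * L 0 - L 1"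
      unfolding sum.distrib sum_subtractf sum_distrib_left[symmetric] sum_distrib_right[symmetric] M_def L_def ..
    finally show ?thesis by simp
  qed
  have E: "E1 = ?D S1 - (M 0 / 2 + (\<gamma>0 - 1) * L 0 - L 1)"
    unfolding R[symmetric] E1_def by (simp add: right_diff_distrib sum_subtractf)
  have "Q 1 = of_real (\<Sum>m = 1..N. \<Sum>n = 1..N. a m * a n * (S1 (real n / real m) / real m + (K + (?l n - ?l m) / 2) / real n))"
    unfolding Q_def of_real_sum
    by (intro sum.cong refl, subst G_1_conv_S1) (simp_all only: of_real_mult of_nat_0_less_iff atLeastAtMost_iff, simp_all)
  also have "(\<Sum>m = 1..N. \<Sum>n = 1..N. a m * a n * (S1 (real n / real m) / real m + (K + (?l n - ?l m) / 2) / real n))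
     = (\<Sum>m = 1..N. \<Sum>n = 1..N. a m * a n * (S1 (real n / real m) / real m) + K * (a m * a n * (?l m ^ 0 * ?l n ^ 0 / real n))
         + 1/2 * (a m * a n * (?l m ^ 0 * ?l n ^ 1 / real n)) - 1/2 * (a m * a n * (?l m ^ 1 * ?l n ^ 0 / real n)))"
    by (intro sum.cong refl) (simp add: distrib_left right_diff_distrib add_divide_distrib diff_divide_distrib)
  also have "\<dots> = ?D S1 + K * (M 0 * L 0) + 1/2 * (M 0 * L 1) - 1/2 * (M 1 * L 0)"
    unfolding sum.distrib sum_subtractf lin prods[symmetric] D ..
  also have "\<dots> = M 0 * (K * L 0 + 1/2 * (L 1 + 1)) - 1/2 * M 1 * L 0 + (\<gamma>0 - 1) * L 0 - L 1 + E1"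
    unfolding E by (simp add: distrib_left)
  finally show "Q 1 = of_real (M 0 * (K * L 0 + 1/2 * (L 1 + 1)) - 1/2 * M 1 * L 0 + (\<gamma>0 - 1) * L 0 - L 1 + E1)" .

  have R: "(\<Sum>m = 1..N. a m / real m * R2 (1 / real m))
      = (K1 + \<gamma>0 / 2) * M 0 - 1/2 * M 1 - (2 - \<gamma>0) * L 1 - 1/2 * L 2 + (2 * \<gamma>0 + \<gamma>1 - 3) * L 0"
  proof -
    have "(\<Sum>m = 1..N. a m / real m * R2 (1 / real m))
        = (\<Sum>m = 1..N. (K1 + \<gamma>0 / 2) * (a m * ?l m ^ 0) - 1/2 * (a m * ?l m ^ 1) - (2 - \<gamma>0) * (a m / real m * ?l m ^ 1)
              - 1/2 * (a m / real m * ?l m ^ 2) + (2 * \<gamma>0 + \<gamma>1 - 3) * (a m / real m * ?l m ^ 0))"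
    proof (rule sum.cong[OF refl])
      fix m assume m: "m \<in> {1..N}"
      \<comment> \<open>This form of the constant is the source of the 1 in
        \<open>K1 * (L 1 + 1)\<close> and of the term with 2 \<gamma> in the factor of
        \<open>M 0\<close>.\<close>
      have k: "ln (2 * pi) / 2 + 1 = K1 + \<gamma>0 / 2" by (simp add: K1_def field_simps)
      have "a m / real m * R2 (1 / real m) = a m * (R2 (1 / real m) / real m)" by simp
      also have "R2 (1 / real m) / real m = (K1 + \<gamma>0 / 2) - ?l m / 2 - (2 - \<gamma>0) * (?l m / real m)
           - (?l m)\<^sup>2 / real m / 2 + (2 * \<gamma>0 + \<gamma>1 - 3) / real m"
        unfolding k[symmetric] by (rule R2_inverse_nat) (use m in simp)
      finally have e: "a m / real m * R2 (1 / real m) = a m * \<dots>" .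
      have "A * (k - z / 2 - c * (z / x) - z\<^sup>2 / x / 2 + d / x)
          = k * (A * z ^ 0) - 1/2 * (A * z ^ 1) - c * (A / x * z ^ 1) - 1/2 * (A / x * z ^ 2) + d * (A / x * z ^ 0)"
        for A k z c x d :: real by (simp add: distrib_left right_diff_distrib mult_ac)
      thus "a m / real m * R2 (1 / real m)
          = (K1 + \<gamma>0 / 2) * (a m * ?l m ^ 0) - 1/2 * (a m * ?l m ^ 1) - (2 - \<gamma>0) * (a m / real m * ?l m ^ 1)
              - 1/2 * (a m / real m * ?l m ^ 2) + (2 * \<gamma>0 + \<gamma>1 - 3) * (a m / real m * ?l m ^ 0)"
        unfolding e .
    qed
    also have "\<dots> = (K1 + \<gamma>0 / 2) * M 0 - 1/2 * M 1 - (2 - \<gamma>0) * L 1 - 1/2 * L 2 + (2 * \<gamma>0 + \<gamma>1 - 3) * L 0"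
      unfolding sum.distrib sum_subtractf sum_distrib_left[symmetric] M_def L_def ..
    finally show ?thesis .
  qed
  have E: "E2 = ?D S2 - ((K1 + \<gamma>0 / 2) * M 0 - 1/2 * M 1 - (2 - \<gamma>0) * L 1 - 1/2 * L 2 + (2 * \<gamma>0 + \<gamma>1 - 3) * L 0)"
    unfolding R[symmetric] E2_def by (simp add: right_diff_distrib sum_subtractf)
  have "Q 2 = of_real (\<Sum>m = 1..N. \<Sum>n = 1..N. a m * a n *
      (S2 (real n / real m) / real m + (K2 + K1 * (?l n - ?l m) + (?l n - ?l m)\<^sup>2 / 4) / real n))"
    unfolding Q_def of_real_sum
    by (intro sum.cong refl, subst G_2_conv_S2) (simp_all only: of_real_mult of_nat_0_less_iff atLeastAtMost_iff, simp_all)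
  also have "(\<Sum>m = 1..N. \<Sum>n = 1..N. a m * a n *
      (S2 (real n / real m) / real m + (K2 + K1 * (?l n - ?l m) + (?l n - ?l m)\<^sup>2 / 4) / real n))
     = (\<Sum>m = 1..N. \<Sum>n = 1..N. a m * a n * (S2 (real n / real m) / real m)
         + K2 * (a m * a n * (?l m ^ 0 * ?l n ^ 0 / real n))
         + K1 * (a m * a n * (?l m ^ 0 * ?l n ^ 1 / real n)) - K1 * (a m * a n * (?l m ^ 1 * ?l n ^ 0 / real n))
         + 1/4 * (a m * a n * (?l m ^ 0 * ?l n ^ 2 / real n)) - 1/2 * (a m * a n * (?l m ^ 1 * ?l n ^ 1 / real n))
         + 1/4 * (a m * a n * (?l m ^ 2 * ?l n ^ 0 / real n)))"
  proof (intro sum.cong refl)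
    fix m n
    have "A * (s + (k2 + k1 * (y - x) + (y - x)\<^sup>2 / 4) / n)
        = A * s + k2 * (A * (x ^ 0 * y ^ 0 / n)) + k1 * (A * (x ^ 0 * y ^ 1 / n)) - k1 * (A * (x ^ 1 * y ^ 0 / n))
          + 1/4 * (A * (x ^ 0 * y ^ 2 / n)) - 1/2 * (A * (x ^ 1 * y ^ 1 / n)) + 1/4 * (A * (x ^ 2 * y ^ 0 / n))"
      for A s k2 k1 x y n :: real
    proof -
      have q: "(y - x)\<^sup>2 / 4 = 1/4 * y\<^sup>2 - 1/2 * (x * y) + 1/4 * x\<^sup>2"
        by (simp add: power2_diff add_divide_distrib diff_divide_distrib)
      show ?thesis
        unfolding q by (simp add: distrib_left right_diff_distrib add_divide_distrib diff_divide_distrib mult_ac)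
    qed
    thus "a m * a n * (S2 (real n / real m) / real m + (K2 + K1 * (?l n - ?l m) + (?l n - ?l m)\<^sup>2 / 4) / real n)
      = a m * a n * (S2 (real n / real m) / real m)
         + K2 * (a m * a n * (?l m ^ 0 * ?l n ^ 0 / real n))
         + K1 * (a m * a n * (?l m ^ 0 * ?l n ^ 1 / real n)) - K1 * (a m * a n * (?l m ^ 1 * ?l n ^ 0 / real n))
         + 1/4 * (a m * a n * (?l m ^ 0 * ?l n ^ 2 / real n)) - 1/2 * (a m * a n * (?l m ^ 1 * ?l n ^ 1 / real n))
         + 1/4 * (a m * a n * (?l m ^ 2 * ?l n ^ 0 / real n))" .
  qed
  also have "\<dots> = ?D S2 + K2 * (M 0 * L 0) + K1 * (M 0 * L 1) - K1 * (M 1 * L 0) + 1/4 * (M 0 * L 2) - 1/2 * (M 1 * L 1) + 1/4 * (M 2 * L 0)"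
    unfolding sum.distrib sum_subtractf lin prods[symmetric] D ..
  also have "\<dots> = M 0 * (K2 * L 0 + K1 * (L 1 + 1) + 1/4 * (2 * \<gamma>0 + L 2))
            - 1/2 * M 1 * (2 * K1 * L 0 + L 1 + 1) + 1/4 * M 2 * L 0
            + (2 * \<gamma>0 + \<gamma>1 - 3) * L 0 + 1/2 * (2 * \<gamma>0 * L 1 - L 2) - 2 * L 1 + E2"
    unfolding E by (simp add: distrib_left distrib_right left_diff_distrib right_diff_distrib)
  finally show "Q 2 = of_real
           (M 0 * (K2 * L 0 + K1 * (L 1 + 1) + 1/4 * (2 * \<gamma>0 + L 2))
            - 1/2 * M 1 * (2 * K1 * L 0 + L 1 + 1) + 1/4 * M 2 * L 0
            + (2 * \<gamma>0 + \<gamma>1 - 3) * L 0 + 1/2 * (2 * \<gamma>0 * L 1 - L 2) - 2 * L 1 + E2)" .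
qed

end
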